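(* Let $r_1:[0,m_1]\to\mathbb R$ and $r_2:[0,m_2]\to\mathbb R$ be the profile functions of metrics $g_1,g_2\in\mathcal G$. Then $g_1$ and $g_2$ are isospectral if, and only if, for every $\rho\ge0$ we have \[ \mathrm{length}\left(\{\sigma\in[0,m_1]\mid r_1(\sigma)\ge\rho\}\right)=\mathrm{length}\left(\{\sigma\in[0,m_2]\mid r_2(\sigma)\ge\rho\}\right), \] where $\mathrm{length}(I)$ denotes the length of the interval $I\subset\mathbb R$.
   Context: Let $S^1=\mathbb R/2\pi\mathbb Z$ act on the unit sphere $S^2\subset\mathbb R^3$ by rotations about the $z$-axis. $\mathcal G$ is the set of $S^1$-invariant smooth Riemannian metrics on $S^2$ possessing a unique equator, i.e. a single $S^1$-invariant unoriented closed geodesic. Away from the two poles, $g\in\mathcal G$ is uniquely written as $g=d\sigma^2+r(\sigma)^2d\theta^2$, where $\theta\in S^1$ is the longitude, $\sigma\in(0,m)$ is the $g$-distance from the south pole along meridians, and $m$ is the length of the meridian arc between the poles. The function $r:[0,m]\to\mathbb R$ is the profile function of $g$: it is positive on $(0,m)$, vanishes at $0$ and $m$, has a unique critical point in $(0,m)$ (necessarily a maximum, corresponding to the equator), and extends to a smooth $2m$-periodic odd function on $\mathbb R$ with $r'(0)=1=-r'(m)$. Marked length spectrum: a meridian is a closed geodesic through the two poles. Any unoriented closed geodesic that is neither the equator nor a meridian is of type $(p,q)$, where $p\in\{1,2,\dots\}$ is (the absolute value of) its winding number around the $z$-axis and $2q$, $q\in\{1,2,\dots\}$, is the number of its (transverse)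 intersections with the equator; one has $\gcd(p,q)=1$. For coprime $p,q\ge1$, $\mathcal L_g(p,q)\subset(0,+\infty)$ is the (possibly empty) set of lengths of all closed geodesics of type $(p,q)$. The marked length spectrum of $g$ is the datum of the length of the equator and of the set-valued function $\mathcal L_g$. Two metrics in $\mathcal G$ are isospectral if they have the same marked length spectrum. *)

theory Defs
  imports "HOL-Complex_Analysis.Complex_Analysis"
begin

section \<open>Smooth maps on open subsets of Euclidean spaces\<close>

text \<open>For an open set \<open>S\<close>, \<open>Ck_on k f S\<close> says that \<open>f\<close> is of class $C^k$ on \<open>S\<close>: a map is $C^{k+1}$
  iff it is differentiable and all its directional derivatives are $C^k$.\<close>

primrec Ck_on :: "nat \<Rightarrow> ('a::euclidean_space \<Rightarrow> 'b::real_normed_vector) \<Rightarrow> 'a set \<Rightarrow> bool" where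
  "Ck_on 0 f S \<longleftrightarrow> continuous_on S f"
| "Ck_on (Suc k) f S \<longleftrightarrow> (\<forall>x\<in>S. f differentiable (at x)) \<and>
     (\<forall>v. Ck_on k (\<lambda>x. frechet_derivative f (at x) v) S)"

definition smooth_on :: "('a::euclidean_space \<Rightarrow> 'b::real_normed_vector) \<Rightarrow> 'a set \<Rightarrow> bool" where
  "smooth_on f S \<longleftrightarrow> (\<forall>k. Ck_on k f S)"


section \<open>The sphere, its poles, and rotations about the z-axis\<close>

abbreviation S2 :: "(real^3) set" where
  "S2 \<equiv> sphere 0 1"

definition tangent_S2 :: "real^3 \<Rightarrow> (real^3) set" where
  "tangent_S2 x = {v. v \<bullet> x = 0}"

definition south_pole :: "real^3" where "south_pole = vector [0, 0, -1]"

definition north_pole :: "real^3" where "north_pole = vector [0, 0, 1]"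

definition rotz :: "real \<Rightarrow> real^3 \<Rightarrow> real^3" where
  "rotz \<alpha> x = vector [cos \<alpha> * x$1 - sin \<alpha> * x$2, sin \<alpha> * x$1 + cos \<alpha> * x$2, x$3]"


section \<open>Riemannian metrics on the sphere\<close>

text \<open>\<open>g x u v\<close> is the inner product of \<open>u\<close> and \<open>v\<close> at \<open>x\<close>; only its values for \<open>x\<close> in the sphere and
  \<open>u\<close>, \<open>v\<close> tangent at \<open>x\<close> are meaningful. Smoothness of the tensor on the submanifold \<open>S2\<close>
  (and bilinearity) is expressed by a smooth local extension to the ambient space.\<close>

type_synonym metric = "real^3 \<Rightarrow> real^3 \<Rightarrow> real^3 \<Rightarrow> real"

definition riemannian_metric :: "metric \<Rightarrow> bool" where
  "riemannian_metric g \<longleftrightarrow>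
     (\<exists>U h. open U \<and> S2 \<subseteq> U \<and> (\<forall>x\<in>U. bilinear (h x)) \<and>
        (\<forall>u v. smooth_on (\<lambda>x. h x u v :: real) U) \<and>
        (\<forall>x\<in>S2. \<forall>u\<in>tangent_S2 x. \<forall>v\<in>tangent_S2 x. g x u v = h x u v)) \<and>
     (\<forall>x\<in>S2. \<forall>u\<in>tangent_S2 x. \<forall>v\<in>tangent_S2 x. g x u v = g x v u) \<and>
     (\<forall>x\<in>S2. \<forall>u\<in>tangent_S2 x. u \<noteq> 0 \<longrightarrow> g x u u > 0)"

definition rotation_invariant :: "metric \<Rightarrow> bool" where
  "rotation_invariant g \<longleftrightarrow>
     (\<forall>\<alpha>. \<forall>x\<in>S2. \<forall>u\<in>tangent_S2 x. \<forall>v\<in>tangent_S2 x.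
        g (rotz \<alpha> x) (rotz \<alpha> u) (rotz \<alpha> v) = g x u v)"


section \<open>Geodesics\<close>

definition curve_length :: "metric \<Rightarrow> real \<Rightarrow> real \<Rightarrow> (real \<Rightarrow> real^3) \<Rightarrow> real" where
  "curve_length g a b \<gamma> = integral {a..b}
     (\<lambda>t. sqrt (g (\<gamma> t) (vector_derivative \<gamma> (at t)) (vector_derivative \<gamma> (at t))))"

definition energy :: "metric \<Rightarrow> real \<Rightarrow> real \<Rightarrow> (real \<Rightarrow> real^3) \<Rightarrow> real" where
  "energy g a b \<gamma> = 1/2 * integral {a..b}
     (\<lambda>t. g (\<gamma> t) (vector_derivative \<gamma> (at t)) (vector_derivative \<gamma> (at t)))"

text \<open>Geodesics are the critical points of the energy: on every compact interval the first
  variation vanishes for all smooth variations \<open>\<Gamma> (s, t)\<close> with fixed endpoints. In particular they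
  have constant speed.\<close>

definition geodesic :: "metric \<Rightarrow> (real \<Rightarrow> real^3) \<Rightarrow> bool" where
  "geodesic g \<gamma> \<longleftrightarrow> smooth_on \<gamma> UNIV \<and> range \<gamma> \<subseteq> S2 \<and>
     (\<forall>a b \<Gamma>. a < b \<longrightarrow> smooth_on \<Gamma> (UNIV :: (real \<times> real) set) \<longrightarrow> range \<Gamma> \<subseteq> S2 \<longrightarrow>
        (\<forall>t. \<Gamma> (0, t) = \<gamma> t) \<longrightarrow> (\<forall>s. \<Gamma> (s, a) = \<gamma> a \<and> \<Gamma> (s, b) = \<gamma> b) \<longrightarrow>
        ((\<lambda>s. energy g a b (\<lambda>t. \<Gamma> (s, t))) has_real_derivative 0) (at 0))"

text \<open>\<open>T\<close> is the minimal period, so closed geodesics are traversed exactly once; constant curves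
  have no minimal period and are thereby excluded.\<close>

definition closed_geodesic :: "metric \<Rightarrow> (real \<Rightarrow> real^3) \<Rightarrow> real \<Rightarrow> bool" where
  "closed_geodesic g \<gamma> T \<longleftrightarrow> geodesic g \<gamma> \<and> T > 0 \<and> (\<forall>t. \<gamma> (t + T) = \<gamma> t) \<and>
     (\<forall>s. 0 < s \<and> s < T \<longrightarrow> (\<exists>t. \<gamma> (t + s) \<noteq> \<gamma> t))"


section \<open>Metrics with a unique equator\<close>

definition is_equator :: "metric \<Rightarrow> (real^3) set \<Rightarrow> bool" where
  "is_equator g E \<longleftrightarrow>
     (\<exists>\<gamma> T. closed_geodesic g \<gamma> T \<and> E = range \<gamma>) \<and> (\<forall>\<alpha>. rotz \<alpha> ` E = E)"

definition metrics_unique_equator :: "metric set" where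
  "metrics_unique_equator =
     {g. riemannian_metric g \<and> rotation_invariant g \<and> (\<exists>!E. is_equator g E)}"

definition equator :: "metric \<Rightarrow> (real^3) set" where
  "equator g = (THE E. is_equator g E)"

definition equator_length :: "metric \<Rightarrow> real" where
  "equator_length g =
     (THE l. \<exists>\<gamma> T. closed_geodesic g \<gamma> T \<and> range \<gamma> = equator g \<and> l = curve_length g 0 T \<gamma>)"


section \<open>Profile functions\<close>

text \<open>\<open>\<Phi> (\<sigma>, \<theta>)\<close> are polar coordinates adapted to \<open>g\<close>, in which \<open>g = d\<sigma>\<^sup>2 + r(\<sigma>)\<^sup>2 d\<theta>\<^sup>2\<close>: the rotation
  by \<open>\<alpha>\<close> acts as \<open>\<theta> \<mapsto> \<theta> + \<alpha>\<close>, and the curves \<open>\<theta> = const\<close> are the meridian arcs, parametrized by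
  arc length starting at the south pole. For an invariant metric they need not be contained in
  half-planes through the z-axis, hence \<open>\<theta>\<close> is not required to be the Euclidean longitude.\<close>

definition polar_coordinates ::
  "metric \<Rightarrow> real \<Rightarrow> (real \<Rightarrow> real) \<Rightarrow> (real \<times> real \<Rightarrow> real^3) \<Rightarrow> bool" where
  "polar_coordinates g m r \<Phi> \<longleftrightarrow>
     smooth_on \<Phi> ({0<..<m} \<times> UNIV) \<and>
     bij_betw \<Phi> ({0<..<m} \<times> {0..<2*pi}) (S2 - {south_pole, north_pole}) \<and>
     (\<forall>\<sigma>\<in>{0<..<m}. \<forall>\<theta> \<alpha>. \<Phi> (\<sigma>, \<theta> + \<alpha>) = rotz \<alpha> (\<Phi> (\<sigma>, \<theta>))) \<and>
     (\<forall>\<theta>. ((\<lambda>\<sigma>. \<Phi> (\<sigma>, \<theta>)) \<longlongrightarrow> south_pole) (at_right 0) \<and>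
          ((\<lambda>\<sigma>. \<Phi> (\<sigma>, \<theta>)) \<longlongrightarrow> north_pole) (at_left m)) \<and>
     (\<forall>\<sigma>\<in>{0<..<m}. \<forall>\<theta> a b a' b'.
        g (\<Phi> (\<sigma>, \<theta>)) (frechet_derivative \<Phi> (at (\<sigma>, \<theta>)) (a, b))
                       (frechet_derivative \<Phi> (at (\<sigma>, \<theta>)) (a', b'))
        = a * a' + (r \<sigma>)\<^sup>2 * (b * b'))"

text \<open>The conditions on \<open>r\<close> other than \<open>r \<ge> 0\<close> and the boundary values are automatic for a metric with
  a unique equator. They are recorded as part of the notion of a profile function.\<close>

definition profile_function :: "metric \<Rightarrow> real \<Rightarrow> (real \<Rightarrow> real) \<Rightarrow> bool" where
  "profile_function g m r \<longleftrightarrow> m > 0 \<and> (\<exists>\<Phi>. polar_coordinates g m r \<Phi>) \<and>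
     (\<forall>\<sigma>\<in>{0<..<m}. r \<sigma> > 0) \<and> r 0 = 0 \<and> r m = 0 \<and>
     (\<exists>!\<sigma>. \<sigma> \<in> {0<..<m} \<and> deriv r \<sigma> = 0) \<and>
     (\<exists>f :: real \<Rightarrow> real. smooth_on f UNIV \<and> (\<forall>\<sigma>\<in>{0..m}. f \<sigma> = r \<sigma>) \<and>
        (\<forall>\<sigma>. f (- \<sigma>) = - f \<sigma>) \<and> (\<forall>\<sigma>. f (\<sigma> + 2 * m) = f \<sigma>) \<and>
        deriv f 0 = 1 \<and> deriv f m = -1)"


section \<open>The marked length spectrum\<close>

definition winding_z :: "(real \<Rightarrow> real^3) \<Rightarrow> real \<Rightarrow> complex" where
  "winding_z \<gamma> T = winding_number (\<lambda>s. Complex (\<gamma> (T * s) $ 1) (\<gamma> (T * s) $ 2)) 0"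

definition meridian :: "metric \<Rightarrow> (real \<Rightarrow> real^3) \<Rightarrow> real \<Rightarrow> bool" where
  "meridian g \<gamma> T \<longleftrightarrow> closed_geodesic g \<gamma> T \<and> south_pole \<in> range \<gamma> \<and> north_pole \<in> range \<gamma>"

text \<open>Avoiding the poles is what makes the winding number around the z-axis well defined. It holds
  for every closed geodesic that is not a meridian, since one through a single pole
  passes through both. Intersections with the equator are counted by parameter in one period, i.e.
  with multiplicity; they are automatically transverse.\<close>

definition geodesic_of_type :: "metric \<Rightarrow> nat \<Rightarrow> nat \<Rightarrow> (real \<Rightarrow> real^3) \<Rightarrow> real \<Rightarrow> bool" where
  "geodesic_of_type g p q \<gamma> T \<longleftrightarrow> closed_geodesic g \<gamma> T \<and>
     range \<gamma> \<noteq> equator g \<and> \<not> meridian g \<gamma> T \<and> south_pole \<notin> range \<gamma> \<and> north_pole \<notin> range \<gamma> \<and>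
     p \<ge> 1 \<and> q \<ge> 1 \<and>
     cmod (winding_z \<gamma> T) = real p \<and>
     finite {t \<in> {0..<T}. \<gamma> t \<in> equator g} \<and> card {t \<in> {0..<T}. \<gamma> t \<in> equator g} = 2 * q"

definition length_spectrum :: "metric \<Rightarrow> nat \<Rightarrow> nat \<Rightarrow> real set" where
  "length_spectrum g p q = {curve_length g 0 T \<gamma> | \<gamma> T. geodesic_of_type g p q \<gamma> T}"

definition isospectral :: "metric \<Rightarrow> metric \<Rightarrow> bool" where
  "isospectral g1 g2 \<longleftrightarrow> equator_length g1 = equator_length g2 \<and>
     (\<forall>p q. p \<ge> 1 \<longrightarrow> q \<ge> 1 \<longrightarrow> coprime p q \<longrightarrow> length_spectrum g1 p q = length_spectrum g2 p q)"

end

theory Submission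
  imports Defs
begin

text \<open>By conservation of the Clairaut constant \<open>\<rho>\<close>, a geodesic that is neither the equator nor a
  meridian oscillates between the two parallels of radius \<open>\<rho> < R = max r\<close>. Its rotation \<open>\<Theta> \<rho>\<close> and
  its length \<open>\<Lambda> \<rho>\<close> during one oscillation are integrals along the profile, and
  $\mathcal L_g(p,q)$ consists of the numbers \<open>q * \<Lambda> \<rho>\<close> with \<open>q * \<Theta> \<rho> = 2 * pi * p\<close>. These integrals
  depend only on the push-forward of the Lebesgue measure by the profile, that is, on the lengths of
  its superlevel sets; conversely, Abel inversion recovers this measure from \<open>\<Theta>\<close>.

  It remains to see that the spectrum determines \<open>\<Theta>\<close>. The curve \<open>(\<Theta>, \<Lambda>)\<close> is a front, as
  \<open>\<Lambda>' = \<rho> * \<Theta>'\<close>: its slope is \<open>\<rho>\<close>. Where \<open>\<Theta>\<^sub>1' \<noteq> 0\<close>, rational values of \<open>\<Theta>\<^sub>1 / (2 * pi)\<close> are dense, so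
  by compactness the graph of the first front over a small interval is contained in the second
  front, up to finitely many points. If \<open>\<Theta>\<^sub>1 \<noteq> \<Theta>\<^sub>2\<close> there, the slopes at a common point are
  different, so the common points are isolated or critical for \<open>\<Theta>\<^sub>2\<close> and, by Sard's theorem, project
  to a null set, which is absurd. Hence \<open>(\<Theta>\<^sub>1 - \<Theta>\<^sub>2) * (\<Theta>\<^sub>1' - \<Theta>\<^sub>2') = 0\<close>, so \<open>\<Theta>\<^sub>1 - \<Theta>\<^sub>2\<close> is
  constant; it vanishes because both functions tend to \<open>2 * pi\<close> as \<open>\<rho>\<close> tends to \<open>0\<close>.\<close>

text \<open>Two obstacles shape the analysis. The integrands of \<Theta> and \<Lambda> are singular
  at the turning points, where the profile equals \<rho>, and the density of the push-forward
  measure blows up at the equator, where the profile has derivative 0. To differentiate \<Theta>,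
  the profile is cut at its maximum into two monotone halves, and each half at a level
  \<open>c\<close> with \<rho> \<open>< c < R\<close>: below \<open>c\<close> a trigonometric
  substitution onto a fixed interval absorbs the turning point, above \<open>c\<close> the kernel is
  regular. The second obstacle is that parameters matched on the second front may run to 0 or to
  \<open>R\<close>. Write \<Lambda> = \<open>J\<close> + \<rho> \<Theta> with
  \<open>J' = -\<close>\<Theta>, so that \<open>J\<close> is the intercept of the tangent. As
  \<open>J\<close> is monotone, bounded, and tends to 0 at \<open>R\<close>, an escape forces the
  point of the first front onto one of two fixed lines, of slope \<open>R\<close> or 0, and a small
  arc meets these in finitely many points. The common limit 2 pi reflects the unit slopes of the
  profile at the poles: each half has density tending to 1 there and contributes 2 arccos 0 =
  pi.\<close>

no_notation fps_nth (infixl "$" 75)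

section \<open>Calculus of smooth maps\<close>

text \<open>The recursion of \<open>Ck_on\<close> runs through \<open>frechet_derivative\<close>,
  which has to be exchanged for formulas valid on \<open>S\<close> only. Since \<open>S\<close> is
  open, agreement on \<open>S\<close> passes to derivatives.\<close>

lemma Ck_on_cong:
  assumes "open S" "Ck_on k f S" "\<And>x. x \<in> S \<Longrightarrow> f x = g x"
  shows "Ck_on k g S"
  using assms(2,3)
proof (induction k arbitrary: f g)
  case 0
  then show ?case using continuous_on_cong[of S S f g] by simp
next
  case (Suc k)
  have der: "(g has_derivative frechet_derivative f (at x)) (at x)" if "x \<in> S" for x
  proof (rule has_derivative_transform_within_open[OF _ \<open>open S\<close> that])
    have "f differentiable (at x)"
      using Suc.prems(1) that by simp
    then show "(f has_derivative frechet_derivative f (at x)) (at x)"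
      unfolding frechet_derivative_works .
  qed (rule Suc.prems(2))
  have "Ck_on k (\<lambda>x. frechet_derivative g (at x) v) S" for v
  proof (rule Suc.IH)
    show "Ck_on k (\<lambda>x. frechet_derivative f (at x) v) S"
      using Suc.prems(1) by simp
    show "frechet_derivative f (at x) v = frechet_derivative g (at x) v" if "x \<in> S" for x
      by (simp only: frechet_derivative_at[OF der[OF that], symmetric])
  qed
  then show ?case
    using differentiableI[OF der] by simp
qed

text \<open>Admits any explicit derivative in place of \<open>frechet_derivative\<close>; the
  closure properties below enter their inductions on \<open>k\<close> through this rule.\<close>

lemma Ck_on_SucI:
  assumes "open S" "\<And>x. x \<in> S \<Longrightarrow> (f has_derivative f' x) (at x)"
    and "\<And>v. Ck_on k (\<lambda>x. f' x v) S"
  shows "Ck_on (Suc k) f S"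
proof -
  have "Ck_on k (\<lambda>x. frechet_derivative f (at x) v) S" for v
    by (rule Ck_on_cong[OF assms(1) assms(3)[of v]])
      (simp only: frechet_derivative_at[OF assms(2), symmetric])
  then show ?thesis
    using differentiableI[OF assms(2)] by simp
qed

lemma Ck_on_SucD: "Ck_on (Suc k) f S \<Longrightarrow> Ck_on k f S"
proof (induction k arbitrary: f)
  case 0
  then show ?case
    using differentiable_imp_continuous_on[of f S] differentiable_at_withinI
    by (auto simp: differentiable_on_def)
qed auto

lemma Ck_on_subset: "Ck_on k f S \<Longrightarrow> T \<subseteq> S \<Longrightarrow> Ck_on k f T"
  by (induction k arbitrary: f) (auto intro: continuous_on_subset)

lemma Ck_on_has_derivative:
  "Ck_on (Suc k) f S \<Longrightarrow> x \<in> S \<Longrightarrow> (f has_derivative frechet_derivative f (at x)) (at x)"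
  unfolding frechet_derivative_works[symmetric] by simp

lemma Ck_on_const: "open S \<Longrightarrow> Ck_on k (\<lambda>x. c) S"
proof (induction k arbitrary: c)
  case (Suc k)
  show ?case
    by (rule Ck_on_SucI[where f' = "\<lambda>x v. 0"]) (use Suc in auto)
qed simp

lemma Ck_on_add:
  assumes "open S" "Ck_on k f S" "Ck_on k g S"
  shows "Ck_on k (\<lambda>x. f x + g x) S"
  using assms(2,3)
proof (induction k arbitrary: f g)
  case (Suc k)
  show ?case
    by (rule Ck_on_SucI[OF \<open>open S\<close>
          has_derivative_add[OF Suc.prems[THEN Ck_on_has_derivative]]])
      (use Suc in auto)
qed (auto intro: continuous_intros)

lemma Ck_on_linear:
  assumes "open S" "bounded_linear L" "Ck_on k f S"
  shows "Ck_on k (\<lambda>x. L (f x)) S"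
  using assms(3)
proof (induction k arbitrary: f)
  case 0
  then show ?case
    using assms(2) by (simp add: bounded_linear.continuous_on)
next
  case (Suc k)
  show ?case
    by (rule Ck_on_SucI[OF \<open>open S\<close>
          bounded_linear.has_derivative[OF assms(2) Ck_on_has_derivative[OF Suc.prems]]])
      (use Suc in auto)
qed

lemma Ck_on_ident: "open S \<Longrightarrow> Ck_on k (\<lambda>x. x) S"
proof (cases k)
  case (Suc n)
  assume "open S"
  then show ?thesis
    unfolding Suc by (intro Ck_on_SucI[where f' = "\<lambda>x v. v"] Ck_on_const) auto
qed auto

lemma Ck_on_bilinear:
  assumes "open S" "bounded_bilinear B" "Ck_on k f S" "Ck_on k g S"
  shows "Ck_on k (\<lambda>x. B (f x) (g x)) S"
  using assms(3,4)
proof (induction k arbitrary: f g)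
  case 0
  then show ?case
    using assms(2) by (simp add: bounded_bilinear.continuous_on)
next
  case (Suc k)
  show ?case
  proof (rule Ck_on_SucI[OF \<open>open S\<close>
          bounded_bilinear.FDERIV[OF assms(2) Suc.prems[THEN Ck_on_has_derivative]]])
    show "Ck_on k (\<lambda>x. B (f x) (frechet_derivative g (at x) v)
                        + B (frechet_derivative f (at x) v) (g x)) S" for v
      using Suc.prems[THEN Ck_on_SucD] Suc.prems by (intro Ck_on_add \<open>open S\<close> Suc.IH) auto
  qed
qed

lemma Ck_on_sum:
  assumes "open S" "finite A" "\<And>i. i \<in> A \<Longrightarrow> Ck_on k (f i) S"
  shows "Ck_on k (\<lambda>x. \<Sum>i\<in>A. f i x) S"
  using assms(2,3)
  by (induction rule: finite_induct) (auto intro!: Ck_on_add Ck_on_const \<open>open S\<close>)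

text \<open>In the chain rule the outer derivative is applied to a direction that moves with the
  point, whereas \<open>Ck_on\<close> controls fixed directions only. Expanding the direction in the
  basis reduces to sums of products of maps covered by the induction hypothesis.\<close>

lemma Ck_on_compose:
  fixes g :: "'a::euclidean_space \<Rightarrow> 'b::euclidean_space"
  assumes "open S" "open T" "g ` S \<subseteq> T" "Ck_on k f T" "Ck_on k g S"
  shows "Ck_on k (\<lambda>x. f (g x)) S"
  using assms(4,5)
proof (induction k arbitrary: f)
  case 0
  then show ?case
    using assms(3) by (simp add: continuous_on_compose2)
next
  case (Suc k)
  show ?case
  proof (rule Ck_on_SucI[OF \<open>open S\<close>])
    show "((\<lambda>x. f (g x)) has_derivative
        (\<lambda>v. \<Sum>b\<in>Basis. (frechet_derivative g (at x) v \<bullet> b) *\<^sub>R frechet_derivative f (at (g x)) b))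
        (at x)" if "x \<in> S" for x
    proof -
      have f: "(f has_derivative frechet_derivative f (at (g x))) (at (g x))"
        using assms(3) that by (intro Ck_on_has_derivative[OF Suc.prems(1)]) auto
      have "((\<lambda>x. f (g x)) has_derivative
          (\<lambda>v. frechet_derivative f (at (g x)) (frechet_derivative g (at x) v))) (at x)"
        by (rule has_derivative_compose[OF Ck_on_has_derivative[OF Suc.prems(2) that] f])
      moreover have "frechet_derivative f (at (g x)) w
          = (\<Sum>b\<in>Basis. (w \<bullet> b) *\<^sub>R frechet_derivative f (at (g x)) b)" for w
      proof -
        interpret linear "frechet_derivative f (at (g x))"
          using f by (rule has_derivative_linear)
        have "frechet_derivative f (at (g x)) w
            = frechet_derivative f (at (g x)) (\<Sum>b\<in>Basis. (w \<bullet> b) *\<^sub>R b)"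
          by (simp add: euclidean_representation)
        then show ?thesis
          by (simp only: sum scaleR)
      qed
      ultimately show ?thesis
        by (rule has_derivative_eq_rhs[OF _ ext])
    qed
    show "Ck_on k (\<lambda>x. \<Sum>b\<in>Basis. (frechet_derivative g (at x) v \<bullet> b) *\<^sub>R
        frechet_derivative f (at (g x)) b) S" for v
    proof (intro Ck_on_sum Ck_on_bilinear[OF _ bounded_bilinear_scaleR] \<open>open S\<close>)
      show "Ck_on k (\<lambda>x. frechet_derivative g (at x) v \<bullet> b) S" for b
        using Suc.prems(2) by (intro Ck_on_linear[OF \<open>open S\<close> bounded_linear_inner_left]) auto
      show "Ck_on k (\<lambda>x. frechet_derivative f (at (g x)) b) S" for b
        using Suc.prems(1) by (intro Suc.IH[OF _ Ck_on_SucD[OF Suc.prems(2)]]) simp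
    qed auto
  qed
qed

lemma Ck_on_curveI:
  fixes f :: "real \<Rightarrow> 'a::real_normed_vector"
  assumes "open S" "\<And>x. x \<in> S \<Longrightarrow> (f has_vector_derivative f' x) (at x)" "Ck_on k f' S"
  shows "Ck_on (Suc k) f S"
proof (rule Ck_on_SucI[OF \<open>open S\<close>])
  show "(f has_derivative (\<lambda>v. v *\<^sub>R f' x)) (at x)" if "x \<in> S" for x
    using assms(2)[OF that] by (simp add: has_vector_derivative_def)
  show "Ck_on k (\<lambda>x. v *\<^sub>R f' x) S" for v
    using assms by (intro Ck_on_linear[OF _ bounded_linear_scaleR_right])
qed

lemma Ck_on_curve_derivative:
  fixes f :: "real \<Rightarrow> 'a::real_normed_vector"
  assumes "open S" "Ck_on (Suc k) f S" "\<And>x. x \<in> S \<Longrightarrow> (f has_vector_derivative f' x) (at x)"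
  shows "Ck_on k f' S"
proof (rule Ck_on_cong[OF \<open>open S\<close>])
  show "Ck_on k (\<lambda>x. frechet_derivative f (at x) 1) S"
    using assms(2) by simp
  show "frechet_derivative f (at x) 1 = f' x" if "x \<in> S" for x
    using frechet_derivative_at[OF assms(3)[OF that, unfolded has_vector_derivative_def]]
    by (metis scaleR_one)
qed

section \<open>Closure properties of smooth maps\<close>

lemma smooth_on_subset: "smooth_on f S \<Longrightarrow> T \<subseteq> S \<Longrightarrow> smooth_on f T"
  unfolding smooth_on_def using Ck_on_subset by blast

lemma smooth_on_has_derivative:
  "smooth_on f S \<Longrightarrow> x \<in> S \<Longrightarrow> (f has_derivative frechet_derivative f (at x)) (at x)"
  unfolding smooth_on_def by (rule Ck_on_has_derivative[of 0]) blast+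

lemma smooth_on_continuous: "smooth_on f S \<Longrightarrow> continuous_on S f"
  unfolding smooth_on_def using Ck_on.simps(1) by blast

lemma smooth_on_const: "open S \<Longrightarrow> smooth_on (\<lambda>x. c) S"
  unfolding smooth_on_def by (blast intro: Ck_on_const)

lemma smooth_on_ident: "open S \<Longrightarrow> smooth_on (\<lambda>x. x) S"
  unfolding smooth_on_def by (blast intro: Ck_on_ident)

lemma smooth_on_add:
  "open S \<Longrightarrow> smooth_on f S \<Longrightarrow> smooth_on g S \<Longrightarrow> smooth_on (\<lambda>x. f x + g x) S"
  unfolding smooth_on_def by (blast intro: Ck_on_add)

lemma smooth_on_linear:
  "open S \<Longrightarrow> bounded_linear L \<Longrightarrow> smooth_on f S \<Longrightarrow> smooth_on (\<lambda>x. L (f x)) S"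
  unfolding smooth_on_def by (blast intro: Ck_on_linear)

lemma smooth_on_bilinear:
  "open S \<Longrightarrow> bounded_bilinear B \<Longrightarrow> smooth_on f S \<Longrightarrow> smooth_on g S \<Longrightarrow>
    smooth_on (\<lambda>x. B (f x) (g x)) S"
  unfolding smooth_on_def by (blast intro: Ck_on_bilinear)

lemma smooth_on_compose:
  fixes g :: "'a::euclidean_space \<Rightarrow> 'b::euclidean_space"
  shows "open S \<Longrightarrow> open T \<Longrightarrow> g ` S \<subseteq> T \<Longrightarrow> smooth_on f T \<Longrightarrow> smooth_on g S \<Longrightarrow>
    smooth_on (\<lambda>x. f (g x)) S"
  unfolding smooth_on_def by (blast intro: Ck_on_compose)

lemmas smooth_on_mult = smooth_on_bilinear[OF _ bounded_bilinear_mult]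
lemmas smooth_on_nth = smooth_on_linear[OF _ bounded_linear_vec_nth]
lemmas smooth_on_fst = smooth_on_linear[OF _ bounded_linear_fst]
lemmas smooth_on_snd = smooth_on_linear[OF _ bounded_linear_snd]

lemma smooth_on_minus: "open S \<Longrightarrow> smooth_on f S \<Longrightarrow> smooth_on (\<lambda>x. - f x) S"
  by (rule smooth_on_linear[OF _ bounded_linear_minus[OF bounded_linear_ident]])

lemma smooth_on_diff:
  "open S \<Longrightarrow> smooth_on f S \<Longrightarrow> smooth_on g S \<Longrightarrow> smooth_on (\<lambda>x. f x - g x) S"
  using smooth_on_add[OF _ _ smooth_on_minus, of S f g] by simp

lemma smooth_on_power:
  fixes f :: "'a::euclidean_space \<Rightarrow> 'b::real_normed_algebra_1"
  shows "open S \<Longrightarrow> smooth_on f S \<Longrightarrow> smooth_on (\<lambda>x. f x ^ n) S"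
  by (induction n) (auto intro: smooth_on_const smooth_on_mult)

lemma smooth_on_Pair:
  assumes "open S" "smooth_on f S" "smooth_on g S"
  shows "smooth_on (\<lambda>x. (f x, g x)) S"
proof -
  have "smooth_on (\<lambda>x. (f x, 0) + (0, g x)) S"
    using assms
    by (intro smooth_on_add smooth_on_linear[of _ "\<lambda>y. (y, 0)"] smooth_on_linear[of _ "\<lambda>y. (0, y)"])
      (auto intro!: bounded_linear_intros)
  then show ?thesis by simp
qed

lemma smooth_on_curveI:
  fixes f :: "real \<Rightarrow> 'a::real_normed_vector"
  assumes "open S" "\<And>x. x \<in> S \<Longrightarrow> (f has_vector_derivative f' x) (at x)" "smooth_on f' S"
  shows "smooth_on f S"
  unfolding smooth_on_def
proof
  show "Ck_on k f S" for k
    using assms(3) by (intro Ck_on_SucD[OF Ck_on_curveI[OF assms(1,2)]]) (auto simp: smooth_on_def)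
qed

lemma smooth_on_curve_derivative:
  fixes f :: "real \<Rightarrow> 'a::real_normed_vector"
  assumes "open S" "smooth_on f S" "\<And>x. x \<in> S \<Longrightarrow> (f has_vector_derivative f' x) (at x)"
  shows "smooth_on f' S"
  unfolding smooth_on_def
proof
  show "Ck_on k f' S" for k
    using assms(2) by (intro Ck_on_curve_derivative[OF assms(1) _ assms(3)]) (simp only: smooth_on_def)
qed

lemma smooth_on_partial:
  assumes "smooth_on f S"
  shows "smooth_on (\<lambda>x. frechet_derivative f (at x) v) S"
  unfolding smooth_on_def
proof
  show "Ck_on k (\<lambda>x. frechet_derivative f (at x) v) S" for k
    using assms[unfolded smooth_on_def, rule_format, of "Suc k"] by simp
qed

lemma smooth_on_has_vector_derivative:
  fixes f :: "real \<Rightarrow> 'a::real_normed_vector"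
  assumes "smooth_on f S" "x \<in> S"
  shows "(f has_vector_derivative vector_derivative f (at x)) (at x)"
  using differentiableI[OF smooth_on_has_derivative[OF assms]] by (simp add: vector_derivative_works)

lemma smooth_on_vector_derivative:
  fixes f :: "real \<Rightarrow> 'a::real_normed_vector"
  assumes "open S" "smooth_on f S"
  shows "smooth_on (\<lambda>x. vector_derivative f (at x)) S"
  by (rule smooth_on_curve_derivative[OF assms smooth_on_has_vector_derivative[OF assms(2)]])

lemma smooth_on_has_real_derivative:
  fixes f :: "real \<Rightarrow> real"
  assumes "smooth_on f S" "x \<in> S"
  shows "(f has_real_derivative deriv f x) (at x)"
  using differentiableI[OF smooth_on_has_derivative[OF assms]]
  by (simp add: DERIV_deriv_iff_real_differentiable)

lemma smooth_on_deriv: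
  fixes f :: "real \<Rightarrow> real"
  assumes "open S" "smooth_on f S"
  shows "smooth_on (deriv f) S"
  using assms smooth_on_curve_derivative[of S f "deriv f"] smooth_on_has_real_derivative
  by (simp add: has_real_derivative_iff_has_vector_derivative)

lemma smooth_on_sin_cos: "smooth_on (sin :: real \<Rightarrow> real) UNIV" "smooth_on (cos :: real \<Rightarrow> real) UNIV"
proof -
  have "Ck_on k (sin :: real \<Rightarrow> real) UNIV \<and> Ck_on k (cos :: real \<Rightarrow> real) UNIV" for k
  proof (induction k)
    case (Suc k)
    have "Ck_on k (\<lambda>x::real. - sin x) UNIV"
      using Suc by (intro Ck_on_linear[OF _ bounded_linear_minus[OF bounded_linear_ident]]) auto
    then show ?case
      using Suc Ck_on_curveI[where f = sin and f' = cos and k = k and S = UNIV]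
        Ck_on_curveI[where f = cos and f' = "\<lambda>x. - sin x" and k = k and S = UNIV]
      by (simp del: Ck_on.simps flip: has_real_derivative_iff_has_vector_derivative)
  qed (auto intro: continuous_intros)
  then show "smooth_on (sin :: real \<Rightarrow> real) UNIV" "smooth_on (cos :: real \<Rightarrow> real) UNIV"
    by (auto simp: smooth_on_def)
qed

lemma smooth_on_sin: "open S \<Longrightarrow> smooth_on f S \<Longrightarrow> smooth_on (\<lambda>x. sin (f x :: real)) S"
  and smooth_on_cos: "open S \<Longrightarrow> smooth_on f S \<Longrightarrow> smooth_on (\<lambda>x. cos (f x :: real)) S"
  using smooth_on_compose[of S UNIV f sin] smooth_on_compose[of S UNIV f cos] smooth_on_sin_cos by auto

lemma smooth_on_inverse_fun: "smooth_on (inverse :: real \<Rightarrow> real) (- {0})"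
proof -
  have "Ck_on k (inverse :: real \<Rightarrow> real) (- {0})" for k
  proof (induction k)
    case (Suc k)
    then have "Ck_on k (\<lambda>x::real. - (inverse x * inverse x)) (- {0})"
      by (intro Ck_on_linear[OF _ bounded_linear_minus[OF bounded_linear_ident]]
          Ck_on_bilinear[OF _ bounded_bilinear_mult]) auto
    then show ?case
      by (rule Ck_on_curveI[rotated 2])
        (auto intro!: derivative_eq_intros simp: power2_eq_square
          simp flip: has_real_derivative_iff_has_vector_derivative)
  qed (auto intro: continuous_intros)
  then show ?thesis
    by (auto simp: smooth_on_def)
qed

lemma smooth_on_inverse:
  "open S \<Longrightarrow> smooth_on f S \<Longrightarrow> (\<And>x. x \<in> S \<Longrightarrow> f x \<noteq> 0) \<Longrightarrow> smooth_on (\<lambda>x. inverse (f x :: real)) S"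
  by (rule smooth_on_compose[OF _ _ _ smooth_on_inverse_fun]) auto

lemma smooth_on_divide:
  "open S \<Longrightarrow> smooth_on f S \<Longrightarrow> smooth_on g S \<Longrightarrow> (\<And>x. x \<in> S \<Longrightarrow> g x \<noteq> 0) \<Longrightarrow>
    smooth_on (\<lambda>x. f x / g x :: real) S"
  unfolding divide_inverse by (intro smooth_on_mult smooth_on_inverse)

text \<open>Bootstrapping: the derivative of \<open>g\<close> is the reciprocal of
  \<open>deriv f\<close> composed with \<open>g\<close>, so \<open>g\<close> of class
  \<open>C^k\<close> has a derivative of class \<open>C^k\<close>. The induction starts from the
  assumed continuity of \<open>g\<close>.\<close>

lemma smooth_on_inverse_function:
  fixes f g :: "real \<Rightarrow> real"
  assumes "open S" "open T" "smooth_on f S" "g ` T \<subseteq> S" "continuous_on T g"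
    and inv: "\<And>y. y \<in> T \<Longrightarrow> f (g y) = y"
    and nz: "\<And>x. x \<in> S \<Longrightarrow> deriv f x \<noteq> 0"
  shows "smooth_on g T"
    and "\<And>y. y \<in> T \<Longrightarrow> (g has_real_derivative inverse (deriv f (g y))) (at y)"
proof -
  show der: "(g has_real_derivative inverse (deriv f (g y))) (at y)" if y: "y \<in> T" for y
  proof -
    obtain e where e: "e > 0" "ball y e \<subseteq> T"
      using \<open>open T\<close> y open_contains_ball by blast
    show ?thesis
    proof (rule DERIV_inverse_function[where f = f and a = "y - e" and b = "y + e"])
      show "(f has_real_derivative deriv f (g y)) (at (g y))"
        using assms y by (intro smooth_on_has_real_derivative) auto
      show "f (g x) = x" if "y - e < x" "x < y + e" for x
        using e that by (intro inv) (auto simp: subset_eq dist_real_def)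
      show "isCont g y"
        using assms(2,5) y continuous_on_eq_continuous_at by blast
    qed (use e assms y in auto)
  qed
  have "Ck_on k g T" for k
  proof (induction k)
    case (Suc k)
    have "smooth_on (\<lambda>x. inverse (deriv f x)) S"
      using assms by (intro smooth_on_inverse smooth_on_deriv)
    then have "Ck_on k (\<lambda>y. inverse (deriv f (g y))) T"
      unfolding smooth_on_def using Suc assms(1,2,4)
      by (auto intro: Ck_on_compose[where f = "\<lambda>x. inverse (deriv f x)" and g = g and T = S])
    then show ?case
      by (rule Ck_on_curveI[rotated 2])
        (use assms(2) der in \<open>auto simp flip: has_real_derivative_iff_has_vector_derivative\<close>)
  qed (use assms(5) in auto)
  then show "smooth_on g T"
    by (auto simp: smooth_on_def)
qed

section \<open>Polar coordinates\<close>

lemma norm_eq_1_vec3: "norm (x :: real^3) = 1 \<longleftrightarrow> (x$1)\<^sup>2 + (x$2)\<^sup>2 + (x$3)\<^sup>2 = 1"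
  by (simp add: norm_eq_1 inner_vec_def sum_3 power2_eq_square)

lemma in_S2_iff: "x \<in> S2 \<longleftrightarrow> (x$1)\<^sup>2 + (x$2)\<^sup>2 + (x$3)\<^sup>2 = 1"
  by (simp add: norm_eq_1_vec3)

text \<open>Turns avoidance of the poles into an open condition on the third coordinate
  alone.\<close>

lemma S2_poles:
  assumes "x \<in> S2"
  shows "x = south_pole \<or> x = north_pole \<longleftrightarrow> \<not> \<bar>x$3\<bar> < 1"
proof
  show "\<not> \<bar>x$3\<bar> < 1" if "x = south_pole \<or> x = north_pole"
    using that by (auto simp: south_pole_def north_pole_def)
  assume "\<not> \<bar>x$3\<bar> < 1"
  then have "1 \<le> (x$3)\<^sup>2"
    using power_mono[of 1 "\<bar>x$3\<bar>" 2] by simp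
  then have "(x$1)\<^sup>2 + (x$2)\<^sup>2 \<le> 0" "(x$3)\<^sup>2 \<le> 1"
    using assms[unfolded in_S2_iff] zero_le_power2[of "x$1"] zero_le_power2[of "x$2"] by linarith+
  moreover have "x$3 = 1 \<or> x$3 = -1"
    using \<open>1 \<le> (x$3)\<^sup>2\<close> \<open>(x$3)\<^sup>2 \<le> 1\<close> power2_eq_1_iff[of "x$3"] by linarith
  ultimately show "x = south_pole \<or> x = north_pole"
    by (auto simp: south_pole_def north_pole_def vec_eq_iff forall_3 sum_power2_le_zero_iff)
qed

lemma has_vector_derivative_nth:
  "(f has_vector_derivative f') F \<Longrightarrow> ((\<lambda>t. f t $ i) has_real_derivative f' $ i) F"
  unfolding has_real_derivative_iff_has_vector_derivative
  by (rule bounded_linear.has_vector_derivative[OF bounded_linear_vec_nth])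

text \<open>\<open>f\<close> stands for the smooth extension of the profile function to the real
  line, so that its derivatives at 0 and \<open>m\<close> are two-sided.\<close>

locale profile =
  fixes g :: metric and m :: real and \<Phi> :: "real \<times> real \<Rightarrow> real^3" and f :: "real \<Rightarrow> real"
    and s0 :: real
  assumes m_pos: "0 < m"
    and polar: "polar_coordinates g m f \<Phi>"
    and f_pos: "\<And>s. 0 < s \<Longrightarrow> s < m \<Longrightarrow> 0 < f s"
    and f_smooth: "smooth_on f UNIV"
    and f_0: "f 0 = 0" and f_m: "f m = 0"
    and f'_0: "deriv f 0 = 1" and f'_m: "deriv f m = -1"
    and s0: "0 < s0" "s0 < m" "deriv f s0 = 0"
    and s0_unique: "\<And>s. 0 < s \<Longrightarrow> s < m \<Longrightarrow> deriv f s = 0 \<Longrightarrow> s = s0"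
begin

abbreviation I :: "real set" where "I \<equiv> {0<..<m}"

lemma open_dom: "open (I \<times> (UNIV :: real set))"
  by (intro open_Times) auto

lemma Phi_smooth: "smooth_on \<Phi> (I \<times> UNIV)"
  using polar by (simp add: polar_coordinates_def)

definition A where "A s = \<Phi> (s, 0) $ 1"
definition B where "B s = \<Phi> (s, 0) $ 2"
definition h where "h s = \<Phi> (s, 0) $ 3"

lemma Phi_nth:
  assumes "s \<in> I"
  shows "\<Phi> (s, t) $ 1 = cos t * A s - sin t * B s"
    and "\<Phi> (s, t) $ 2 = sin t * A s + cos t * B s"
    and "\<Phi> (s, t) $ 3 = h s"
proof -
  have "\<Phi> (s, 0 + t) = rotz t (\<Phi> (s, 0))"
    using polar assms unfolding polar_coordinates_def by blast
  then show "\<Phi> (s, t) $ 1 = cos t * A s - sin t * B s"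
    and "\<Phi> (s, t) $ 2 = sin t * A s + cos t * B s"
    and "\<Phi> (s, t) $ 3 = h s"
    by (simp_all add: rotz_def A_def B_def h_def)
qed

lemma Phi_bij: "bij_betw \<Phi> (I \<times> {0..<2*pi}) (S2 - {south_pole, north_pole})"
  using polar by (simp add: polar_coordinates_def)

lemma Phi_0_S2:
  assumes "s \<in> I"
  shows "\<Phi> (s, 0) \<in> S2" "\<bar>h s\<bar> < 1"
proof -
  have "\<Phi> (s, 0) \<in> S2 - {south_pole, north_pole}"
    using assms bij_betw_apply[OF Phi_bij, of "(s, 0)"] by auto
  then show "\<Phi> (s, 0) \<in> S2" "\<bar>h s\<bar> < 1"
    using S2_poles[of "\<Phi> (s, 0)"] by (auto simp: h_def)
qed

lemma ABh:
  assumes "s \<in> I"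
  shows "(A s)\<^sup>2 + (B s)\<^sup>2 = 1 - (h s)\<^sup>2"
  using Phi_0_S2(1)[OF assms] by (simp add: norm_eq_1_vec3 A_def B_def h_def)

lemma AB_pos:
  assumes "s \<in> I"
  shows "0 < 1 - (h s)\<^sup>2"
  using Phi_0_S2(2)[OF assms] by (simp add: abs_square_less_1)

lemma Phi_S2:
  assumes "s \<in> I"
  shows "\<Phi> (s, t) \<in> S2" "\<bar>\<Phi> (s, t) $ 3\<bar> < 1"
proof -
  have "(\<Phi> (s, t) $ 1)\<^sup>2 + (\<Phi> (s, t) $ 2)\<^sup>2 = ((A s)\<^sup>2 + (B s)\<^sup>2) * ((sin t)\<^sup>2 + (cos t)\<^sup>2)"
    unfolding Phi_nth[OF assms] by algebra
  then show "\<Phi> (s, t) \<in> S2" "\<bar>\<Phi> (s, t) $ 3\<bar> < 1"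
    using ABh[OF assms] Phi_0_S2(2)[OF assms] by (auto simp: norm_eq_1_vec3 Phi_nth[OF assms])
qed

lemma ABh_smooth: "smooth_on A I" "smooth_on B I" "smooth_on h I"
proof -
  have "smooth_on (\<lambda>s. \<Phi> (s, 0)) I"
    by (rule smooth_on_compose[OF _ open_dom _ Phi_smooth])
      (auto intro!: smooth_on_Pair smooth_on_ident smooth_on_const)
  then show "smooth_on A I" "smooth_on B I" "smooth_on h I"
    unfolding A_def B_def h_def by (auto intro: smooth_on_nth)
qed

lemma ABh_deriv:
  assumes "s \<in> I"
  shows "(A has_real_derivative deriv A s) (at s)" "(B has_real_derivative deriv B s) (at s)"
    "(h has_real_derivative deriv h s) (at s)"
  using ABh_smooth[THEN smooth_on_has_real_derivative[OF _ assms]] by auto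

lemma deriv_ABh:
  assumes "s \<in> I"
  shows "A s * deriv A s + B s * deriv B s = - h s * deriv h s"
proof -
  have "((\<lambda>s. (A s)\<^sup>2 + (B s)\<^sup>2 + (h s)\<^sup>2) has_real_derivative
      2 * (A s * deriv A s + B s * deriv B s + h s * deriv h s)) (at s)"
    using ABh_deriv[OF assms] by (auto intro!: derivative_eq_intros simp: algebra_simps)
  moreover have "((\<lambda>s. (A s)\<^sup>2 + (B s)\<^sup>2 + (h s)\<^sup>2) has_real_derivative 0) (at s)"
    by (rule has_field_derivative_transform_within_open[of "\<lambda>s. 1" _ _ I])
      (use assms ABh in \<open>auto simp: algebra_simps\<close>)
  ultimately show ?thesis
    using DERIV_unique by fastforce
qed

abbreviation D where "D s t \<equiv> frechet_derivative \<Phi> (at (s, t))"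

lemma Phi_deriv:
  assumes "s \<in> I"
  shows "(\<Phi> has_derivative D s t) (at (s, t))"
  by (rule smooth_on_has_derivative[OF Phi_smooth]) (use assms in auto)

lemma D_nth:
  assumes "s \<in> I"
  shows "D s t (a, b) $ 1 = a * (cos t * deriv A s - sin t * deriv B s) - b * (sin t * A s + cos t * B s)"
    and "D s t (a, b) $ 2 = a * (sin t * deriv A s + cos t * deriv B s) + b * (cos t * A s - sin t * B s)"
    and "D s t (a, b) $ 3 = a * deriv h s"
proof -
  have D: "((\<lambda>p. \<Phi> p $ i) has_derivative (\<lambda>v. D s t v $ i)) (at (s, t))" for i
    by (rule bounded_linear.has_derivative[OF bounded_linear_vec_nth Phi_deriv[OF assms]])
  have *: "D s t v $ i = F' v"
    if "(F has_derivative F') (at (s, t))" "\<And>s t. s \<in> I \<Longrightarrow> \<Phi> (s, t) $ i = F (s, t)" for v i F F'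
  proof -
    have "((\<lambda>p. \<Phi> p $ i) has_derivative F') (at (s, t))"
      by (rule has_derivative_transform_within_open[OF that(1) open_dom]) (use assms that(2) in auto)
    then show ?thesis
      using has_derivative_unique[OF D] by metis
  qed
  have "((\<lambda>p. cos (snd p) * A (fst p) - sin (snd p) * B (fst p)) has_derivative
      (\<lambda>v. fst v * (cos t * deriv A s - sin t * deriv B s) - snd v * (sin t * A s + cos t * B s)))
      (at (s, t))"
    using ABh_deriv[OF assms]
    by (auto intro!: derivative_eq_intros DERIV_compose_FDERIV[where f = A]
      DERIV_compose_FDERIV[where f = B] simp: algebra_simps)
  from *[OF this, of 1 "(a, b)"] show "D s t (a, b) $ 1 = a * (cos t * deriv A s - sin t * deriv B s) - b * (sin t * A s + cos t * B s)"
    by (simp add: Phi_nth)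
  have "((\<lambda>p. sin (snd p) * A (fst p) + cos (snd p) * B (fst p)) has_derivative
      (\<lambda>v. fst v * (sin t * deriv A s + cos t * deriv B s) + snd v * (cos t * A s - sin t * B s)))
      (at (s, t))"
    using ABh_deriv[OF assms]
    by (auto intro!: derivative_eq_intros DERIV_compose_FDERIV[where f = A]
      DERIV_compose_FDERIV[where f = B] simp: algebra_simps)
  from *[OF this, of 2 "(a, b)"] show "D s t (a, b) $ 2 = a * (sin t * deriv A s + cos t * deriv B s) + b * (cos t * A s - sin t * B s)"
    by (simp add: Phi_nth)
  have "((\<lambda>p. h (fst p)) has_derivative (\<lambda>v. fst v * deriv h s)) (at (s, t))"
    using ABh_deriv[OF assms]
    by (auto intro!: derivative_eq_intros DERIV_compose_FDERIV[where f = h] simp: algebra_simps)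
  from *[OF this, of 3 "(a, b)"] show "D s t (a, b) $ 3 = a * deriv h s"
    by (simp add: Phi_nth)
qed

lemma metric_D:
  "s \<in> I \<Longrightarrow> g (\<Phi> (s, t)) (D s t (a, b)) (D s t (a', b')) = a * a' + (f s)\<^sup>2 * (b * b')"
  using polar by (simp add: polar_coordinates_def)

text \<open>At a zero of the derivative of the height, the velocity of the meridian would be
  horizontal and tangent to the sphere, hence a multiple \<open>l\<close> of the rotation field.
  Then the coordinate vector \<open>(1, -l)\<close> would be mapped to 0, although its metric length
  is at least 1.\<close>

lemma deriv_h_nonzero:
  assumes "s \<in> I"
  shows "deriv h s \<noteq> 0"
proof
  assume 0: "deriv h s = 0"
  \<comment> \<open>The factor by which the meridian velocity is a multiple of the rotation field
    \<open>(-B, A)\<close>, found by projecting onto that field.\<close>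
  define l where "l = (A s * deriv B s - B s * deriv A s) / (1 - (h s)\<^sup>2)"
  have e: "A s * deriv A s + B s * deriv B s = 0"
    using deriv_ABh[OF assms] 0 by simp
  have l: "l * ((A s)\<^sup>2 + (B s)\<^sup>2) = A s * deriv B s - B s * deriv A s"
    using AB_pos[OF assms] by (simp add: l_def ABh[OF assms])
  have "deriv A s = - l * B s" "deriv B s = l * A s"
  proof -
    have n: "(A s)\<^sup>2 + (B s)\<^sup>2 \<noteq> 0"
      using ABh[OF assms] AB_pos[OF assms] by simp
    have "((A s)\<^sup>2 + (B s)\<^sup>2) * (deriv A s + l * B s) = 0"
      using e l by algebra
    then show "deriv A s = - l * B s"
      using n unfolding mult_eq_0_iff by auto
    have "((A s)\<^sup>2 + (B s)\<^sup>2) * (deriv B s - l * A s) = 0"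
      using e l by algebra
    then show "deriv B s = l * A s"
      using n unfolding mult_eq_0_iff by auto
  qed
  then have "D s 0 (1, -l) = D s 0 (0, 0)"
    by (simp add: vec_eq_iff forall_3 D_nth[OF assms] 0)
  then have "1 + (f s)\<^sup>2 * (l * l) = 0"
    using metric_D[OF assms, of 0 1 "-l" 1 "-l"] metric_D[OF assms, of 0 0 0 0 0] by simp
  moreover have "0 \<le> (f s)\<^sup>2 * (l * l)"
    by simp
  ultimately show False by linarith
qed

lemma Phi_surj:
  assumes "x \<in> S2" "\<bar>x$3\<bar> < 1"
  obtains s t where "s \<in> I" "x = \<Phi> (s, t)"
proof -
  have "x \<in> S2 - {south_pole, north_pole}"
    using assms S2_poles by blast
  then have "x \<in> \<Phi> ` (I \<times> {0..<2*pi})"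
    using Phi_bij by (simp only: bij_betw_def)
  then obtain p where p: "p \<in> I \<times> {0..<2*pi}" "x = \<Phi> p"
    by blast
  then show ?thesis
    using that[of "fst p" "snd p"] p by auto
qed

section \<open>The height as a coordinate along the meridians\<close>

lemma h_image: "h ` I = {-1<..<1}"
proof
  show "h ` I \<subseteq> {-1<..<1}"
    using Phi_0_S2(2) by (auto simp: abs_less_iff)
  show "{-1<..<1} \<subseteq> h ` I"
  proof
    fix z :: real assume "z \<in> {-1<..<1}"
    then have z: "\<bar>z\<bar> < 1" by auto
    then have "vector [sqrt (1 - z\<^sup>2), 0, z] \<in> S2"
      by (simp add: norm_eq_1_vec3 abs_square_le_1)
    then obtain s t where "s \<in> I" "vector [sqrt (1 - z\<^sup>2), 0, z] = \<Phi> (s, t)"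
      using Phi_surj z by (metis vector_3(3))
    then show "z \<in> h ` I"
      using Phi_nth(3)[of s t] by (metis image_eqI vector_3(3))
  qed
qed

lemma h_inj: "inj_on h I"
proof (rule inj_onI)
  fix s s' assume s: "s \<in> I" "s' \<in> I" "h s = h s'"
  show "s = s'"
  proof (rule ccontr)
    assume "s \<noteq> s'"
    have *: "\<exists>z. z \<in> I \<and> deriv h z = 0" if uv: "u < v" "u \<in> I" "v \<in> I" "h u = h v" for u v
    proof -
      have "continuous_on {u..v} h"
        using smooth_on_continuous[OF ABh_smooth(3)] by (rule continuous_on_subset) (use that in auto)
      moreover have "h differentiable (at x)" if "u < x" "x < v" for x
        using ABh_deriv(3)[of x] that \<open>u \<in> I\<close> \<open>v \<in> I\<close> real_differentiable_def by auto
      ultimately obtain z where "u < z" "z < v" "(h has_real_derivative 0) (at z)"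
        using Rolle[OF uv(1,4)] by blast
      then show ?thesis
        using that by (auto intro!: exI[of _ z] DERIV_imp_deriv)
    qed
    show False
      using *[of s s'] *[of s' s] s \<open>s \<noteq> s'\<close> deriv_h_nonzero by (metis linorder_neqE_linordered_idom)
  qed
qed

text \<open>Along any curve the first polar coordinate is \<open>Z\<close> of the third Cartesian
  coordinate: a smooth function of the point, needing no choice of a lift. Only the angle needs such
  a choice.\<close>

definition Z where "Z = the_inv_into I h"

lemma Z: "s \<in> I \<Longrightarrow> Z (h s) = s" "\<bar>z\<bar> < 1 \<Longrightarrow> Z z \<in> I" "\<bar>z\<bar> < 1 \<Longrightarrow> h (Z z) = z"
proof -
  show "s \<in> I \<Longrightarrow> Z (h s) = s"
    unfolding Z_def by (rule the_inv_into_f_f[OF h_inj])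
  have "z \<in> h ` I" if "\<bar>z\<bar> < 1"
    using that by (auto simp: h_image)
  then show "\<bar>z\<bar> < 1 \<Longrightarrow> Z z \<in> I" "\<bar>z\<bar> < 1 \<Longrightarrow> h (Z z) = z"
    unfolding Z_def using the_inv_into_into[OF h_inj _ order_refl] f_the_inv_into_f[OF h_inj] by blast+
qed

lemma Z_smooth: "smooth_on Z {-1<..<1}"
  and Z_deriv: "\<bar>z\<bar> < 1 \<Longrightarrow> (Z has_real_derivative inverse (deriv h (Z z))) (at z)"
proof -
  obtain k where k: "homeomorphism I (h ` I) h k"
    by (rule invariance_of_domain_homeomorphism[OF _ smooth_on_continuous[OF ABh_smooth(3)] _ h_inj])
      auto
  have "continuous_on {-1<..<1} k"
    using k h_image by (auto simp: homeomorphism_def)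
  moreover have "k z = Z z" if "z \<in> {-1<..<1}" for z
    using k that h_image Z h_inj unfolding homeomorphism_def
    by (metis imageE)
  ultimately have "continuous_on {-1<..<1} Z"
    using continuous_on_cong by metis
  note * = smooth_on_inverse_function[OF _ _ ABh_smooth(3) _ this]
  show "smooth_on Z {-1<..<1}"
    by (rule *(1)) (use Z deriv_h_nonzero in \<open>auto simp: abs_less_iff\<close>)
  show "\<bar>z\<bar> < 1 \<Longrightarrow> (Z has_real_derivative inverse (deriv h (Z z))) (at z)"
    by (rule *(2)) (use Z deriv_h_nonzero in \<open>auto simp: abs_less_iff\<close>)
qed

lemma Z_Phi: "s \<in> I \<Longrightarrow> Z (\<Phi> (s, t) $ 3) = s"
  by (simp add: Phi_nth Z)

definition Z' where "Z' z = inverse (deriv h (Z z))"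

text \<open>The rate, per unit of height, at which the Euclidean longitude changes along the
  meridian at angle 0. It measures how far the meridians deviate from half-planes through the
  axis.\<close>

definition twist where
  "twist z = (A (Z z) * deriv B (Z z) - B (Z z) * deriv A (Z z)) * Z' z / (1 - z\<^sup>2)"

text \<open>\<open>\<Omega>\<close> is the one-form \<open>d\<theta>\<close>, written in ambient coordinates so that it can be evaluated along a
  curve before an angle function is chosen.\<close>

definition \<Omega> where
  "\<Omega> x v = (x$1 * v$2 - x$2 * v$1) / (1 - (x$3)\<^sup>2) - twist (x$3) * v$3"

text \<open>Both components of a tangent vector in polar coordinates are thus read off in ambient
  coordinates; this is the test that \<Omega> is the differential of the angle.\<close>

lemma Omega_D:
  assumes "s \<in> I"
  shows "\<Omega> (\<Phi> (s, t)) (D s t (a, b)) = b" "Z' (\<Phi> (s, t) $ 3) * D s t (a, b) $ 3 = a"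
proof -
  have h': "Z' (h s) * deriv h s = 1"
    using deriv_h_nonzero[OF assms] by (simp add: Z'_def Z(1)[OF assms])
  then show "Z' (\<Phi> (s, t) $ 3) * D s t (a, b) $ 3 = a"
    unfolding D_nth[OF assms] Phi_nth[OF assms] by algebra
  define n where "n = 1 - (h s)\<^sup>2"
  have n: "n > 0"
    using AB_pos[OF assms] by (simp add: n_def)
  have "\<Phi> (s, t) $ 1 * D s t (a, b) $ 2 - \<Phi> (s, t) $ 2 * D s t (a, b) $ 1
      = ((sin t)\<^sup>2 + (cos t)\<^sup>2) * (a * (A s * deriv B s - B s * deriv A s) + b * ((A s)\<^sup>2 + (B s)\<^sup>2))"
    unfolding Phi_nth[OF assms] D_nth[OF assms] by algebra
  also have "\<dots> = a * (A s * deriv B s - B s * deriv A s) + b * n"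
    using ABh[OF assms] by (simp add: n_def)
  finally have 1: "\<Phi> (s, t) $ 1 * D s t (a, b) $ 2 - \<Phi> (s, t) $ 2 * D s t (a, b) $ 1
      = a * (A s * deriv B s - B s * deriv A s) + b * n" .
  have "twist (h s) * (a * deriv h s) = (A s * deriv B s - B s * deriv A s) / n * a * (Z' (h s) * deriv h s)"
    by (simp add: twist_def Z(1)[OF assms] n_def)
  then have 2: "twist (h s) * (a * deriv h s) = a * (A s * deriv B s - B s * deriv A s) / n"
    using h' by simp
  show "\<Omega> (\<Phi> (s, t)) (D s t (a, b)) = b"
    unfolding \<Omega>_def 1 using n 2
    by (simp add: Phi_nth[OF assms] D_nth[OF assms] n_def[symmetric] field_simps)
qed


lemma Phi_curve:
  assumes "(\<sigma> has_real_derivative \<sigma>') (at t)" "(\<theta> has_real_derivative \<theta>') (at t)" "\<sigma> t \<in> I"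
  shows "((\<lambda>t. \<Phi> (\<sigma> t, \<theta> t)) has_vector_derivative D (\<sigma> t) (\<theta> t) (\<sigma>', \<theta>')) (at t)"
proof -
  have "((\<lambda>t. (\<sigma> t, \<theta> t)) has_vector_derivative (\<sigma>', \<theta>')) (at t)"
    using assms by (intro has_vector_derivative_Pair)
      (auto simp: has_real_derivative_iff_has_vector_derivative)
  from vector_derivative_diff_chain_within[OF this, of \<Phi> "D (\<sigma> t) (\<theta> t)"] Phi_deriv[OF assms(3), of "\<theta> t"]
  show ?thesis
    by (simp add: o_def has_derivative_at_withinI)
qed

lemma Phi_curve_smooth:
  fixes \<sigma> \<theta> :: "'a::euclidean_space \<Rightarrow> real"
  assumes "open S" "smooth_on \<sigma> S" "smooth_on \<theta> S" "\<And>t. t \<in> S \<Longrightarrow> \<sigma> t \<in> I"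
  shows "smooth_on (\<lambda>t. \<Phi> (\<sigma> t, \<theta> t)) S"
  by (rule smooth_on_compose[OF assms(1) open_dom _ Phi_smooth])
    (use assms in \<open>auto intro!: smooth_on_Pair\<close>)

text \<open>The quotient of \<open>\<gamma>\<^sub>1 + i \<gamma>\<^sub>2\<close> by its value on the meridian at the same height has modulus one and
  logarithmic derivative \<open>i \<Omega>\<close>.\<close>

lemma angular_derivative:
  assumes \<gamma>: "(\<gamma> has_vector_derivative v) (at t)" "\<bar>\<gamma> t $ 3\<bar> < 1"
    and S2: "open S" "t \<in> S" "\<And>u. u \<in> S \<Longrightarrow> \<gamma> u \<in> S2"
    and \<theta>: "(\<theta> has_real_derivative \<Omega> (\<gamma> t) v) (at t)"
  shows "((\<lambda>t. Complex (\<gamma> t $ 1) (\<gamma> t $ 2) / Complex (A (Z (\<gamma> t $ 3))) (B (Z (\<gamma> t $ 3))) * cis (- \<theta> t))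
      has_vector_derivative 0) (at t)"
proof -
  define s where "s = Z (\<gamma> t $ 3)"
  have s: "s \<in> I" "h s = \<gamma> t $ 3"
    using Z \<gamma>(2) by (auto simp: s_def)
  define s' where "s' = Z' (\<gamma> t $ 3) * v $ 3"
  define n where "n = 1 - (\<gamma> t $ 3)\<^sup>2"
  have n: "n > 0"
    using AB_pos[OF s(1)] s(2) by (simp add: n_def)
  define W C W' C' where "W = Complex (\<gamma> t $ 1) (\<gamma> t $ 2)" and "C = Complex (A s) (B s)"
    and "W' = Complex (v $ 1) (v $ 2)" and "C' = Complex (s' * deriv A s) (s' * deriv B s)"
  have Zd: "((\<lambda>t. Z (\<gamma> t $ 3)) has_real_derivative s') (at t)"
    unfolding s'_def Z'_def
    by (rule DERIV_chain2[OF Z_deriv[OF \<gamma>(2)] has_vector_derivative_nth[OF \<gamma>(1)]])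
  have dW: "((\<lambda>t. Complex (\<gamma> t $ 1) (\<gamma> t $ 2)) has_vector_derivative W') (at t)"
    unfolding W'_def has_vector_derivative_complex_iff
    using has_vector_derivative_nth[OF \<gamma>(1)] by simp
  have dC: "((\<lambda>t. Complex (A (Z (\<gamma> t $ 3))) (B (Z (\<gamma> t $ 3)))) has_vector_derivative C') (at t)"
    unfolding C'_def has_vector_derivative_complex_iff
    using DERIV_chain2[OF ABh_deriv(1)[OF s(1), unfolded s_def] Zd]
      DERIV_chain2[OF ABh_deriv(2)[OF s(1), unfolded s_def] Zd]
    by (simp add: mult.commute s_def)
  have de: "((\<lambda>t. cis (- \<theta> t)) has_vector_derivative - \<i> * \<Omega> (\<gamma> t) v * cis (- \<theta> t)) (at t)"
    unfolding has_vector_derivative_complex_iff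
    using \<theta> by (auto intro!: derivative_eq_intros)
  have WW: "W * cnj W = n" "C * cnj C = n"
  proof -
    have "(\<gamma> t $ 1)\<^sup>2 + (\<gamma> t $ 2)\<^sup>2 = n"
      using S2(3)[OF S2(2)] by (simp add: norm_eq_1_vec3 n_def)
    then show "W * cnj W = n"
      by (simp add: W_def complex_eq_iff power2_eq_square)
    show "C * cnj C = n"
      using ABh[OF s(1)] by (simp add: C_def complex_eq_iff power2_eq_square n_def s(2))
  qed
  then have nz: "W \<noteq> 0" "C \<noteq> 0"
    using n by auto
  have h's': "deriv h s * s' = v $ 3"
    using deriv_h_nonzero[OF s(1)] by (simp add: s'_def Z'_def s_def)
  have re: "\<gamma> t $ 1 * v $ 1 + \<gamma> t $ 2 * v $ 2 = s' * (A s * deriv A s + B s * deriv B s)"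
  proof -
    have "((\<lambda>t. (\<gamma> t $ 1)\<^sup>2 + (\<gamma> t $ 2)\<^sup>2 + (\<gamma> t $ 3)\<^sup>2) has_real_derivative
      2 * (\<gamma> t $ 1 * v $ 1 + \<gamma> t $ 2 * v $ 2 + \<gamma> t $ 3 * v $ 3)) (at t)"
      using has_vector_derivative_nth[OF \<gamma>(1)] by (auto intro!: derivative_eq_intros simp: algebra_simps)
    moreover have "((\<lambda>t. (\<gamma> t $ 1)\<^sup>2 + (\<gamma> t $ 2)\<^sup>2 + (\<gamma> t $ 3)\<^sup>2) has_real_derivative 0) (at t)"
      by (rule has_field_derivative_transform_within_open[of "\<lambda>s. 1" _ _ S])
        (use S2 in \<open>auto simp: norm_eq_1_vec3\<close>)
    ultimately have "\<gamma> t $ 1 * v $ 1 + \<gamma> t $ 2 * v $ 2 + \<gamma> t $ 3 * v $ 3 = 0"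
      using DERIV_unique by fastforce
    then show ?thesis
      unfolding deriv_ABh[OF s(1)] h's'[symmetric] s(2) by (simp add: algebra_simps)
  qed
  have tw: "twist (\<gamma> t $ 3) * v $ 3 = s' * (A s * deriv B s - B s * deriv A s) / n"
    by (simp add: twist_def s'_def n_def s_def)
  have im: "n * \<Omega> (\<gamma> t) v = (\<gamma> t $ 1 * v $ 2 - \<gamma> t $ 2 * v $ 1)
      - s' * (A s * deriv B s - B s * deriv A s)"
    unfolding \<Omega>_def tw n_def[symmetric] using n by (simp add: field_simps)
  \<comment> \<open>\<open>W\<close> and \<open>C\<close> keep the same squared modulus
    \<open>n\<close> along the curve, so the real parts cancel. The imaginary parts are the two
    Euclidean angular momenta, whose difference is \<open>n\<close> times \<Omega>.\<close>
  have key: "W' * cnj W - C' * cnj C = \<i> * (n * \<Omega> (\<gamma> t) v)"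
    unfolding im complex_eq_iff using re
    by (simp add: W'_def W_def C'_def C_def algebra_simps)
  have "W' * C - W * C' = \<i> * \<Omega> (\<gamma> t) v * W * C"
  proof -
    have "W * C * (W' * cnj W - C' * cnj C) = C * W' * (W * cnj W) - W * C' * (C * cnj C)"
      by (simp add: algebra_simps)
    then have "n * (W' * C - W * C') = W * C * (W' * cnj W - C' * cnj C)"
      unfolding WW by (simp add: algebra_simps)
    also have "\<dots> = n * (\<i> * \<Omega> (\<gamma> t) v * W * C)"
      unfolding key by simp
    finally show ?thesis using n by simp
  qed
  then have z: "(W' * C - W * C') / C\<^sup>2 * cis (- \<theta> t) + W / C * (- \<i> * \<Omega> (\<gamma> t) v * cis (- \<theta> t)) = 0"
    using nz by (simp add: field_simps power2_eq_square)
  have q: "((\<lambda>t. Complex (\<gamma> t $ 1) (\<gamma> t $ 2) / Complex (A (Z (\<gamma> t $ 3))) (B (Z (\<gamma> t $ 3))))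
      has_vector_derivative (W' * C - W * C') / C\<^sup>2) (at t)"
  proof -
    have "((\<lambda>t. Complex (A (Z (\<gamma> t $ 3))) (B (Z (\<gamma> t $ 3)))) has_derivative (\<lambda>x. x *\<^sub>R C')) (at t)"
      using dC by (simp add: has_vector_derivative_def)
    from has_derivative_divide[OF dW[unfolded has_vector_derivative_def] this]
    show ?thesis
      using nz unfolding has_vector_derivative_def
      by (rule_tac has_derivative_eq_rhs) (auto simp: fun_eq_iff C_def W_def s_def field_simps power2_eq_square scaleR_conv_of_real)
  qed
  from has_vector_derivative_mult[OF q de] z show ?thesis
    by (simp add: W_def C_def s_def add.commute)
qed

text \<open>The quotient of \<open>angular_derivative\<close> is constant, and equals 1 at
  \<open>t0\<close>. Extended-real end points allow for bounded open intervals, needed for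
  variations, as well as for the whole line, needed for geodesics.\<close>

lemma lift_eq:
  fixes a b :: ereal
  assumes \<gamma>: "\<And>t. t \<in> einterval a b \<Longrightarrow> (\<gamma> has_vector_derivative \<gamma>' t) (at t)"
      "\<And>t. t \<in> einterval a b \<Longrightarrow> \<gamma> t \<in> S2" "\<And>t. t \<in> einterval a b \<Longrightarrow> \<bar>\<gamma> t $ 3\<bar> < 1"
    and \<theta>: "\<And>t. t \<in> einterval a b \<Longrightarrow> (\<theta> has_real_derivative \<Omega> (\<gamma> t) (\<gamma>' t)) (at t)"
    and t0: "t0 \<in> einterval a b" "\<gamma> t0 = \<Phi> (Z (\<gamma> t0 $ 3), \<theta> t0)"
    and t: "t \<in> einterval a b"
  shows "\<gamma> t = \<Phi> (Z (\<gamma> t $ 3), \<theta> t)"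
proof -
  define N where "N t = Complex (\<gamma> t $ 1) (\<gamma> t $ 2) / Complex (A (Z (\<gamma> t $ 3))) (B (Z (\<gamma> t $ 3))) * cis (- \<theta> t)" for t
  have nz: "Complex (A (Z (\<gamma> t $ 3))) (B (Z (\<gamma> t $ 3))) \<noteq> 0" if "t \<in> einterval a b" for t
    using ABh[OF Z(2)[OF \<gamma>(3)[OF that]]] AB_pos[OF Z(2)[OF \<gamma>(3)[OF that]]]
    by (auto simp: complex_eq_iff)
  have "(N has_vector_derivative 0) (at t)" if "t \<in> einterval a b" for t
    unfolding N_def
    by (rule angular_derivative[OF _ _ open_einterval]) (use that \<gamma> \<theta> in auto)
  then have d: "(N has_derivative (\<lambda>x. 0)) (at t within einterval a b)" if "t \<in> einterval a b" for t
    using that by (auto simp: has_vector_derivative_def intro: has_derivative_at_withinI)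
  have "convex (einterval a b)"
    unfolding is_interval_convex_1[symmetric] is_interval_1
    by (auto simp: einterval_def) (metis ereal_less_eq(3) le_less_trans less_le_trans)+
  then obtain c where "\<And>t. t \<in> einterval a b \<Longrightarrow> N t = c"
    using has_derivative_zero_constant[OF _ d] by blast
  then have "N t = N t0"
    using t t0(1) by simp
  also have "N t0 = 1"
  proof -
    have "Complex (\<gamma> t0 $ 1) (\<gamma> t0 $ 2) = Complex (A (Z (\<gamma> t0 $ 3))) (B (Z (\<gamma> t0 $ 3))) * cis (\<theta> t0)"
      by (subst t0(2), subst (2) t0(2)) (use Z(2)[OF \<gamma>(3)[OF t0(1)]] in \<open>simp add: Phi_nth complex_eq_iff algebra_simps\<close>)
    then show ?thesis
      using nz[OF t0(1)] by (simp add: N_def cis_mult)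
  qed
  finally have "Complex (\<gamma> t $ 1) (\<gamma> t $ 2) * cis (- \<theta> t) * cis (\<theta> t)
      = Complex (A (Z (\<gamma> t $ 3))) (B (Z (\<gamma> t $ 3))) * cis (\<theta> t)"
    using nz[OF t] by (simp add: N_def field_simps)
  then have "Complex (\<gamma> t $ 1) (\<gamma> t $ 2) = Complex (A (Z (\<gamma> t $ 3))) (B (Z (\<gamma> t $ 3))) * cis (\<theta> t)"
    by (simp add: mult.assoc cis_mult)
  then show ?thesis
    using Z(2,3)[OF \<gamma>(3)[OF t]]
    by (simp add: vec_eq_iff forall_3 Phi_nth complex_eq_iff algebra_simps)
qed

text \<open>The angle is an antiderivative of \<Omega> along the curve, normalized by one polar
  representation at \<open>t0\<close>; no covering space argument is used.\<close>

lemma lift_exists: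
  fixes a b :: ereal
  assumes ab: "a < b"
    and \<gamma>: "\<And>t. t \<in> einterval a b \<Longrightarrow> (\<gamma> has_vector_derivative \<gamma>' t) (at t)"
      "\<And>t. t \<in> einterval a b \<Longrightarrow> \<gamma> t \<in> S2" "\<And>t. t \<in> einterval a b \<Longrightarrow> \<bar>\<gamma> t $ 3\<bar> < 1"
    and cont: "continuous_on (einterval a b) (\<lambda>t. \<Omega> (\<gamma> t) (\<gamma>' t))"
  obtains \<theta> where "\<And>t. t \<in> einterval a b \<Longrightarrow> \<gamma> t = \<Phi> (Z (\<gamma> t $ 3), \<theta> t)"
    "\<And>t. t \<in> einterval a b \<Longrightarrow> (\<theta> has_real_derivative \<Omega> (\<gamma> t) (\<gamma>' t)) (at t)"
proof -
  obtain t0 where t0: "t0 \<in> einterval a b"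
    using einterval_nonempty[OF ab] by blast
  obtain s \<theta>0 where s: "s \<in> I" "\<gamma> t0 = \<Phi> (s, \<theta>0)"
    using Phi_surj[of "\<gamma> t0"] \<gamma> t0 by metis
  have "isCont (\<lambda>t. \<Omega> (\<gamma> t) (\<gamma>' t)) t" if "t \<in> einterval a b" for t
    using cont that open_einterval continuous_on_eq_continuous_at by blast
  then obtain F where F: "\<And>t. t \<in> einterval a b \<Longrightarrow> (F has_real_derivative \<Omega> (\<gamma> t) (\<gamma>' t)) (at t)"
    using einterval_antiderivative[OF ab, of "\<lambda>t. \<Omega> (\<gamma> t) (\<gamma>' t)"]
    by (auto simp: einterval_def has_real_derivative_iff_has_vector_derivative)
  define \<theta> where "\<theta> t = F t + (\<theta>0 - F t0)" for t
  have \<theta>: "(\<theta> has_real_derivative \<Omega> (\<gamma> t) (\<gamma>' t)) (at t)" if "t \<in> einterval a b" for t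
    unfolding \<theta>_def using F[OF that] by (auto intro!: derivative_eq_intros)
  have "\<gamma> t0 = \<Phi> (Z (\<gamma> t0 $ 3), \<theta> t0)"
    using s by (simp add: \<theta>_def Z_Phi)
  then show ?thesis
    using that[OF lift_eq[OF \<gamma> \<theta> t0] \<theta>] by blast
qed

text \<open>The parameter \<open>p\<close> ranges over an arbitrary Euclidean space, so that single
  curves and two-parameter variations are both covered.\<close>

lemma Omega_smooth:
  assumes "open S" "smooth_on x S" "smooth_on v S" "\<And>p. p \<in> S \<Longrightarrow> \<bar>x p $ 3\<bar> < 1"
  shows "smooth_on (\<lambda>p. \<Omega> (x p) (v p)) S" "smooth_on (\<lambda>p. Z (x p $ 3)) S"
    "smooth_on (\<lambda>p. Z' (x p $ 3) * v p $ 3) S"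
proof -
  have x3: "smooth_on (\<lambda>p. x p $ 3) S"
    using assms by (intro smooth_on_nth)
  have "(\<lambda>p. x p $ 3) ` S \<subseteq> {-1<..<1}"
    using assms(4) by (auto simp: abs_less_iff)
  then show Zs: "smooth_on (\<lambda>p. Z (x p $ 3)) S"
    by (rule smooth_on_compose[OF assms(1) open_greaterThanLessThan _ Z_smooth x3])
  have comp: "smooth_on (\<lambda>p. F (Z (x p $ 3))) S" if "smooth_on F I" for F :: "real \<Rightarrow> real"
    by (rule smooth_on_compose[OF assms(1) _ _ that Zs]) (use assms(4) Z(2) in auto)
  have Z's: "smooth_on (\<lambda>p. Z' (x p $ 3)) S"
    unfolding Z'_def using assms deriv_h_nonzero Z(2)
    by (intro smooth_on_inverse comp smooth_on_deriv ABh_smooth) auto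
  then show "smooth_on (\<lambda>p. Z' (x p $ 3) * v p $ 3) S"
    using assms by (intro smooth_on_mult smooth_on_nth)
  show "smooth_on (\<lambda>p. \<Omega> (x p) (v p)) S"
    unfolding \<Omega>_def twist_def
    using assms Z's AB_pos[OF Z(2)] Z(3)
    by (intro smooth_on_diff smooth_on_divide smooth_on_mult smooth_on_nth smooth_on_power
        smooth_on_const comp smooth_on_deriv ABh_smooth) (auto, (metis abs_square_less_1 less_irrefl right_minus_eq)+)
qed

end

section \<open>The geodesic equations\<close>

text \<open>The second bound is the first one applied to the Taylor remainder in \<open>u\<close>,
  whose derivative is a difference of values of \<open>deriv F\<close> and so bounded by
  \<open>C\<close> times the distance.\<close>

lemma smooth_Taylor_bounds:
  fixes F :: "real \<Rightarrow> real"
  assumes "smooth_on F UNIV"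
  obtains C where "0 \<le> C"
    "\<And>u v. u \<in> {a..b} \<Longrightarrow> v \<in> {a..b} \<Longrightarrow> \<bar>F u - F v\<bar> \<le> C * \<bar>u - v\<bar>"
    "\<And>u v. u \<in> {a..b} \<Longrightarrow> v \<in> {a..b} \<Longrightarrow> \<bar>F u - F v - deriv F v * (u - v)\<bar> \<le> C * (u - v)\<^sup>2"
proof -
  note d1 = smooth_on_has_real_derivative[OF assms UNIV_I]
  note F' = smooth_on_deriv[OF open_UNIV assms]
  note d2 = smooth_on_has_real_derivative[OF F' UNIV_I]
  note F'' = smooth_on_deriv[OF open_UNIV F']
  obtain C1 C2 where C: "\<And>x. x \<in> {a..b} \<Longrightarrow> norm (deriv F x) \<le> C1"
      "\<And>x. x \<in> {a..b} \<Longrightarrow> norm (deriv (deriv F) x) \<le> C2"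
    using continuous_on_compact_bound[OF compact_Icc continuous_on_subset[OF smooth_on_continuous[OF F'] subset_UNIV]]
      continuous_on_compact_bound[OF compact_Icc continuous_on_subset[OF smooth_on_continuous[OF F''] subset_UNIV]]
    by metis
  define C where "C = max 0 (max C1 C2)"
  have C1: "\<bar>deriv F x\<bar> \<le> C" "\<bar>deriv (deriv F) x\<bar> \<le> C" if "x \<in> {a..b}" for x
    using C(1)[OF that] C(2)[OF that] by (auto simp: C_def)
  have L: "\<bar>G u - G v\<bar> \<le> B * \<bar>u - v\<bar>"
    if "\<And>x. (G has_real_derivative G' x) (at x)" "\<And>x. x \<in> closed_segment v u \<Longrightarrow> \<bar>G' x\<bar> \<le> B"
    for G G' :: "real \<Rightarrow> real" and B u v
    using field_differentiable_bound[of "closed_segment v u" G G' B u v] that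
    by (auto intro: has_field_derivative_at_within)
  have seg: "closed_segment v u \<subseteq> {a..b}" if "u \<in> {a..b}" "v \<in> {a..b}" for u v
    using that closed_segment_subset[of v "{a..b}" u] by simp
  show ?thesis
  proof
    show "0 \<le> C"
      by (simp add: C_def)
    fix u v assume uv: "u \<in> {a..b}" "v \<in> {a..b}"
    show "\<bar>F u - F v\<bar> \<le> C * \<bar>u - v\<bar>"
      by (rule L[OF d1]) (use C1(1) seg[OF uv] in blast)
    have "\<bar>(F u - F v - deriv F v * (u - v)) - (F v - F v - deriv F v * (v - v))\<bar> \<le> C * \<bar>u - v\<bar> * \<bar>u - v\<bar>"
    proof (rule L)
      show "((\<lambda>x. F x - F v - deriv F v * (x - v)) has_real_derivative deriv F x - deriv F v) (at x)" for x
        by (auto intro!: derivative_eq_intros d1)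
      fix x assume x: "x \<in> closed_segment v u"
      then have x': "x \<in> {a..b}"
        using seg[OF uv] by blast
      have "\<bar>deriv F x - deriv F v\<bar> \<le> C * \<bar>x - v\<bar>"
        by (rule L[OF d2]) (use C1(2) seg[OF x' uv(2)] in blast)
      also have "\<bar>x - v\<bar> \<le> \<bar>u - v\<bar>"
        using x by (auto simp: closed_segment_eq_real_ivl split: if_splits)
      finally show "\<bar>deriv F x - deriv F v\<bar> \<le> C * \<bar>u - v\<bar>"
        by (simp add: C_def mult_left_mono)
    qed
    then show "\<bar>F u - F v - deriv F v * (u - v)\<bar> \<le> C * (u - v)\<^sup>2"
      by (simp add: power2_eq_square abs_mult_self_eq mult.assoc)
  qed
qed

lemma smooth_Lipschitz_fst:
  fixes F :: "real \<times> real \<Rightarrow> real"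
  assumes "smooth_on F U" "{-d..d} \<times> {a..b} \<subseteq> U" "0 \<le> d"
  obtains C where "0 \<le> C"
    "\<And>s t. s \<in> {-d..d} \<Longrightarrow> t \<in> {a..b} \<Longrightarrow> \<bar>F (s, t) - F (0, t)\<bar> \<le> C * \<bar>s\<bar>"
proof -
  define G where "G p = frechet_derivative F (at p) (1, 0)" for p
  have "continuous_on ({-d..d} \<times> {a..b}) G"
    unfolding G_def
    by (rule continuous_on_subset[OF smooth_on_continuous[OF smooth_on_partial[OF assms(1)]] assms(2)])
  then obtain C where C: "\<And>p. p \<in> {-d..d} \<times> {a..b} \<Longrightarrow> norm (G p) \<le> C"
    using continuous_on_compact_bound[OF compact_Times[OF compact_Icc compact_Icc]] by metis
  have der: "((\<lambda>s. F (s, t)) has_real_derivative G (s, t)) (at s)" if "s \<in> {-d..d}" "t \<in> {a..b}" for s t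
  proof -
    have F: "(F has_derivative frechet_derivative F (at (s, t))) (at (s, t))"
      by (rule smooth_on_has_derivative[OF assms(1)]) (use assms(2) that in auto)
    have "((\<lambda>s. (s, t)) has_vector_derivative (1, 0)) (at s)"
      by (auto intro!: derivative_eq_intros)
    from vector_derivative_diff_chain_within[OF this has_derivative_at_withinI[OF F]]
    show ?thesis
      by (simp add: G_def o_def has_real_derivative_iff_has_vector_derivative)
  qed
  show ?thesis
  proof
    show "0 \<le> max 0 C" by simp
    fix s t assume st: "s \<in> {-d..d}" "t \<in> {a..b}"
    have "norm (F (s, t) - F (0, t)) \<le> C * norm (s - 0)"
      by (rule field_differentiable_bound[of "{-d..d}" _ "\<lambda>s. G (s, t)"])
        (use C der st assms(3) in \<open>auto intro: has_field_derivative_at_within\<close>)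
    then have "\<bar>F (s, t) - F (0, t)\<bar> \<le> C * \<bar>s\<bar>"
      by simp
    also have "\<dots> \<le> max 0 C * \<bar>s\<bar>"
      by (simp add: mult_right_mono)
    finally show "\<bar>F (s, t) - F (0, t)\<bar> \<le> max 0 C * \<bar>s\<bar>" .
  qed
qed

lemma has_real_derivative_zeroI:
  fixes E :: "real \<Rightarrow> real"
  assumes "0 < e" "\<And>s. \<bar>s\<bar> < e \<Longrightarrow> \<bar>E s - E 0\<bar> \<le> K * s\<^sup>2"
  shows "(E has_real_derivative 0) (at 0)"
  unfolding has_field_derivative_iff
proof (rule Lim_null_comparison)
  have "\<forall>\<^sub>F s in at 0. s \<in> ball (0::real) e"
    using assms(1) by (intro eventually_at_in_open') auto
  then show "\<forall>\<^sub>F s in at 0. norm ((E s - E 0) / (s - 0)) \<le> K * \<bar>s\<bar>"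
  proof (eventually_elim)
    case (elim s)
    then have "\<bar>E s - E 0\<bar> \<le> K * (\<bar>s\<bar> * \<bar>s\<bar>)"
      using assms(2)[of s] by (simp add: power2_eq_square dist_real_def)
    then show ?case
      by (cases "s = 0") (auto simp: field_simps)
  qed
  show "((\<lambda>s. K * \<bar>s\<bar>) \<longlongrightarrow> 0) (at (0::real))"
    by (auto intro!: tendsto_eq_intros)
qed

section \<open>Solutions of the reduced equations are geodesics\<close>

context profile
begin

lemma Phi_angle_eq:
  assumes "s \<in> I" "\<Phi> (s, t) = \<Phi> (s, t')"
  shows "\<exists>n::int. t = t' + 2 * pi * n"
proof -
  have nz: "Complex (A s) (B s) \<noteq> 0"
    using ABh[OF assms(1)] AB_pos[OF assms(1)] by (auto simp: complex_eq_iff)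
  have "Complex (A s) (B s) * cis t = Complex (A s) (B s) * cis t'"
    using arg_cong[OF assms(2), of "\<lambda>x. x $ 1"] arg_cong[OF assms(2), of "\<lambda>x. x $ 2"]
    by (simp add: Phi_nth[OF assms(1)] complex_eq_iff algebra_simps)
  then have "cis t = cis t'"
    using nz by simp
  then have "sin t = sin t'" "cos t = cos t'"
    by (auto simp: complex_eq_iff)
  then show ?thesis
    using sin_cos_eq_iff by blast
qed

lemma Phi_periodic: "s \<in> I \<Longrightarrow> \<Phi> (s, t + 2 * pi * of_int n) = \<Phi> (s, t)"
  by (simp add: vec_eq_iff forall_3 Phi_nth sin_add cos_add sin_integer_2pi cos_integer_2pi)

text \<open>The formula contains no angle, but its proof chooses a lift: by uniqueness of
  derivatives the velocity is the image of the coordinate velocity, to which the normal form of the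
  metric applies.\<close>

lemma speed_sq:
  fixes a b :: ereal
  assumes ab: "a < b"
    and \<gamma>: "\<And>t. t \<in> einterval a b \<Longrightarrow> (\<gamma> has_vector_derivative \<gamma>' t) (at t)"
      "\<And>t. t \<in> einterval a b \<Longrightarrow> \<gamma> t \<in> S2" "\<And>t. t \<in> einterval a b \<Longrightarrow> \<bar>\<gamma> t $ 3\<bar> < 1"
    and cont: "continuous_on (einterval a b) (\<lambda>t. \<Omega> (\<gamma> t) (\<gamma>' t))"
    and t: "t \<in> einterval a b"
  shows "g (\<gamma> t) (\<gamma>' t) (\<gamma>' t)
    = (Z' (\<gamma> t $ 3) * \<gamma>' t $ 3)\<^sup>2 + (f (Z (\<gamma> t $ 3)))\<^sup>2 * (\<Omega> (\<gamma> t) (\<gamma>' t))\<^sup>2"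
proof -
  obtain \<theta> where \<theta>: "\<And>t. t \<in> einterval a b \<Longrightarrow> \<gamma> t = \<Phi> (Z (\<gamma> t $ 3), \<theta> t)"
    "\<And>t. t \<in> einterval a b \<Longrightarrow> (\<theta> has_real_derivative \<Omega> (\<gamma> t) (\<gamma>' t)) (at t)"
    using lift_exists[OF ab \<gamma> cont] by blast
  let ?s = "Z (\<gamma> t $ 3)"
  have sI: "?s \<in> I"
    using Z \<gamma>(3)[OF t] by blast
  have "((\<lambda>t. Z (\<gamma> t $ 3)) has_real_derivative Z' (\<gamma> t $ 3) * \<gamma>' t $ 3) (at t)"
    unfolding Z'_def by (rule DERIV_chain2[OF Z_deriv[OF \<gamma>(3)[OF t]] has_vector_derivative_nth[OF \<gamma>(1)[OF t]]])
  from Phi_curve[OF this \<theta>(2)[OF t] sI]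
  have "(\<gamma> has_vector_derivative D ?s (\<theta> t) (Z' (\<gamma> t $ 3) * \<gamma>' t $ 3, \<Omega> (\<gamma> t) (\<gamma>' t))) (at t)"
    by (rule has_vector_derivative_transform_within_open[OF _ open_einterval t]) (simp add: \<theta>(1)[symmetric])
  then have "\<gamma>' t = D ?s (\<theta> t) (Z' (\<gamma> t $ 3) * \<gamma>' t $ 3, \<Omega> (\<gamma> t) (\<gamma>' t))"
    using \<gamma>(1)[OF t] vector_derivative_unique_at by blast
  then show ?thesis
    using metric_D[OF sI, of "\<theta> t" "Z' (\<gamma> t $ 3) * \<gamma>' t $ 3" "\<Omega> (\<gamma> t) (\<gamma>' t)" "Z' (\<gamma> t $ 3) * \<gamma>' t $ 3" "\<Omega> (\<gamma> t) (\<gamma>' t)"]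
      \<theta>(1)[OF t] by (metis power2_eq_square)
qed

text \<open>The first variation of the energy is computed without mixed partial derivatives: after
  subtracting the derivative of \<open>2 \<sigma>' (\<Sigma> - \<sigma>) + 2 k (\<vartheta> - \<theta>)\<close>, which integrates to zero,
  the difference of the energy densities is \<open>O(s\<^sup>2)\<close>.\<close>

lemma geodesicI:
  assumes sm: "smooth_on \<sigma> UNIV" "smooth_on \<theta> UNIV" and sI: "\<And>t. \<sigma> t \<in> I"
    and d: "\<And>t. (\<sigma> has_real_derivative \<sigma>1 t) (at t)" "\<And>t. (\<theta> has_real_derivative \<theta>1 t) (at t)"
      "\<And>t. (\<sigma>1 has_real_derivative f (\<sigma> t) * deriv f (\<sigma> t) * (\<theta>1 t)\<^sup>2) (at t)"
    and k: "\<And>t. (f (\<sigma> t))\<^sup>2 * \<theta>1 t = k"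
  shows "geodesic g (\<lambda>t. \<Phi> (\<sigma> t, \<theta> t))"
  unfolding geodesic_def
proof (intro conjI allI impI)
  show "smooth_on (\<lambda>t. \<Phi> (\<sigma> t, \<theta> t)) UNIV"
    by (rule Phi_curve_smooth) (use sm sI in auto)
  show "range (\<lambda>t. \<Phi> (\<sigma> t, \<theta> t)) \<subseteq> S2"
    using Phi_S2(1)[OF sI] by blast
  fix a b :: real and \<Gamma> :: "real \<times> real \<Rightarrow> real^3"
  assume ab: "a < b" and \<Gamma>: "smooth_on \<Gamma> UNIV" "range \<Gamma> \<subseteq> S2" "\<forall>t. \<Gamma> (0, t) = \<Phi> (\<sigma> t, \<theta> t)"
    "\<forall>s. \<Gamma> (s, a) = \<Phi> (\<sigma> a, \<theta> a) \<and> \<Gamma> (s, b) = \<Phi> (\<sigma> b, \<theta> b)"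
  define U where "U = {p. \<bar>\<Gamma> p $ 3\<bar> < 1}"
  have contG: "continuous_on UNIV (\<lambda>p. \<Gamma> p $ 3)"
    by (intro continuous_intros smooth_on_continuous[OF \<Gamma>(1)])
  have U: "open U"
    unfolding U_def by (intro open_Collect_less continuous_intros contG)
  have "compact ({0} \<times> {a..b})" "{0} \<times> {a..b} \<subseteq> U"
    using \<Gamma>(3) Phi_S2(2)[OF sI] by (auto simp: U_def intro: compact_Times)
  then obtain e where e: "e > 0" "(\<Union>x\<in>{0} \<times> {a..b}. ball x e) \<subseteq> U"
    using compact_subset_open_imp_ball_epsilon_subset[OF _ U] by metis
  define \<delta> where "\<delta> = min 1 (e / 2)"
  have \<delta>: "0 < \<delta>" "\<delta> \<le> 1" "2 * \<delta> \<le> e"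
    using e(1) by (auto simp: \<delta>_def)
  \<comment> \<open>The margin \<delta> beyond both ends provides open time intervals containing
    \<open>{a..b}\<close> on which the varied curves still avoid the poles, as
    \<open>lift_exists\<close> requires.\<close>
  have inU: "(s, t) \<in> U" if "\<bar>s\<bar> \<le> \<delta>" "a - \<delta> < t" "t < b + \<delta>" for s t
  proof -
    define t' where "t' = max a (min b t)"
    have t': "t' \<in> {a..b}" "\<bar>t' - t\<bar> < \<delta>"
      using that ab \<delta> by (auto simp: t'_def)
    have "dist (0, t') (s, t) \<le> \<bar>s\<bar> + \<bar>t' - t\<bar>"
      using norm_Pair_le[of "-s" "t' - t"] by (simp add: dist_norm)
    also have "\<dots> < e"
      using that t' \<delta> by linarith
    finally show ?thesis
      using e(2) t'(1) by (auto simp: subset_eq)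
  qed
  define T where "T p = frechet_derivative \<Gamma> (at p) (0, 1)" for p
  have T: "((\<lambda>t. \<Gamma> (s, t)) has_vector_derivative T (s, t)) (at t)" for s t
  proof -
    have "((\<lambda>t. (s, t)) has_vector_derivative (0, 1)) (at t)"
      by (auto intro!: derivative_eq_intros)
    from vector_derivative_diff_chain_within[OF this has_derivative_at_withinI[OF smooth_on_has_derivative[OF \<Gamma>(1)]]]
    show ?thesis by (simp add: T_def o_def)
  qed
  define S where "S p = Z (\<Gamma> p $ 3)" for p
  define S1 where "S1 p = Z' (\<Gamma> p $ 3) * T p $ 3" for p
  define W where "W p = \<Omega> (\<Gamma> p) (T p)" for p
  have "smooth_on T UNIV"
    unfolding T_def by (rule smooth_on_partial[OF \<Gamma>(1)])
  then have TU: "smooth_on T U"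
    by (rule smooth_on_subset) simp
  have lt1: "\<And>p. p \<in> U \<Longrightarrow> \<bar>\<Gamma> p $ 3\<bar> < 1"
    by (simp add: U_def)
  have smU: "smooth_on S U" "smooth_on S1 U" "smooth_on W U"
    unfolding S_def S1_def W_def
    using Omega_smooth[OF U smooth_on_subset[OF \<Gamma>(1) subset_UNIV] TU lt1] by auto
  have SI: "S p \<in> I" if "p \<in> U" for p
    using that Z(2) by (simp add: U_def S_def)
  have at0: "S (0, t) = \<sigma> t" "S1 (0, t) = \<sigma>1 t" "W (0, t) = \<theta>1 t" for t
  proof -
    have "T (0, t) = D (\<sigma> t) (\<theta> t) (\<sigma>1 t, \<theta>1 t)"
      using vector_derivative_unique_at[OF T[of 0 t]] Phi_curve[OF d(1,2) sI] \<Gamma>(3) by simp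
    then show "S (0, t) = \<sigma> t" "S1 (0, t) = \<sigma>1 t" "W (0, t) = \<theta>1 t"
      using \<Gamma>(3) Omega_D[OF sI] Z_Phi[OF sI] by (auto simp: S_def S1_def W_def)
  qed
  have rect: "{-\<delta>..\<delta>} \<times> {a..b} \<subseteq> U"
    using inU \<delta> by auto
  obtain C1 where C1: "0 \<le> C1" "\<And>s t. s \<in> {-\<delta>..\<delta>} \<Longrightarrow> t \<in> {a..b} \<Longrightarrow> \<bar>S (s, t) - S (0, t)\<bar> \<le> C1 * \<bar>s\<bar>"
    using smooth_Lipschitz_fst[OF smU(1) rect] \<delta> by auto
  obtain C2 where C2: "0 \<le> C2" "\<And>s t. s \<in> {-\<delta>..\<delta>} \<Longrightarrow> t \<in> {a..b} \<Longrightarrow> \<bar>S1 (s, t) - S1 (0, t)\<bar> \<le> C2 * \<bar>s\<bar>"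
    using smooth_Lipschitz_fst[OF smU(2) rect] \<delta> by auto
  obtain C3 where C3: "0 \<le> C3" "\<And>s t. s \<in> {-\<delta>..\<delta>} \<Longrightarrow> t \<in> {a..b} \<Longrightarrow> \<bar>W (s, t) - W (0, t)\<bar> \<le> C3 * \<bar>s\<bar>"
    using smooth_Lipschitz_fst[OF smU(3) rect] \<delta> by auto
  define C where "C = C1 + C2 + C3"
  have C: "0 \<le> C" "\<bar>S (s, t) - \<sigma> t\<bar> \<le> C * \<bar>s\<bar>" "\<bar>S1 (s, t) - \<sigma>1 t\<bar> \<le> C * \<bar>s\<bar>" "\<bar>W (s, t) - \<theta>1 t\<bar> \<le> C * \<bar>s\<bar>"
    if "\<bar>s\<bar> \<le> \<delta>" "t \<in> {a..b}" for s t
  proof -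
    have le: "C1 * \<bar>s\<bar> \<le> C * \<bar>s\<bar>" "C2 * \<bar>s\<bar> \<le> C * \<bar>s\<bar>" "C3 * \<bar>s\<bar> \<le> C * \<bar>s\<bar>"
      using C1(1) C2(1) C3(1) by (auto simp: C_def intro!: mult_right_mono)
    have "s \<in> {-\<delta>..\<delta>}" using that by auto
    note this that(2)
    note C1(2)[OF this, unfolded at0] C2(2)[OF this, unfolded at0] C3(2)[OF this, unfolded at0]
    then show "\<bar>S (s, t) - \<sigma> t\<bar> \<le> C * \<bar>s\<bar>" "\<bar>S1 (s, t) - \<sigma>1 t\<bar> \<le> C * \<bar>s\<bar>" "\<bar>W (s, t) - \<theta>1 t\<bar> \<le> C * \<bar>s\<bar>"
      using le by linarith+
    show "0 \<le> C"
      using C1 C2 C3 by (simp add: C_def)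
  qed
  define F where "F x = (f x)\<^sup>2" for x
  have F: "smooth_on F UNIV"
    unfolding F_def by (intro smooth_on_power f_smooth) auto
  have F': "deriv F x = 2 * f x * deriv f x" for x
    unfolding F_def using smooth_on_has_real_derivative[OF f_smooth, of x]
    by (intro DERIV_imp_deriv) (auto intro!: derivative_eq_intros)
  obtain CF where CF: "0 \<le> CF" "\<And>u v. u \<in> {0..m} \<Longrightarrow> v \<in> {0..m} \<Longrightarrow> \<bar>F u - F v\<bar> \<le> CF * \<bar>u - v\<bar>"
    "\<And>u v. u \<in> {0..m} \<Longrightarrow> v \<in> {0..m} \<Longrightarrow> \<bar>F u - F v - deriv F v * (u - v)\<bar> \<le> CF * (u - v)\<^sup>2"
    using smooth_Taylor_bounds[OF F] by metis
  have \<sigma>cont: "continuous_on UNIV \<sigma>" "continuous_on UNIV \<sigma>1" "continuous_on UNIV \<theta>1"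
  proof -
    show "continuous_on UNIV \<sigma>" "continuous_on UNIV \<sigma>1"
      by (rule DERIV_continuous_on[OF has_field_derivative_at_within[OF d(1)]]
          DERIV_continuous_on[OF has_field_derivative_at_within[OF d(3)]])+
    have "continuous_on UNIV (deriv \<theta>)"
      by (intro smooth_on_continuous smooth_on_deriv sm) auto
    moreover have "deriv \<theta> = \<theta>1"
      using d(2) by (auto intro: DERIV_imp_deriv)
    ultimately show "continuous_on UNIV \<theta>1" by simp
  qed
  have "continuous_on {a..b} (\<lambda>t. F (\<sigma> t))"
    by (rule continuous_on_compose2[OF smooth_on_continuous[OF F] continuous_on_subset[OF \<sigma>cont(1)]]) auto
  then obtain K M where K: "\<And>t. t \<in> {a..b} \<Longrightarrow> norm (\<theta>1 t) \<le> K" and M: "\<And>t. t \<in> {a..b} \<Longrightarrow> norm (F (\<sigma> t)) \<le> M"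
    using continuous_on_compact_bound[OF compact_Icc continuous_on_subset[OF \<sigma>cont(3) subset_UNIV]]
      continuous_on_compact_bound[OF compact_Icc] by metis
  note K = K[unfolded real_norm_def] and M = M[unfolded real_norm_def]
  \<comment> \<open>Twice the energy density of the varied curve.\<close>
  define X where "X s t = (S1 (s, t))\<^sup>2 + F (S (s, t)) * (W (s, t))\<^sup>2" for s t
  \<comment> \<open>One summand for each of the four terms of the identity \<open>eq\<close> below.
    In the third, one factor \<bar>s\<bar> is estimated by 1, so that the bound remains
    quadratic.\<close>
  define Q where "Q = C\<^sup>2 + CF * C\<^sup>2 * K\<^sup>2 + CF * C * (2 * K * C + C\<^sup>2) + M * C\<^sup>2"
  define P' where "P' s t = 2 * (f (\<sigma> t) * deriv f (\<sigma> t) * (\<theta>1 t)\<^sup>2 * (S (s, t) - \<sigma> t) + \<sigma>1 t * (S1 (s, t) - \<sigma>1 t))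
      + 2 * k * (W (s, t) - \<theta>1 t)" for s t
  have rest: "\<bar>X s t - X 0 t - P' s t\<bar> \<le> Q * s\<^sup>2" if s: "\<bar>s\<bar> \<le> \<delta>" and t: "t \<in> {a..b}" for s t
  proof -
    define x y w where "x = S (s, t) - \<sigma> t" and "y = S1 (s, t) - \<sigma>1 t" and "w = W (s, t) - \<theta>1 t"
    note c = C[OF s t, folded x_def y_def w_def]
    have Cs: "0 \<le> C * \<bar>s\<bar>" "(C * \<bar>s\<bar>)\<^sup>2 = C\<^sup>2 * s\<^sup>2" "C * \<bar>s\<bar> \<le> C"
      using c(1) s \<delta> by (auto simp: power_mult_distrib mult_left_le)
    have K0: "0 \<le> K" "0 \<le> M" using K[OF t] M[OF t] by linarith+
    have sq: "x\<^sup>2 \<le> C\<^sup>2 * s\<^sup>2" "y\<^sup>2 \<le> C\<^sup>2 * s\<^sup>2" "w\<^sup>2 \<le> C\<^sup>2 * s\<^sup>2"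
      using power_mono[OF c(2), of 2] power_mono[OF c(3), of 2] power_mono[OF c(4), of 2]
      by (simp_all add: Cs)
    have mem: "S (s, t) \<in> {0..m}" "\<sigma> t \<in> {0..m}"
      using SI[of "(s, t)"] inU[OF s, of t] t \<delta> sI[of t] by auto
    note f1 = CF(2)[OF mem, folded x_def] and f2 = CF(3)[OF mem, folded x_def]
    have kk: "k = F (\<sigma> t) * \<theta>1 t"
      using k[of t] by (simp add: F_def)
    have S: "S1 (s, t) = \<sigma>1 t + y" "W (s, t) = \<theta>1 t + w" "S (s, t) - \<sigma> t = x"
      by (simp_all add: x_def y_def w_def)
    have eq: "X s t - X 0 t - P' s t = y\<^sup>2 + (F (S (s, t)) - F (\<sigma> t) - deriv F (\<sigma> t) * x) * (\<theta>1 t)\<^sup>2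
        + (F (S (s, t)) - F (\<sigma> t)) * (2 * \<theta>1 t * w + w\<^sup>2) + F (\<sigma> t) * w\<^sup>2"
      unfolding X_def P'_def at0 S kk F' by (simp add: power2_eq_square algebra_simps)
    have b1: "\<bar>(F (S (s, t)) - F (\<sigma> t) - deriv F (\<sigma> t) * x) * (\<theta>1 t)\<^sup>2\<bar> \<le> (CF * (C\<^sup>2 * s\<^sup>2)) * K\<^sup>2"
      unfolding abs_mult
    proof (rule mult_mono)
      show "\<bar>F (S (s, t)) - F (\<sigma> t) - deriv F (\<sigma> t) * x\<bar> \<le> CF * (C\<^sup>2 * s\<^sup>2)"
        using f2 mult_left_mono[OF sq(1) CF(1)] by linarith
      show "\<bar>(\<theta>1 t)\<^sup>2\<bar> \<le> K\<^sup>2"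
        using power_mono[OF K[OF t], of 2] by simp
    qed (use CF in auto)
    have b2: "\<bar>(F (S (s, t)) - F (\<sigma> t)) * (2 * \<theta>1 t * w + w\<^sup>2)\<bar> \<le> (CF * (C * \<bar>s\<bar>)) * (2 * K * (C * \<bar>s\<bar>) + C * (C * \<bar>s\<bar>))"
      unfolding abs_mult
    proof (rule mult_mono)
      show "\<bar>F (S (s, t)) - F (\<sigma> t)\<bar> \<le> CF * (C * \<bar>s\<bar>)"
        using f1 mult_left_mono[OF c(2) CF(1)] by linarith
      have "\<bar>2 * \<theta>1 t * w\<bar> \<le> 2 * K * (C * \<bar>s\<bar>)"
        using mult_mono[OF K[OF t] c(4) K0(1)] by (simp add: abs_mult)
      moreover have "\<bar>w\<^sup>2\<bar> \<le> C * (C * \<bar>s\<bar>)"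
        using mult_mono[of "\<bar>w\<bar>" C "\<bar>w\<bar>" "C * \<bar>s\<bar>"] c Cs by (simp add: power2_eq_square abs_mult)
      ultimately show "\<bar>2 * \<theta>1 t * w + w\<^sup>2\<bar> \<le> 2 * K * (C * \<bar>s\<bar>) + C * (C * \<bar>s\<bar>)"
        by linarith
    qed (use CF c Cs in auto)
    have b3: "\<bar>F (\<sigma> t) * w\<^sup>2\<bar> \<le> M * (C\<^sup>2 * s\<^sup>2)"
      unfolding abs_mult by (rule mult_mono) (use M[OF t] sq K0 in auto)
    have "Q * s\<^sup>2 = C\<^sup>2 * s\<^sup>2 + (CF * (C\<^sup>2 * s\<^sup>2)) * K\<^sup>2 + (CF * (C * \<bar>s\<bar>)) * (2 * K * (C * \<bar>s\<bar>) + C * (C * \<bar>s\<bar>))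
        + M * (C\<^sup>2 * s\<^sup>2)"
      by (simp add: Q_def algebra_simps power2_eq_square)
    moreover have "\<bar>p1 + p2 + p3 + p4\<bar> \<le> q1 + q2 + q3 + q4"
      if "\<bar>p1\<bar> \<le> q1" "\<bar>p2\<bar> \<le> q2" "\<bar>p3\<bar> \<le> q3" "\<bar>p4\<bar> \<le> q4" for p1 p2 p3 p4 q1 q2 q3 q4 :: real
      using that by linarith
    ultimately show ?thesis
      unfolding eq using b1 b2 b3 sq(2) by simp
  qed
  define J where "J = einterval (a - \<delta>) (b + \<delta>)"
  have ereal_lt: "ereal (a - \<delta>) < ereal (b + \<delta>)"
    using ab \<delta> by simp
  have J: "(s, t) \<in> U" if "\<bar>s\<bar> \<le> \<delta>" "t \<in> J" for s t
    using that inU by (auto simp: J_def einterval_def)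
  have abJ: "t \<in> J" if "t \<in> {a..b}" for t
    using that \<delta> by (auto simp: J_def einterval_def)
  have \<Gamma>S2: "\<Gamma> p \<in> S2" for p
    using \<Gamma>(2) by blast
  have contJ: "continuous_on J (\<lambda>t. \<Omega> (\<Gamma> (s, t)) (T (s, t)))" if "\<bar>s\<bar> \<le> \<delta>" for s
    by (rule continuous_on_compose2[OF smooth_on_continuous[OF smU(3)], of _ "\<lambda>t. (s, t)", unfolded W_def])
      (use J[OF that] in \<open>auto intro!: continuous_intros\<close>)
  have E: "energy g a b (\<lambda>t. \<Gamma> (s, t)) = 1/2 * integral {a..b} (X s)" if s: "\<bar>s\<bar> \<le> \<delta>" for s
  proof -
    have "g (\<Gamma> (s, t)) (vector_derivative (\<lambda>t. \<Gamma> (s, t)) (at t)) (vector_derivative (\<lambda>t. \<Gamma> (s, t)) (at t)) = X s t"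
      if "t \<in> {a..b}" for t
      using speed_sq[OF ereal_lt, folded J_def, OF T \<Gamma>S2 lt1[OF J[OF s]] contJ[OF s] abJ[OF that]]
      unfolding X_def S1_def S_def W_def F_def vector_derivative_at[OF T] .
    then have "integral {a..b} (\<lambda>t. g (\<Gamma> (s, t)) (vector_derivative (\<lambda>t. \<Gamma> (s, t)) (at t))
        (vector_derivative (\<lambda>t. \<Gamma> (s, t)) (at t))) = integral {a..b} (X s)"
      by (rule integral_cong)
    then show ?thesis
      unfolding energy_def by simp
  qed
  have Xint: "X s integrable_on {a..b}" if s: "\<bar>s\<bar> \<le> \<delta>" for s
  proof (rule integrable_continuous_real)
    have sub: "(\<lambda>t. (s, t)) ` {a..b} \<subseteq> U"
      using inU[OF s] \<delta> by auto
    have c: "continuous_on {a..b} (\<lambda>t. H (s, t))" if "smooth_on H U" for H :: "real \<times> real \<Rightarrow> real"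
      by (rule continuous_on_compose2[OF smooth_on_continuous[OF that] _ sub]) (auto intro!: continuous_intros)
    show "continuous_on {a..b} (X s)"
      unfolding X_def
      by (intro continuous_intros c smU continuous_on_compose2[OF smooth_on_continuous[OF F]]) auto
  qed
  have P: "(P' s has_integral 0) {a..b}" if s: "\<bar>s\<bar> \<le> \<delta>" "C * \<bar>s\<bar> * (b - a) < 2 * pi" for s
  proof -
    obtain \<phi> where \<phi>: "\<And>t. t \<in> J \<Longrightarrow> \<Gamma> (s, t) = \<Phi> (S (s, t), \<phi> t)"
      "\<And>t. t \<in> J \<Longrightarrow> (\<phi> has_real_derivative W (s, t)) (at t)"
      using lift_exists[OF ereal_lt, folded J_def, OF T \<Gamma>S2 lt1[OF J[OF s(1)]] contJ[OF s(1)]]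
      unfolding S_def W_def by blast
    have dS: "((\<lambda>t. S (s, t)) has_real_derivative S1 (s, t)) (at t)" if "t \<in> J" for t
      unfolding S_def S1_def Z'_def
      by (rule DERIV_chain2[OF Z_deriv has_vector_derivative_nth[OF T]]) (use J[OF s(1) that] in \<open>simp add: U_def\<close>)
    \<comment> \<open>At either end the lifts of the varied and of the original curve differ by an
      integer multiple of 2 pi. The difference drifts by at most \<open>C\<close> \<bar>s\<bar>
      \<open>(b - a) < 2 pi\<close>, so the two integers coincide and the boundary terms of the
      angle cancel.\<close>
    have \<phi>eq: "\<phi> a - \<theta> a = \<phi> b - \<theta> b"
    proof -
      have S_end: "S (s, t) = \<sigma> t" "\<Phi> (\<sigma> t, \<phi> t) = \<Phi> (\<sigma> t, \<theta> t)" if "t = a \<or> t = b" for t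
      proof -
        show "S (s, t) = \<sigma> t"
          using that \<Gamma>(4) Z_Phi[OF sI] by (auto simp: S_def)
        then show "\<Phi> (\<sigma> t, \<phi> t) = \<Phi> (\<sigma> t, \<theta> t)"
          using \<phi>(1)[OF abJ, of t] that \<Gamma>(4) ab by auto
      qed
      obtain n1 n2 :: int where n: "\<phi> a = \<theta> a + 2 * pi * n1" "\<phi> b = \<theta> b + 2 * pi * n2"
        using Phi_angle_eq[OF sI S_end(2)] by metis
      have "norm ((\<phi> b - \<theta> b) - (\<phi> a - \<theta> a)) \<le> C * \<bar>s\<bar> * norm (b - a)"
        by (rule field_differentiable_bound[of "{a..b}" _ "\<lambda>t. W (s, t) - \<theta>1 t"])
          (use has_field_derivative_at_within[OF DERIV_diff[OF \<phi>(2)[OF abJ] d(2)]] C(4)[OF s(1)] ab in auto)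
      moreover have "(\<phi> b - \<theta> b) - (\<phi> a - \<theta> a) = 2 * pi * (n2 - n1)"
        using n by (simp add: algebra_simps)
      ultimately have "2 * pi * \<bar>real_of_int (n2 - n1)\<bar> \<le> C * \<bar>s\<bar> * (b - a)"
        using ab by (simp add: abs_mult)
      then have "2 * pi * \<bar>real_of_int (n2 - n1)\<bar> < 2 * pi * 1"
        using s(2) by linarith
      then have "\<bar>real_of_int (n2 - n1)\<bar> < 1"
        by (subst (asm) mult_less_cancel_left_pos) auto
      then have "n1 = n2"
        by linarith
      then show ?thesis using n by simp
    qed
    have "(P' s has_integral (2 * (\<sigma>1 b * (S (s, b) - \<sigma> b)) + 2 * k * (\<phi> b - \<theta> b))
        - (2 * (\<sigma>1 a * (S (s, a) - \<sigma> a)) + 2 * k * (\<phi> a - \<theta> a))) {a..b}"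
    proof (rule fundamental_theorem_of_calculus)
      show "((\<lambda>t. 2 * (\<sigma>1 t * (S (s, t) - \<sigma> t)) + 2 * k * (\<phi> t - \<theta> t)) has_vector_derivative P' s t) (at t within {a..b})"
        if "t \<in> {a..b}" for t
        unfolding P'_def has_real_derivative_iff_has_vector_derivative[symmetric]
        by (rule has_field_derivative_at_within)
          (use dS[OF abJ[OF that]] \<phi>(2)[OF abJ[OF that]] d in \<open>auto intro!: derivative_eq_intros simp: algebra_simps\<close>)
    qed (use ab in auto)
    moreover have "S (s, a) = \<sigma> a" "S (s, b) = \<sigma> b"
      using \<Gamma>(4) Z_Phi[OF sI] by (auto simp: S_def)
    ultimately show ?thesis
      using \<phi>eq by simp
  qed
  \<comment> \<open>Ensures \<open>C\<close> \<bar>s\<bar> \<open>(b - a)\<close> \<le> 1, which is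
    below 2 pi; adding 1 keeps the denominator positive when \<open>C\<close> is 0.\<close>
  define \<eta> where "\<eta> = min \<delta> (1 / (C * (b - a) + 1))"
  have C0: "0 \<le> C"
    using C(1)[of 0 a] \<delta> ab by simp
  have \<eta>: "0 < \<eta>" "\<eta> \<le> \<delta>"
    using \<delta> C0 ab by (auto simp: \<eta>_def intro!: add_nonneg_pos)
  show "((\<lambda>s. energy g a b (\<lambda>t. \<Gamma> (s, t))) has_real_derivative 0) (at 0)"
  proof (rule has_real_derivative_zeroI[OF \<eta>(1)])
    fix s assume s: "\<bar>s\<bar> < \<eta>"
    have "C * (b - a) * \<bar>s\<bar> \<le> (C * (b - a) + 1) * \<bar>s\<bar>"
      by (rule mult_right_mono) auto
    also have "\<dots> \<le> (C * (b - a) + 1) * (1 / (C * (b - a) + 1))"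
      by (rule mult_left_mono) (use s C0 ab in \<open>auto simp: \<eta>_def\<close>)
    also have "\<dots> \<le> 1"
      by simp
    finally have small: "C * \<bar>s\<bar> * (b - a) < 2 * pi"
      using pi_gt3 by (simp add: algebra_simps)
    have s': "\<bar>s\<bar> \<le> \<delta>" using s \<eta> by simp
    have "((\<lambda>t. X s t - X 0 t - P' s t) has_integral integral {a..b} (X s) - integral {a..b} (X 0) - 0) {a..b}"
      using Xint[OF s'] Xint[of 0] \<delta> P[OF s' small]
      by (intro has_integral_diff integrable_integral) auto
    then have "norm (integral {a..b} (X s) - integral {a..b} (X 0) - 0) \<le> Q * s\<^sup>2 * measure lborel {a..b}"
    proof (rule has_integral_bound_real[rotated 2])
      show "0 \<le> Q * s\<^sup>2"
        using rest[OF s', of a] ab by (smt (verit) atLeastAtMost_iff)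
      show "\<And>t. t \<in> {a..b} - {} \<Longrightarrow> norm (X s t - X 0 t - P' s t) \<le> Q * s\<^sup>2"
        using rest[OF s'] by simp
    qed simp
    then show "\<bar>energy g a b (\<lambda>t. \<Gamma> (s, t)) - energy g a b (\<lambda>t. \<Gamma> (0, t))\<bar> \<le> (Q * (b - a)) * s\<^sup>2"
      using E[OF s'] E[of 0] \<delta> ab by (simp add: algebra_simps abs_le_iff)
  qed
qed

end

text \<open>The fundamental lemma of the calculus of variations. One arch of a sine serves as a test
  function: it is smooth on the whole line and vanishes at \<open>a\<close> and \<open>b\<close>,
  which is all that a variation with fixed end points requires. On an interval centred at
  \<open>t\<close> on which the function is positive, the arch is nonnegative and equals 1 at
  \<open>t\<close>.\<close>

lemma continuous_zero_if_sine_tests: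
  fixes G :: "real \<Rightarrow> real"
  assumes cont: "continuous_on UNIV G"
    and int: "\<And>a b. a < b \<Longrightarrow> ((\<lambda>t. G t * sin (pi * (t - a) / (b - a))) has_integral 0) {a..b}"
  shows "G t = 0"
proof -
  have npos: "\<not> 0 < H t" if H: "continuous_on UNIV H"
    "\<And>a b. a < b \<Longrightarrow> ((\<lambda>t. H t * sin (pi * (t - a) / (b - a))) has_integral 0) {a..b}"
    for H :: "real \<Rightarrow> real"
  proof
    assume pos: "0 < H t"
    have "open {u. 0 < H u}"
      by (intro open_Collect_less continuous_intros H)
    then obtain e where e: "0 < e" "cball t e \<subseteq> {u. 0 < H u}"
      using pos open_contains_cball by (metis mem_Collect_eq)
    have Hpos: "0 < H u" if "u \<in> {t - e..t + e}" for u
      using e(2) that by (auto simp: subset_eq dist_real_def abs_le_iff)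
    have *: "H t * sin (pi * (t - (t - e)) / ((t + e) - (t - e))) = 0"
    proof (rule has_integral_0_cbox_imp_0[of "t - e" "t + e" "\<lambda>u. H u * sin (pi * (u - (t - e)) / ((t + e) - (t - e)))" t])
      show "continuous_on (cbox (t - e) (t + e)) (\<lambda>u. H u * sin (pi * (u - (t - e)) / ((t + e) - (t - e))))"
        using e by (intro continuous_intros continuous_on_subset[OF H(1)]) auto
      show "0 \<le> H u * sin (pi * (u - (t - e)) / ((t + e) - (t - e)))" if u': "u \<in> box (t - e) (t + e)" for u
      proof -
        have u: "0 \<le> u - (t - e)" "u - (t - e) \<le> 2 * e" using u' by auto
        have "0 \<le> H u" using Hpos[of u] u' by simp
        moreover have "0 \<le> pi * (u - (t - e)) / ((t + e) - (t - e))"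
          using u e by simp
        moreover have "pi * (u - (t - e)) \<le> pi * (2 * e)"
          using u by (intro mult_left_mono) auto
        then have "pi * (u - (t - e)) / ((t + e) - (t - e)) \<le> pi"
          using e by (simp add: divide_le_eq)
        ultimately show ?thesis
          by (intro mult_nonneg_nonneg sin_ge_zero)
      qed
      show "((\<lambda>u. H u * sin (pi * (u - (t - e)) / ((t + e) - (t - e)))) has_integral 0) (cbox (t - e) (t + e))"
        using H(2)[of "t - e" "t + e"] e by simp
    qed (use e in auto)
    have "pi * (t - (t - e)) / ((t + e) - (t - e)) = pi / 2"
      using e by (simp add: field_simps)
    then show False using * pos by (simp only: sin_pi_half)
  qed
  have "((\<lambda>t. - G t * sin (pi * (t - a) / (b - a))) has_integral 0) {a..b}" if "a < b" for a b
    using has_integral_neg[OF int[OF that]] by simp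
  then have "\<not> 0 < - G t"
    using npos[of "\<lambda>t. - G t"] cont by (auto intro: continuous_intros)
  moreover have "\<not> 0 < G t"
    by (rule npos[OF cont int])
  ultimately show ?thesis by linarith
qed

lemma integration_by_parts_vanishing:
  fixes p q :: "real \<Rightarrow> real"
  assumes "a \<le> b" "\<And>t. (p has_real_derivative p' t) (at t)" "\<And>t. (q has_real_derivative q' t) (at t)"
    and "q a = 0" "q b = 0"
  shows "((\<lambda>t. p t * q' t + p' t * q t) has_integral 0) {a..b}"
proof -
  have "((\<lambda>t. p t * q' t + p' t * q t) has_integral p b * q b - p a * q a) {a..b}"
  proof (rule fundamental_theorem_of_calculus[OF assms(1)])
    show "((\<lambda>t. p t * q t) has_vector_derivative p t * q' t + p' t * q t) (at t within {a..b})" for t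
      unfolding has_real_derivative_iff_has_vector_derivative[symmetric]
      by (rule has_field_derivative_at_within) (use assms in \<open>auto intro!: derivative_eq_intros\<close>)
  qed
  then show ?thesis using assms by simp
qed

section \<open>Geodesics away from the poles solve the reduced equations\<close>

context profile
begin

text \<open>Admissible variations are defined for every real \<open>s\<close> and must stay on the
  sphere. Hence the first coordinate is moved by a bounded multiple of \<open>sin s\<close>, and the
  hypotheses confine the curve to a band away from the poles. Varying the angle alone gives
  Clairaut's integral, varying the first coordinate alone gives the second-order equation.\<close>

lemma geodesicD:
  assumes geo: "geodesic g \<gamma>" and lt1: "\<And>t. \<bar>\<gamma> t $ 3\<bar> < 1"
    and lu: "0 < l" "u < m" "\<And>t. l \<le> Z (\<gamma> t $ 3)" "\<And>t. Z (\<gamma> t $ 3) \<le> u"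
  obtains \<sigma> \<theta> \<sigma>1 \<theta>1 k where "\<And>t. \<gamma> t = \<Phi> (\<sigma> t, \<theta> t)" "\<And>t. \<sigma> t \<in> I"
    "\<And>t. (\<sigma> has_real_derivative \<sigma>1 t) (at t)" "\<And>t. (\<theta> has_real_derivative \<theta>1 t) (at t)"
    "\<And>t. (\<sigma>1 has_real_derivative f (\<sigma> t) * deriv f (\<sigma> t) * (\<theta>1 t)\<^sup>2) (at t)"
    "\<And>t. (f (\<sigma> t))\<^sup>2 * \<theta>1 t = k"
proof -
  have "range \<gamma> \<subseteq> S2"
    using geo unfolding geodesic_def by blast
  then have \<gamma>: "smooth_on \<gamma> UNIV" "\<And>t. \<gamma> t \<in> S2"
    using geo unfolding geodesic_def by blast+
  define \<gamma>' where "\<gamma>' t = vector_derivative \<gamma> (at t)" for t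
  have \<gamma>': "(\<gamma> has_vector_derivative \<gamma>' t) (at t)" for t
    unfolding \<gamma>'_def by (rule smooth_on_has_vector_derivative[OF \<gamma>(1)]) simp
  have "smooth_on \<gamma>' UNIV"
    unfolding \<gamma>'_def by (rule smooth_on_vector_derivative[OF open_UNIV \<gamma>(1)])
  note sm = Omega_smooth[OF open_UNIV \<gamma>(1) this lt1]
  define \<sigma> where "\<sigma> t = Z (\<gamma> t $ 3)" for t
  define \<sigma>1 where "\<sigma>1 t = Z' (\<gamma> t $ 3) * \<gamma>' t $ 3" for t
  define \<theta>1 where "\<theta>1 t = \<Omega> (\<gamma> t) (\<gamma>' t)" for t
  have sm: "smooth_on \<sigma> UNIV" "smooth_on \<sigma>1 UNIV" "smooth_on \<theta>1 UNIV"
    using sm unfolding \<sigma>_def \<sigma>1_def \<theta>1_def by auto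
  have \<sigma>I: "\<sigma> t \<in> I" for t
    using Z(2)[OF lt1] by (simp add: \<sigma>_def)
  have UN: "einterval (-\<infinity>) \<infinity> = UNIV"
    by (auto simp: einterval_def)
  obtain \<theta> where \<theta>: "\<And>t. \<gamma> t = \<Phi> (\<sigma> t, \<theta> t)" "\<And>t. (\<theta> has_real_derivative \<theta>1 t) (at t)"
    using lift_exists[of "-\<infinity>" \<infinity> \<gamma> \<gamma>', unfolded UN, OF _ \<gamma>' \<gamma>(2) lt1 smooth_on_continuous[OF sm(3), unfolded \<theta>1_def]]
    unfolding \<sigma>_def \<theta>1_def by auto
  have d\<sigma>: "(\<sigma> has_real_derivative \<sigma>1 t) (at t)" for t
    unfolding \<sigma>_def \<sigma>1_def Z'_def
    by (rule DERIV_chain2[OF Z_deriv[OF lt1] has_vector_derivative_nth[OF \<gamma>']])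
  have \<theta>sm: "smooth_on \<theta> UNIV"
    using smooth_on_curveI[OF open_UNIV _ sm(3)] \<theta>(2)
    by (simp add: has_real_derivative_iff_has_vector_derivative)
  define F where "F x = (f x)\<^sup>2" for x
  define F' where "F' x = 2 * f x * deriv f x" for x
  have dF: "(F has_real_derivative F' x) (at x)" for x
    unfolding F_def F'_def using smooth_on_has_real_derivative[OF f_smooth, of x]
    by (auto intro!: derivative_eq_intros)
  have F: "smooth_on F UNIV" "smooth_on F' UNIV"
    unfolding F_def F'_def
    by (intro smooth_on_power smooth_on_mult smooth_on_const f_smooth smooth_on_deriv open_UNIV)+
  \<comment> \<open>Half of the room between the band and the poles, as bound for the displacement
    of the first coordinate.\<close>
  define c where "c = min l (m - u) / 2"
  have c: "0 < c" "c < l" "c < m - u"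
    using lu by (auto simp: c_def)
  have var: "integral {a..b} (\<lambda>t. c * (\<sigma>1 t * \<xi>' t) + c * (1/2 * F' (\<sigma> t) * (\<theta>1 t)\<^sup>2 * \<xi> t) + F (\<sigma> t) * \<theta>1 t * \<eta>' t) = 0"
    if ab: "a < b" and \<xi>: "smooth_on \<xi> UNIV" "smooth_on \<xi>' UNIV" "\<And>t. (\<xi> has_real_derivative \<xi>' t) (at t)"
        "\<And>t. \<bar>\<xi> t\<bar> \<le> 1" "\<xi> a = 0" "\<xi> b = 0"
      and \<eta>: "smooth_on \<eta> UNIV" "smooth_on \<eta>' UNIV" "\<And>t. (\<eta> has_real_derivative \<eta>' t) (at t)"
        "\<eta> a = 0" "\<eta> b = 0" for a b \<xi> \<xi>' \<eta> \<eta>'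
  proof -
    define \<Gamma> where "\<Gamma> p = \<Phi> (\<sigma> (snd p) + c * sin (fst p) * \<xi> (snd p), \<theta> (snd p) + fst p * \<eta> (snd p))" for p
    have inI: "\<sigma> t + c * sin s * \<xi> t \<in> I" for s t
    proof -
      have "\<bar>c * sin s * \<xi> t\<bar> \<le> c"
        unfolding abs_mult using mult_mono[OF mult_mono[of "\<bar>c\<bar>" c "\<bar>sin s\<bar>" 1] \<xi>(4)[of t]] c
        by simp
      then show ?thesis
        using c lu(3)[of t] lu(4)[of t] unfolding \<sigma>_def[symmetric] by auto
    qed
    have snd': "smooth_on (\<lambda>p::real \<times> real. H (snd p)) UNIV" if "smooth_on H UNIV" for H :: "real \<Rightarrow> real"
      by (rule smooth_on_compose[OF open_UNIV open_UNIV _ that]) (auto intro!: smooth_on_snd smooth_on_ident)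
    have fst': "smooth_on (\<lambda>p::real \<times> real. fst p) UNIV"
      by (intro smooth_on_fst smooth_on_ident open_UNIV)
    have \<Gamma>sm: "smooth_on \<Gamma> UNIV"
      unfolding \<Gamma>_def using inI
      by (intro Phi_curve_smooth smooth_on_add smooth_on_mult smooth_on_const smooth_on_sin snd' fst'
          sm \<theta>sm \<xi> \<eta> open_UNIV) auto
    have \<Gamma>0: "\<Gamma> (0, t) = \<gamma> t" for t
      by (simp add: \<Gamma>_def \<theta>(1))
    have \<Gamma>ab: "\<Gamma> (s, a) = \<gamma> a" "\<Gamma> (s, b) = \<gamma> b" for s
      by (simp_all add: \<Gamma>_def \<theta>(1) \<xi> \<eta>)
    have \<Gamma>S2: "range \<Gamma> \<subseteq> S2"
      using Phi_S2(1)[OF inI] by (auto simp: \<Gamma>_def)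
    define X where "X s t = (\<sigma>1 t + c * sin s * \<xi>' t)\<^sup>2 + F (\<sigma> t + c * sin s * \<xi> t) * (\<theta>1 t + s * \<eta>' t)\<^sup>2" for s t
    define X' where "X' s t = 2 * (\<sigma>1 t + c * sin s * \<xi>' t) * (c * cos s * \<xi>' t)
      + (F' (\<sigma> t + c * sin s * \<xi> t) * (c * cos s * \<xi> t) * (\<theta>1 t + s * \<eta>' t)\<^sup>2
        + F (\<sigma> t + c * sin s * \<xi> t) * (2 * (\<theta>1 t + s * \<eta>' t) * \<eta>' t))" for s t
    have E: "energy g a b (\<lambda>t. \<Gamma> (s, t)) = 1/2 * integral {a..b} (X s)" for s
    proof -
      have d1: "((\<lambda>t. \<sigma> t + c * sin s * \<xi> t) has_real_derivative \<sigma>1 t + c * sin s * \<xi>' t) (at t)"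
        and d2: "((\<lambda>t. \<theta> t + s * \<eta> t) has_real_derivative \<theta>1 t + s * \<eta>' t) (at t)" for t
        using d\<sigma> \<xi>(3) \<theta>(2) \<eta>(3) by (auto intro!: derivative_eq_intros)
      have "g (\<Gamma> (s, t)) (vector_derivative (\<lambda>t. \<Gamma> (s, t)) (at t)) (vector_derivative (\<lambda>t. \<Gamma> (s, t)) (at t)) = X s t" for t
        using vector_derivative_at[OF Phi_curve[OF d1 d2 inI]] metric_D[OF inI]
        by (simp add: \<Gamma>_def X_def F_def power2_eq_square)
      then show ?thesis by (simp add: energy_def)
    qed
    have c1: "continuous_on UNIV (\<lambda>p::real\<times>real. H (snd p))" if "smooth_on H UNIV" for H :: "real \<Rightarrow> real"
      by (rule smooth_on_continuous[OF snd'[OF that]])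
    have c2: "continuous_on UNIV (\<lambda>p::real\<times>real. H (\<sigma> (snd p) + c * sin (fst p) * \<xi> (snd p)))" if "smooth_on H UNIV" for H :: "real \<Rightarrow> real"
      by (rule continuous_on_compose2[OF smooth_on_continuous[OF that]])
        (intro continuous_intros c1 sm \<xi>, simp)
    have "continuous_on UNIV (\<lambda>p. X (fst p) (snd p))"
      unfolding X_def by (intro continuous_intros c1 c2 sm F \<xi> \<eta>)
    then have "continuous_on {a..b} (\<lambda>t. X (fst (s, t)) (snd (s, t)))" for s
      by (rule continuous_on_compose2) (intro continuous_intros, simp)
    then have "continuous_on {a..b} (X s)" for s
      by simp
    note Xint = integrable_continuous_real[OF this]
    have "continuous_on UNIV (\<lambda>p. X' (fst p) (snd p))"
      unfolding X'_def by (intro continuous_intros c1 c2 sm F \<xi> \<eta>)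
    then have X'c: "continuous_on (UNIV \<times> cbox a b) (\<lambda>(s, t). X' s t)"
      by (auto simp: case_prod_unfold intro: continuous_on_subset)
    have dX: "((\<lambda>s. X s t) has_real_derivative X' s t) (at s)" for s t
    proof -
      have "((\<lambda>s. \<sigma> t + c * sin s * \<xi> t) has_real_derivative c * cos s * \<xi> t) (at s)"
        by (auto intro!: derivative_eq_intros)
      note DERIV_chain2[OF dF this]
      then show ?thesis
        unfolding X_def X'_def by (auto intro!: derivative_eq_intros simp: algebra_simps)
    qed
    have "((\<lambda>s. integral (cbox a b) (X s)) has_real_derivative integral (cbox a b) (X' 0)) (at 0 within UNIV)"
      by (rule leibniz_rule_field_derivative[OF dX _ X'c]) (use Xint in auto)
    then have "((\<lambda>s. energy g a b (\<lambda>t. \<Gamma> (s, t))) has_real_derivative 1/2 * integral {a..b} (X' 0)) (at 0)"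
      unfolding E by (auto intro!: derivative_eq_intros)
    moreover have "((\<lambda>s. energy g a b (\<lambda>t. \<Gamma> (s, t))) has_real_derivative 0) (at 0)"
      using geo ab \<Gamma>sm \<Gamma>0 \<Gamma>ab \<Gamma>S2 unfolding geodesic_def by blast
    ultimately have "integral {a..b} (X' 0) = 0"
      using DERIV_unique by fastforce
    moreover define Y where "Y t = c * (\<sigma>1 t * \<xi>' t) + c * (1/2 * F' (\<sigma> t) * (\<theta>1 t)\<^sup>2 * \<xi> t) + F (\<sigma> t) * \<theta>1 t * \<eta>' t" for t
    moreover have "X' 0 = (\<lambda>t. 2 * Y t)"
      by (auto simp: X'_def Y_def algebra_simps)
    ultimately have "integral {a..b} (\<lambda>t. 2 * Y t) = 0"
      by (simp only:)
    then have "2 * integral {a..b} Y = 0"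
      by (simp only: integral_mult_right)
    then have "integral {a..b} Y = 0"
      by simp
    then show ?thesis
      unfolding Y_def .
  qed
  define \<xi> where "\<xi> a b t = sin (pi * (t - a) / (b - a))" for a b t :: real
  define \<xi>' where "\<xi>' a b t = pi / (b - a) * cos (pi * (t - a) / (b - a))" for a b t :: real
  have \<xi>: "smooth_on (\<xi> a b) UNIV" "smooth_on (\<xi>' a b) UNIV" "\<And>t. (\<xi> a b has_real_derivative \<xi>' a b t) (at t)"
        "\<And>t. \<bar>\<xi> a b t\<bar> \<le> 1" "\<xi> a b a = 0" "\<xi> a b b = 0" if "a < b" for a b
    using that unfolding \<xi>_def \<xi>'_def
    by (auto intro!: smooth_on_mult smooth_on_sin smooth_on_cos smooth_on_divide smooth_on_diff smooth_on_const
        smooth_on_ident derivative_eq_intros)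
  define \<sigma>2 where "\<sigma>2 = deriv \<sigma>1"
  have d\<sigma>1: "(\<sigma>1 has_real_derivative \<sigma>2 t) (at t)" for t
    unfolding \<sigma>2_def by (rule smooth_on_has_real_derivative[OF sm(2)]) simp
  have \<sigma>2: "smooth_on \<sigma>2 UNIV"
    unfolding \<sigma>2_def by (rule smooth_on_deriv[OF open_UNIV sm(2)])
  define k where "k t = F (\<sigma> t) * \<theta>1 t" for t
  have Fs: "smooth_on (\<lambda>t. F (\<sigma> t)) UNIV" "smooth_on (\<lambda>t. F' (\<sigma> t)) UNIV"
    by (rule smooth_on_compose[OF open_UNIV open_UNIV _ F(1) sm(1)], simp)
      (rule smooth_on_compose[OF open_UNIV open_UNIV _ F(2) sm(1)], simp)
  have k: "smooth_on k UNIV"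
    unfolding k_def by (intro smooth_on_mult Fs sm open_UNIV)
  have dk: "(k has_real_derivative deriv k t) (at t)" for t
    by (rule smooth_on_has_real_derivative[OF k]) simp
  have k': "smooth_on (deriv k) UNIV"
    by (rule smooth_on_deriv[OF open_UNIV k])
  \<comment> \<open>Variation of the angle only: integration by parts moves the derivative from the
    test function to the Clairaut quantity \<open>k\<close>.\<close>
  have "deriv k t = 0" for t
  proof (rule continuous_zero_if_sine_tests[OF smooth_on_continuous[OF k']])
    fix a b :: real assume ab: "a < b"
    have "integral {a..b} (\<lambda>t. k t * \<xi>' a b t) = 0"
      using var[OF ab, of "\<lambda>t. 0" "\<lambda>t. 0" "\<xi> a b" "\<xi>' a b"] \<xi>[OF ab]
      by (simp add: k_def smooth_on_const)
    moreover have "(\<lambda>t. k t * \<xi>' a b t) integrable_on {a..b}"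
      by (intro integrable_continuous_real continuous_intros continuous_on_subset[OF smooth_on_continuous[OF k]]
          continuous_on_subset[OF smooth_on_continuous[OF \<xi>(2)[OF ab]]]) auto
    ultimately have "((\<lambda>t. k t * \<xi>' a b t) has_integral 0) {a..b}"
      using integrable_integral by fastforce
    from has_integral_diff[OF integration_by_parts_vanishing[OF _ dk \<xi>(3,5,6)[OF ab]] this]
    show "((\<lambda>t. deriv k t * sin (pi * (t - a) / (b - a))) has_integral 0) {a..b}"
      using ab by (simp add: \<xi>_def)
  qed
  then have k0: "k t = k 0" for t
    using DERIV_isconst_all[of k t 0] dk by simp
  \<comment> \<open>Variation of the first coordinate only; the positive factor \<open>c\<close> is
    divided out before integrating by parts.\<close>
  have "\<sigma>2 t - 1/2 * F' (\<sigma> t) * (\<theta>1 t)\<^sup>2 = 0" for t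
  proof (rule continuous_zero_if_sine_tests[where G = "\<lambda>t. \<sigma>2 t - 1/2 * F' (\<sigma> t) * (\<theta>1 t)\<^sup>2"])
    have cc: "continuous_on UNIV (\<lambda>t. 1/2 * F' (\<sigma> t) * (\<theta>1 t)\<^sup>2)" "continuous_on UNIV \<sigma>2" "continuous_on UNIV \<sigma>1"
      by (intro continuous_intros smooth_on_continuous Fs sm \<sigma>2)+
    then show "continuous_on UNIV (\<lambda>t. \<sigma>2 t - 1/2 * F' (\<sigma> t) * (\<theta>1 t)\<^sup>2)"
      by (intro continuous_on_diff)
    fix a b :: real assume ab: "a < b"
    have "integral {a..b} (\<lambda>t. c * (\<sigma>1 t * \<xi>' a b t) + c * (1/2 * F' (\<sigma> t) * (\<theta>1 t)\<^sup>2 * \<xi> a b t)) = 0"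
      using var[OF ab, of "\<xi> a b" "\<xi>' a b" "\<lambda>t. 0" "\<lambda>t. 0"] \<xi>[OF ab]
      by (simp add: smooth_on_const)
    then have "integral {a..b} (\<lambda>t. c * (\<sigma>1 t * \<xi>' a b t + 1/2 * F' (\<sigma> t) * (\<theta>1 t)\<^sup>2 * \<xi> a b t)) = 0"
      by (simp only: distrib_left)
    then have "integral {a..b} (\<lambda>t. \<sigma>1 t * \<xi>' a b t + 1/2 * F' (\<sigma> t) * (\<theta>1 t)\<^sup>2 * \<xi> a b t) = 0"
      using \<open>0 < c\<close> by (simp only: integral_mult_right) simp
    moreover have "(\<lambda>t. \<sigma>1 t * \<xi>' a b t + 1/2 * F' (\<sigma> t) * (\<theta>1 t)\<^sup>2 * \<xi> a b t) integrable_on {a..b}"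
      by (intro integrable_continuous_real continuous_on_add continuous_on_mult continuous_on_subset[OF cc(1)] continuous_on_subset[OF cc(3)]
          continuous_on_subset[OF smooth_on_continuous[OF \<xi>(1)[OF ab]]] continuous_on_subset[OF smooth_on_continuous[OF \<xi>(2)[OF ab]]]) auto
    ultimately have "((\<lambda>t. \<sigma>1 t * \<xi>' a b t + 1/2 * F' (\<sigma> t) * (\<theta>1 t)\<^sup>2 * \<xi> a b t) has_integral 0) {a..b}"
      using integrable_integral by fastforce
    from has_integral_diff[OF integration_by_parts_vanishing[OF _ d\<sigma>1 \<xi>(3,5,6)[OF ab]] this]
    show "((\<lambda>t. (\<sigma>2 t - 1/2 * F' (\<sigma> t) * (\<theta>1 t)\<^sup>2) * sin (pi * (t - a) / (b - a))) has_integral 0) {a..b}"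
      using ab by (simp add: \<xi>_def algebra_simps)
  qed
  then have "\<sigma>2 t = f (\<sigma> t) * deriv f (\<sigma> t) * (\<theta>1 t)\<^sup>2" for t
    by (simp add: F'_def)
  then show ?thesis
    using that[OF \<theta>(1) \<sigma>I d\<sigma> \<theta>(2), of "k 0"] d\<sigma>1 k0 by (simp add: k_def F_def)
qed

end

section \<open>Orbits of the reduced system\<close>

text \<open>An antiderivative on the whole line vanishing at 0. Negative arguments matter, since
  parity and translation by periods are used below.\<close>

definition prim :: "(real \<Rightarrow> real) \<Rightarrow> real \<Rightarrow> real" where
  "prim f = (SOME F. F 0 = 0 \<and> (\<forall>x. (F has_real_derivative f x) (at x)))"

lemma prim:
  assumes "continuous_on UNIV f"
  shows "prim f 0 = 0" "(prim f has_real_derivative f x) (at x)"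
proof -
  obtain F where F: "\<And>x. (F has_real_derivative f x) (at x)"
    using einterval_antiderivative[of "-\<infinity>" \<infinity> f] assms
    by (auto simp: continuous_on_eq_continuous_at has_real_derivative_iff_has_vector_derivative)
  have "(\<lambda>x. F x - F 0) 0 = 0 \<and> (\<forall>x. ((\<lambda>x. F x - F 0) has_real_derivative f x) (at x))"
    using F by (auto intro!: derivative_eq_intros)
  then have "prim f 0 = 0 \<and> (\<forall>x. (prim f has_real_derivative f x) (at x))"
    unfolding prim_def
    by (rule someI[where P = "\<lambda>F. F 0 = 0 \<and> (\<forall>x. (F has_real_derivative f x) (at x))"])
  then show "prim f 0 = 0" "(prim f has_real_derivative f x) (at x)" by auto
qed

lemma has_real_derivative_eqI:
  fixes F G :: "real \<Rightarrow> real"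
  assumes "\<And>x. (F has_real_derivative h x) (at x)" "\<And>x. (G has_real_derivative h x) (at x)" "F a = G a"
  shows "F x = G x"
proof -
  have "((\<lambda>x. F x - G x) has_real_derivative 0) (at x)" for x
    using DERIV_diff[OF assms(1,2)] by simp
  then have "F x - G x = F a - G a"
    by (intro DERIV_isconst_all[of "\<lambda>x. F x - G x"]) simp
  then show ?thesis using assms(3) by simp
qed

lemma prim_add_period:
  assumes "continuous_on UNIV f" "\<And>x. f (x + p) = f x"
  shows "prim f (x + p) = prim f x + prim f p"
proof (rule has_real_derivative_eqI[where a = 0 and h = f and F = "\<lambda>x. prim f (x + p)"
      and G = "\<lambda>x. prim f x + prim f p"])
  show "((\<lambda>x. prim f (x + p)) has_real_derivative f x) (at x)" for x
    using DERIV_shift[of "prim f" "f x" x p] prim(2)[OF assms(1), of "x + p"] assms(2) by simp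
  show "((\<lambda>x. prim f x + prim f p) has_real_derivative f x) (at x)" for x
    using prim(2)[OF assms(1)] by (auto intro!: derivative_eq_intros)
qed (simp add: prim(1)[OF assms(1)])

lemma prim_minus:
  assumes "continuous_on UNIV f" "\<And>x. f (- x) = f x"
  shows "prim f (- x) = - prim f x"
proof (rule has_real_derivative_eqI[where a = 0 and h = "\<lambda>x. - f x" and F = "\<lambda>x. prim f (- x)"
      and G = "\<lambda>x. - prim f x"])
  show "((\<lambda>x. prim f (- x)) has_real_derivative - f x) (at x)" for x
    using DERIV_chain2[OF prim(2)[OF assms(1)] DERIV_minus[OF DERIV_ident]] assms(2) by simp
  show "((\<lambda>x. - prim f x) has_real_derivative - f x) (at x)" for x
    using prim(2)[OF assms(1)] by (auto intro!: derivative_eq_intros)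
qed (simp add: prim(1)[OF assms(1)])

lemma prim_add_int_period:
  assumes "continuous_on UNIV f" "\<And>x. f (x + p) = f x"
  shows "prim f (x + of_int n * p) = prim f x + of_int n * prim f p"
proof -
  have nat: "prim f (x + of_nat n * p) = prim f x + of_nat n * prim f p" for x n
  proof (induction n)
    case (Suc n)
    have "x + of_nat (Suc n) * p = (x + of_nat n * p) + p"
      by (simp add: algebra_simps)
    then show ?case
      by (simp only: prim_add_period[OF assms] Suc.IH) (simp add: algebra_simps)
  qed simp
  show ?thesis
  proof (cases "0 \<le> n")
    case True
    then show ?thesis using nat[of x "nat n"] by simp
  next
    case False
    then show ?thesis using nat[of "x + of_int n * p" "nat (- n)"] by simp
  qed
qed

text \<open>The fundamental theorem tolerates one exceptional point, so \<open>y\<close> differs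
  from an antiderivative of \<open>h\<close> by a constant across \<open>t0\<close>. This serves at
  turning points, where a square root obstructs direct differentiation.\<close>

lemma has_real_derivative_removable:
  fixes y h :: "real \<Rightarrow> real"
  assumes "continuous_on UNIV h" "continuous_on UNIV y" "0 < d"
    and "\<And>t. \<bar>t - t0\<bar> < d \<Longrightarrow> t \<noteq> t0 \<Longrightarrow> (y has_real_derivative h t) (at t)"
  shows "(y has_real_derivative h t0) (at t0)"
proof -
  define E where "E t = y t - prim h t" for t
  have E': "(E has_vector_derivative 0) (at t)" if "\<bar>t - t0\<bar> < d" "t \<noteq> t0" for t
    unfolding E_def has_real_derivative_iff_has_vector_derivative[symmetric]
    using DERIV_diff[OF assms(4)[OF that] prim(2)[OF assms(1)]] by simp
  have Ec: "continuous_on UNIV E"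
    unfolding E_def
    by (intro continuous_intros assms(2)
        DERIV_continuous_on[OF has_field_derivative_at_within[OF prim(2)[OF assms(1)]]])
  have const: "E b = E a" if "a \<le> b" "\<bar>a - t0\<bar> < d" "\<bar>b - t0\<bar> < d" for a b
  proof -
    have "((\<lambda>_. 0) has_integral E b - E a) {a..b}"
      by (rule fundamental_theorem_of_calculus_strong[of "{t0}"])
        (use that E' continuous_on_subset[OF Ec] in auto)
    then show ?thesis
      using has_integral_unique[OF has_integral_0] by force
  qed
  have "y t = prim h t + E t0" if "t \<in> ball t0 d" for t
    using const[of t t0] const[of t0 t] that assms(3)
    by (cases "t \<le> t0") (auto simp: E_def dist_real_def abs_minus_commute)
  moreover have "((\<lambda>t. prim h t + E t0) has_real_derivative h t0) (at t0)"
    using prim(2)[OF assms(1)] by (auto intro!: derivative_eq_intros)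
  ultimately show ?thesis
    using has_field_derivative_transform_within_open[of "\<lambda>t. prim h t + E t0" "h t0" t0 "ball t0 d" y] assms(3)
    by simp
qed

section \<open>Monotonicity of the profile on both sides of the equator\<close>

context profile
begin

lemma f_deriv: "(f has_real_derivative deriv f s) (at s)"
  by (rule smooth_on_has_real_derivative[OF f_smooth]) simp

lemma f'_cont: "continuous_on S (deriv f)" and f_cont: "continuous_on S f"
  using smooth_on_continuous[OF smooth_on_deriv[OF open_UNIV f_smooth]] smooth_on_continuous[OF f_smooth]
    continuous_on_subset by blast+

lemma f'_pos:
  assumes "0 \<le> s" "s < s0"
  shows "0 < deriv f s"
proof (rule ccontr)
  assume "\<not> 0 < deriv f s"
  then obtain z where z: "0 \<le> z" "z \<le> s" "deriv f z = 0"
    using IVT2'[of "deriv f" s 0 0] f'_0 assms f'_cont by auto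
  then have "0 < z"
    using f'_0 by (cases "z = 0") auto
  then show False
    using s0_unique[of z] z assms s0 by auto
qed

lemma f'_neg:
  assumes "s0 < s" "s \<le> m"
  shows "deriv f s < 0"
proof (rule ccontr)
  assume "\<not> deriv f s < 0"
  then obtain z where z: "s \<le> z" "z \<le> m" "deriv f z = 0"
    using IVT2'[of "deriv f" m 0 s] f'_m assms f'_cont by auto
  then have "z < m"
    using f'_m by (cases "z = m") auto
  then show False
    using s0_unique[of z] z assms s0 by auto
qed

lemma f_strict_mono:
  assumes "0 \<le> a" "a < b" "b \<le> s0"
  shows "f a < f b"
  by (rule DERIV_pos_imp_increasing_open[OF assms(2) _ f_cont]) (use f'_pos f_deriv assms in force)

lemma f_strict_antimono:
  assumes "s0 \<le> a" "a < b" "b \<le> m"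
  shows "f b < f a"
  by (rule DERIV_neg_imp_decreasing_open[OF assms(2) _ f_cont]) (use f'_neg f_deriv assms in force)

definition R where "R = f s0"

lemma R_pos: "0 < R"
  using f_pos s0 by (simp add: R_def)

lemma f_le_R:
  assumes "0 \<le> s" "s \<le> m"
  shows "f s \<le> R" "f s = R \<longleftrightarrow> s = s0"
proof -
  consider "s < s0" | "s = s0" | "s0 < s" by linarith
  then have "f s \<le> R \<and> (f s = R \<longleftrightarrow> s = s0)"
    using f_strict_mono[of s s0] f_strict_antimono[of s0 s] assms unfolding R_def by cases auto
  then show "f s \<le> R" "f s = R \<longleftrightarrow> s = s0" by auto
qed

end

text \<open>\<rho> is the Clairaut constant at unit speed: the radius of the two parallels at which
  the orbit turns.\<close>

locale orbit = profile +
  fixes \<rho> :: real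
  assumes \<rho>: "0 < \<rho>" "\<rho> < R"
begin

definition lo where "lo = (SOME s. 0 < s \<and> s < s0 \<and> f s = \<rho>)"
definition hi where "hi = (SOME s. s0 < s \<and> s < m \<and> f s = \<rho>)"

lemma lo: "0 < lo" "lo < s0" "f lo = \<rho>"
proof -
  obtain s where s: "0 \<le> s" "s \<le> s0" "f s = \<rho>"
    using IVT'[of f 0 \<rho> s0] f_cont f_0 \<rho> s0 by (auto simp: R_def)
  have "s \<noteq> 0" "s \<noteq> s0"
    using s(3) f_0 \<rho> by (auto simp: R_def)
  then have "0 < s \<and> s < s0 \<and> f s = \<rho>"
    using s by auto
  then have "0 < lo \<and> lo < s0 \<and> f lo = \<rho>"
    unfolding lo_def by (rule someI)
  then show "0 < lo" "lo < s0" "f lo = \<rho>" by auto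
qed

lemma hi: "s0 < hi" "hi < m" "f hi = \<rho>"
proof -
  obtain s where s: "s0 \<le> s" "s \<le> m" "f s = \<rho>"
    using IVT2'[of f m \<rho> s0] f_cont f_m \<rho> s0 by (auto simp: R_def)
  have "s \<noteq> m" "s \<noteq> s0"
    using s(3) f_m \<rho> by (auto simp: R_def)
  then have "s0 < s \<and> s < m \<and> f s = \<rho>"
    using s by auto
  then have "s0 < hi \<and> hi < m \<and> f hi = \<rho>"
    unfolding hi_def by (rule someI)
  then show "s0 < hi" "hi < m" "f hi = \<rho>" by auto
qed

lemma lo_hi: "lo < hi" "{lo..hi} \<subseteq> I"
  using lo hi by auto

lemma f_gt_iff:
  assumes "0 \<le> s" "s \<le> m"
  shows "\<rho> < f s \<longleftrightarrow> lo < s \<and> s < hi" "\<rho> \<le> f s \<longleftrightarrow> lo \<le> s \<and> s \<le> hi"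
proof -
  consider "s < lo" | "s = lo" | "lo < s" "s \<le> s0" | "s0 < s" "s < hi" | "s = hi" | "hi < s"
    by linarith
  then have "(\<rho> < f s \<longleftrightarrow> lo < s \<and> s < hi) \<and> (\<rho> \<le> f s \<longleftrightarrow> lo \<le> s \<and> s \<le> hi)"
  proof cases
    case 1
    then show ?thesis using f_strict_mono[of s lo] lo hi assms by auto
  next
    case 2
    then show ?thesis using lo hi by auto
  next
    case 3
    then show ?thesis using f_strict_mono[of lo s] lo hi by auto
  next
    case 4
    then show ?thesis using f_strict_antimono[of s hi] lo hi by auto
  next
    case 5
    then show ?thesis using lo hi by auto
  next
    case 6
    then show ?thesis using f_strict_antimono[of hi s] lo hi assms by auto
  qed
  then show "\<rho> < f s \<longleftrightarrow> lo < s \<and> s < hi" "\<rho> \<le> f s \<longleftrightarrow> lo \<le> s \<and> s \<le> hi" by auto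
qed

text \<open>For a unit-speed geodesic with Clairaut constant \<rho>, the squared velocity of the
  first coordinate is \<open>P\<close> and its acceleration is \<open>G\<close>, half the derivative
  of \<open>P\<close>.\<close>

definition P where "P s = 1 - (\<rho> / f s)\<^sup>2"
definition G where "G s = \<rho>\<^sup>2 * deriv f s / f s ^ 3"

lemma f_pos_I: "s \<in> I \<Longrightarrow> 0 < f s"
  using f_pos by auto

lemma P_deriv:
  assumes "s \<in> I"
  shows "(P has_real_derivative 2 * G s) (at s)"
  unfolding P_def G_def using f_pos_I[OF assms] f_deriv[of s]
  by (auto intro!: derivative_eq_intros simp: field_simps power2_eq_square power3_eq_cube)

lemma P_pos:
  assumes "lo < s" "s < hi"
  shows "0 < P s"
proof -
  have "\<rho> < f s"
    using f_gt_iff(1)[of s] assms lo hi by auto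
  then have "(\<rho> / f s)\<^sup>2 < 1\<^sup>2"
    using \<rho> by (intro power_strict_mono) auto
  then show ?thesis by (simp add: P_def)
qed

lemma P_ends: "P lo = 0" "P hi = 0"
  using lo hi \<rho> by (auto simp: P_def)

lemma G_ends: "0 < G lo" "G hi < 0"
  using f'_pos[of lo] f'_neg[of hi] lo hi \<rho> by (auto simp: G_def mult_pos_neg divide_neg_pos)

text \<open>\<open>P\<close> divided by its two zeros. They are simple because the profile has
  nonzero derivative at both turning points, so the values filled in at the ends are
  positive.\<close>

definition Q where
  "Q s = (if s = lo then 2 * G lo / (hi - lo) else if s = hi then - 2 * G hi / (hi - lo)
     else P s / ((s - lo) * (hi - s)))"

lemma P_Q: "lo \<le> s \<Longrightarrow> s \<le> hi \<Longrightarrow> P s = (s - lo) * (hi - s) * Q s"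
  by (auto simp: Q_def P_ends)

lemma Q_pos: "lo \<le> s \<Longrightarrow> s \<le> hi \<Longrightarrow> 0 < Q s"
  using G_ends P_pos[of s] lo_hi(1) by (auto simp: Q_def divide_neg_pos)

text \<open>At an end the quotient is a difference quotient of \<open>P\<close> times a regular
  factor, and the values of \<open>Q\<close> there are the resulting limits.\<close>

lemma Q_cont: "continuous_on {lo..hi} Q"
  unfolding continuous_on_eq_continuous_within
proof
  fix s assume s: "s \<in> {lo..hi}"
  then have sI: "s \<in> I" using lo_hi by blast
  have dq: "((\<lambda>x. (P x - P s) / (x - s)) \<longlongrightarrow> 2 * G s) (at s)"
    using P_deriv[OF sI] by (simp add: has_field_derivative_iff)
  consider "s = lo" | "s = hi" | "lo < s" "s < hi"
    using s by force
  then have "(Q \<longlongrightarrow> Q s) (at s)"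
  proof cases
    case 1
    have "((\<lambda>x. (P x - P s) / (x - s) * (1 / (hi - x))) \<longlongrightarrow> 2 * G s * (1 / (hi - s))) (at s)"
      using 1 lo_hi by (intro tendsto_mult dq tendsto_intros) auto
    then have "(Q \<longlongrightarrow> 2 * G s * (1 / (hi - s))) (at s)"
      by (rule Lim_transform_within_open[of _ _ _ _ "{..<hi}"])
        (use 1 lo_hi in \<open>auto simp: Q_def P_ends\<close>)
    then show ?thesis using 1 by (simp add: Q_def)
  next
    case 2
    have "((\<lambda>x. - ((P x - P s) / (x - s)) * (1 / (x - lo))) \<longlongrightarrow> - (2 * G s) * (1 / (s - lo))) (at s)"
      using 2 lo_hi by (intro tendsto_mult tendsto_minus dq tendsto_intros) auto
    then have "(Q \<longlongrightarrow> - (2 * G s) * (1 / (s - lo))) (at s)"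
      by (rule Lim_transform_within_open[of _ _ _ _ "{lo<..}"])
        (use 2 lo_hi in \<open>auto simp: Q_def P_ends field_simps minus_divide_right\<close>)
    then show ?thesis using 2 lo_hi by (simp add: Q_def)
  next
    case 3
    have "((\<lambda>x. P x / ((x - lo) * (hi - x))) \<longlongrightarrow> P s / ((s - lo) * (hi - s))) (at s)"
      using 3 DERIV_isCont[OF P_deriv[OF sI]] by (intro tendsto_intros) (auto simp: isCont_def)
    then have "(Q \<longlongrightarrow> P s / ((s - lo) * (hi - s))) (at s)"
      by (rule Lim_transform_within_open[of _ _ _ _ "{lo<..<hi}"])
        (use 3 in \<open>auto simp: Q_def\<close>)
    then show ?thesis using 3 by (simp add: Q_def)
  qed
  then show "continuous (at s within {lo..hi}) Q"
    using continuous_at_imp_continuous_at_within isCont_def by blast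
qed

text \<open>Uniformization of an oscillation: with \<open>\<sigma> = X \<psi>\<close> the equation \<open>\<sigma>'\<^sup>2 = P \<sigma>\<close>, which degenerates at the
  turning points \<open>lo\<close> and \<open>hi\<close>, becomes \<open>\<psi>' = \<omega> \<psi>\<close> with \<open>\<omega> > 0\<close>.\<close>

definition mid where "mid = (lo + hi) / 2"
definition amp where "amp = (hi - lo) / 2"
definition X where "X \<psi> = mid - amp * cos \<psi>"
definition \<omega> where "\<omega> \<psi> = sqrt (Q (X \<psi>))"

lemma amp_pos: "0 < amp"
  using lo_hi by (simp add: amp_def)

lemma X_range: "lo \<le> X \<psi>" "X \<psi> \<le> hi"
proof -
  have "\<bar>amp * cos \<psi>\<bar> \<le> amp"
    using amp_pos abs_cos_le_one[of \<psi>] by (simp add: abs_mult mult_left_le)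
  then show "lo \<le> X \<psi>" "X \<psi> \<le> hi"
    by (auto simp: X_def mid_def amp_def abs_le_iff field_simps)
qed

lemma X_deriv: "(X has_real_derivative amp * sin \<psi>) (at \<psi>)"
  unfolding X_def by (auto intro!: derivative_eq_intros)

lemma X_cont: "continuous_on S X"
  unfolding X_def by (intro continuous_intros)

lemma X_I: "X \<psi> \<in> I"
  using X_range[of \<psi>] lo_hi(2) by auto

lemma X_sym: "X (- \<psi>) = X \<psi>" "X (\<psi> + 2 * pi) = X \<psi>"
  by (simp_all add: X_def)

lemma \<omega>_pos: "0 < \<omega> \<psi>"
  using Q_pos X_range by (simp add: \<omega>_def)

lemma \<omega>_cont: "continuous_on S \<omega>"
  unfolding \<omega>_def
  by (intro continuous_intros continuous_on_compose2[OF Q_cont X_cont]) (use X_range in auto)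

lemma P_X: "P (X \<psi>) = (amp * sin \<psi> * \<omega> \<psi>)\<^sup>2"
proof -
  have "(X \<psi> - lo) * (hi - X \<psi>) = amp\<^sup>2 * (1 - (cos \<psi>)\<^sup>2)"
    by (simp add: X_def mid_def amp_def power2_eq_square field_simps)
  also have "\<dots> = (amp * sin \<psi>)\<^sup>2"
    by (simp add: sin_squared_eq power_mult_distrib)
  finally show ?thesis
    using P_Q[OF X_range] Q_pos[OF X_range] by (simp add: \<omega>_def power_mult_distrib less_imp_le)
qed

section \<open>Time and angle as functions of the phase\<close>

definition \<tau> where "\<tau> = prim (\<lambda>\<psi>. 1 / \<omega> \<psi>)"
definition per where "per = \<tau> (2 * pi)"
definition rate where "rate \<psi> = \<rho> / ((f (X \<psi>))\<^sup>2 * \<omega> \<psi>)"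
definition rot where "rot = prim rate"
definition shift where "shift = rot (2 * pi)"

lemma inv_\<omega>_cont: "continuous_on UNIV (\<lambda>\<psi>. 1 / \<omega> \<psi>)"
  using \<omega>_pos by (intro continuous_intros \<omega>_cont) (metis less_irrefl)

lemma rate_cont: "continuous_on UNIV rate"
  unfolding rate_def using \<omega>_pos f_pos_I[OF X_I]
  by (intro continuous_intros \<omega>_cont continuous_on_compose2[OF f_cont X_cont])
    (auto simp: less_imp_neq[symmetric])

lemma \<tau>_deriv: "(\<tau> has_real_derivative 1 / \<omega> \<psi>) (at \<psi>)"
  unfolding \<tau>_def by (rule prim(2)[OF inv_\<omega>_cont])

lemma rot_deriv: "(rot has_real_derivative rate \<psi>) (at \<psi>)"
  unfolding rot_def by (rule prim(2)[OF rate_cont])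

lemma \<omega>_sym: "\<omega> (- \<psi>) = \<omega> \<psi>" "\<omega> (\<psi> + 2 * pi) = \<omega> \<psi>"
  by (simp_all add: \<omega>_def X_sym)

lemma rate_sym: "rate (- \<psi>) = rate \<psi>" "rate (\<psi> + 2 * pi) = rate \<psi>"
  by (simp_all add: rate_def X_sym \<omega>_sym)

lemma \<tau>_sym: "\<tau> 0 = 0" "\<tau> (- \<psi>) = - \<tau> \<psi>" "\<tau> (\<psi> + of_int n * (2 * pi)) = \<tau> \<psi> + of_int n * per"
  unfolding \<tau>_def per_def
  by (rule prim prim_minus prim_add_int_period; use inv_\<omega>_cont \<omega>_sym in simp)+

lemma rot_sym: "rot 0 = 0" "rot (- \<psi>) = - rot \<psi>" "rot (\<psi> + of_int n * (2 * pi)) = rot \<psi> + of_int n * shift"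
  unfolding rot_def shift_def
  by (rule prim prim_minus prim_add_int_period; use rate_cont rate_sym in simp)+

text \<open>The way back from \<open>hi\<close> to \<open>lo\<close> mirrors the way up, because
  \<omega> and \<open>rate\<close> are even in the phase.\<close>

lemma half_period: "per = 2 * \<tau> pi" "shift = 2 * rot pi"
  using \<tau>_sym(3)[of "-pi" 1] \<tau>_sym(2)[of pi] rot_sym(3)[of "-pi" 1] rot_sym(2)[of pi] by auto

lemma \<tau>_strict_mono: "\<psi> < \<psi>' \<Longrightarrow> \<tau> \<psi> < \<tau> \<psi>'"
  by (rule DERIV_pos_imp_increasing[of \<psi> \<psi>' \<tau>]) (use \<tau>_deriv in \<open>auto intro!: exI[of _ "1 / \<omega> _"] simp: \<omega>_pos\<close>)

lemma per_pos: "0 < per"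
  using \<tau>_strict_mono[of 0 "2 * pi"] by (simp add: per_def \<tau>_sym)

lemma \<tau>_surj: "\<exists>\<psi>. \<tau> \<psi> = t"
proof -
  define n where "n = \<lfloor>t / per\<rfloor>"
  have n: "of_int n * per \<le> t" "t \<le> of_int (n + 1) * per"
    using floor_divide_lower[OF per_pos, of t] floor_divide_upper[OF per_pos, of t] by (auto simp: n_def)
  have "\<tau> (of_int n * (2 * pi)) = of_int n * per" "\<tau> (of_int (n + 1) * (2 * pi)) = of_int (n + 1) * per"
    using \<tau>_sym(3)[of 0 n] \<tau>_sym(3)[of 0 "n + 1"] \<tau>_sym(1) by auto
  then show ?thesis
    using IVT'[of \<tau> "of_int n * (2 * pi)" t "of_int (n + 1) * (2 * pi)"] n
      DERIV_continuous_on[OF has_field_derivative_at_within[OF \<tau>_deriv]]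
    by (auto simp: mult_right_mono)
qed

definition phase where "phase = inv \<tau>"

lemma phase: "\<tau> (phase t) = t" "phase (\<tau> \<psi>) = \<psi>"
proof -
  show "\<tau> (phase t) = t"
    unfolding phase_def using \<tau>_surj by (metis f_inv_into_f rangeI)
  have "inj \<tau>"
    using \<tau>_strict_mono by (metis injI linorder_neqE_linordered_idom less_irrefl)
  then show "phase (\<tau> \<psi>) = \<psi>"
    by (simp add: phase_def)
qed

lemma phase_deriv: "(phase has_real_derivative \<omega> (phase t)) (at t)"
proof -
  have "isCont phase (\<tau> (phase t))"
    by (rule isCont_inverse_function[where f = \<tau> and d = 1]) (use phase DERIV_isCont[OF \<tau>_deriv] in auto)
  then have "(phase has_real_derivative inverse (1 / \<omega> (phase t))) (at t)"
    using \<tau>_deriv \<omega>_pos phase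
    by (intro DERIV_inverse_function[where f = \<tau> and a = "t - 1" and b = "t + 1"]) (auto simp: less_imp_neq[symmetric])
  then show ?thesis by simp
qed

lemma phase_add: "phase (t + of_int n * per) = phase t + of_int n * (2 * pi)"
  using \<tau>_sym(3)[of "phase t" n] phase by metis

section \<open>The orbit as a function of time\<close>

definition x where "x t = X (phase t)"
definition x1 where "x1 t = amp * sin (phase t) * \<omega> (phase t)"
definition ang where "ang t = rot (phase t)"

lemma x_I: "x t \<in> I" "lo \<le> x t" "x t \<le> hi"
  using X_I X_range by (auto simp: x_def)

lemma x_deriv: "(x has_real_derivative x1 t) (at t)"
  unfolding x_def x1_def by (rule DERIV_chain2[OF X_deriv phase_deriv])

lemma ang_deriv: "(ang has_real_derivative \<rho> / (f (x t))\<^sup>2) (at t)"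
proof -
  have "rate (phase t) * \<omega> (phase t) = \<rho> / (f (x t))\<^sup>2"
    using \<omega>_pos[of "phase t"] by (simp add: rate_def x_def)
  then show ?thesis
    using DERIV_chain2[OF rot_deriv phase_deriv, of t] unfolding ang_def by simp
qed

lemma x1_sq: "(x1 t)\<^sup>2 = P (x t)"
  by (simp add: x1_def x_def P_X)

lemma x_add: "x (t + of_int n * per) = x t"
proof -
  have "cos (phase t + of_int n * (2 * pi)) = cos (phase t)"
    using cos.plus_of_int[of "phase t" n] by simp
  then show ?thesis
    by (simp add: x_def X_def phase_add)
qed

lemma ang_add: "ang (t + of_int n * per) = ang t + of_int n * shift"
  by (simp add: ang_def phase_add rot_sym)

lemma x1_cont: "continuous_on UNIV x1"
proof -
  have "continuous_on UNIV phase"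
    by (rule DERIV_continuous_on[OF has_field_derivative_at_within[OF phase_deriv]])
  then show ?thesis
    unfolding x1_def by (intro continuous_intros continuous_on_compose2[OF \<omega>_cont[of UNIV]]) auto
qed

lemma G_smooth: "smooth_on G I"
  unfolding G_def using f_pos_I
  by (intro smooth_on_divide smooth_on_mult smooth_on_const smooth_on_power
      smooth_on_subset[OF f_smooth] smooth_on_subset[OF smooth_on_deriv[OF open_UNIV f_smooth]])
    (auto simp: less_imp_neq[symmetric])

lemma x_cont: "continuous_on UNIV x"
  by (rule DERIV_continuous_on[OF has_field_derivative_at_within[OF x_deriv]])

lemma Gx_cont: "continuous_on UNIV (\<lambda>t. G (x t))"
  by (rule continuous_on_compose2[OF smooth_on_continuous[OF G_smooth] x_cont]) (use x_I in auto)

text \<open>Away from turning points the velocity is a signed square root of \<open>P\<close> along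
  the orbit, and its sign is locally constant, so the relation \<open>x1^2 = P\<close> can be
  differentiated.\<close>

lemma x1_deriv_regular:
  assumes "sin (phase t) \<noteq> 0"
  shows "(x1 has_real_derivative G (x t)) (at t)"
proof -
  define e where "e = sgn (x1 t)"
  have nz: "x1 t \<noteq> 0"
    using assms amp_pos \<omega>_pos[of "phase t"] by (simp add: x1_def)
  then have e: "e * x1 t = \<bar>x1 t\<bar>" "e * e = 1"
    by (auto simp: e_def sgn_real_def)
  have "open {u. 0 < e * x1 u}"
    by (intro open_Collect_less continuous_intros x1_cont)
  moreover have "t \<in> {u. 0 < e * x1 u}"
    using nz e by simp
  moreover have "e * sqrt (P (x u)) = x1 u" if "u \<in> {u. 0 < e * x1 u}" for u
  proof -
    have "sqrt (P (x u)) = \<bar>e * x1 u\<bar>"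
      using x1_sq[of u] e(2) by (simp add: abs_mult e_def sgn_real_def nz flip: real_sqrt_abs)
    then show ?thesis
      using that e(2) by (simp add: mult.assoc[symmetric])
  qed
  moreover have "((\<lambda>u. e * sqrt (P (x u))) has_real_derivative G (x t)) (at t)"
  proof -
    have Px: "0 < P (x t)"
      unfolding x1_sq[symmetric] using nz by simp
    have r: "e * x1 t / sqrt (P (x t)) = 1"
      using x1_sq[of t] Px e by (simp flip: real_sqrt_abs)
    have "((\<lambda>u. P (x u)) has_real_derivative 2 * G (x t) * x1 t) (at t)"
      by (rule DERIV_chain2[OF P_deriv[OF x_I(1)] x_deriv])
    from DERIV_cmult[OF DERIV_chain2[OF DERIV_real_sqrt[OF Px] this], of e]
    have "((\<lambda>u. e * sqrt (P (x u))) has_real_derivative e * (inverse (sqrt (P (x t))) / 2 * (2 * G (x t) * x1 t))) (at t)" .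
    also have "e * (inverse (sqrt (P (x t))) / 2 * (2 * G (x t) * x1 t)) = G (x t) * (e * x1 t / sqrt (P (x t)))"
      by (simp add: field_simps)
    finally show ?thesis
      by (simp add: r)
  qed
  ultimately show ?thesis
    using has_field_derivative_transform_within_open by blast
qed

text \<open>Turning times are isolated: in a neighbourhood the phase moves by less than pi, so its
  sine has no other zero. The exceptional point is then removed by continuity.\<close>

lemma x1_deriv: "(x1 has_real_derivative G (x t)) (at t)"
proof (cases "sin (phase t) = 0")
  case True
  have "isCont phase t"
    using phase_deriv DERIV_isCont by blast
  then obtain d where d: "0 < d" "\<And>u. \<bar>u - t\<bar> < d \<Longrightarrow> \<bar>phase u - phase t\<bar> < pi"
    unfolding continuous_at_eps_delta dist_real_def using pi_gt_zero by metis
  show ?thesis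
  proof (rule has_real_derivative_removable[OF Gx_cont x1_cont d(1)])
    fix u assume u: "\<bar>u - t\<bar> < d" "u \<noteq> t"
    define w where "w = phase u - phase t"
    have "w \<noteq> 0" "\<bar>w\<bar> < pi"
      using u d(2)[OF u(1)] phase(1) by (auto simp: w_def) (metis phase(1))
    then have "sin w \<noteq> 0"
      using sin_gt_zero[of w] sin_gt_zero[of "-w"] by (cases "0 < w") auto
    moreover have "sin w = sin (phase u) * cos (phase t)"
      using True by (simp add: w_def sin_diff)
    ultimately show "(x1 has_real_derivative G (x u)) (at u)"
      by (intro x1_deriv_regular) auto
  qed
qed (rule x1_deriv_regular)

text \<open>The uniformizing factor \<omega> is known to be continuous only, so smoothness cannot
  come from the phase. It comes from bootstrapping the second-order equation, whose right-hand side
  \<open>G\<close> is smooth also at the turning points.\<close>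

lemma x_smooth: "smooth_on x UNIV" and ang_smooth: "smooth_on ang UNIV"
proof -
  have "Ck_on k x UNIV" for k
  proof (induction k)
    case (Suc k)
    have "Ck_on k (\<lambda>t. G (x t)) UNIV"
      by (rule Ck_on_compose[OF open_UNIV _ _ _ Suc, where T = I]) (use x_I G_smooth in \<open>auto simp: smooth_on_def\<close>)
    then have "Ck_on (Suc k) x1 UNIV"
      by (rule Ck_on_curveI[rotated 2]) (use x1_deriv in \<open>auto simp flip: has_real_derivative_iff_has_vector_derivative\<close>)
    then have "Ck_on k x1 UNIV"
      by (rule Ck_on_SucD)
    then show ?case
      by (rule Ck_on_curveI[rotated 2]) (use x_deriv in \<open>auto simp flip: has_real_derivative_iff_has_vector_derivative\<close>)
  qed (use x_cont in simp)
  then show x: "smooth_on x UNIV"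
    by (simp add: smooth_on_def)
  have "smooth_on (\<lambda>t. f (x t)) UNIV"
    by (rule smooth_on_compose[OF open_UNIV open_UNIV _ f_smooth x]) simp
  then have "smooth_on (\<lambda>t. \<rho> / (f (x t))\<^sup>2) UNIV"
    using f_pos_I[OF x_I(1)] by (intro smooth_on_divide smooth_on_const smooth_on_power) (auto simp: less_imp_neq[symmetric])
  then show "smooth_on ang UNIV"
    by (rule smooth_on_curveI[rotated 2]) (use ang_deriv in \<open>auto simp flip: has_real_derivative_iff_has_vector_derivative\<close>)
qed

section \<open>Crossings of the equator and the minimal period\<close>

definition \<psi>0 where "\<psi>0 = arccos ((mid - s0) / amp)"
definition \<alpha> where "\<alpha> = \<tau> \<psi>0"

lemma \<psi>0: "0 < \<psi>0" "\<psi>0 < pi" "cos \<psi>0 = (mid - s0) / amp"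
proof -
  have b: "-1 < (mid - s0) / amp" "(mid - s0) / amp < 1"
    using lo hi amp_pos by (auto simp: less_divide_eq divide_less_eq mid_def amp_def field_simps)
  then show "cos \<psi>0 = (mid - s0) / amp"
    by (simp add: \<psi>0_def)
  show "0 < \<psi>0" "\<psi>0 < pi"
    using arccos_lt_bounded[of "(mid - s0) / amp"] b by (auto simp: \<psi>0_def)
qed

lemma \<alpha>: "0 < \<alpha>" "2 * \<alpha> < per"
  using \<tau>_strict_mono[of 0 \<psi>0] \<tau>_strict_mono[of \<psi>0 pi] \<psi>0 half_period by (auto simp: \<alpha>_def \<tau>_sym)

lemma crossing_iff:
  "x t = s0 \<longleftrightarrow> (\<exists>n::int. t = \<alpha> + of_int n * per) \<or> (\<exists>n::int. t = - \<alpha> + of_int n * per)"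
proof -
  have "x t = s0 \<longleftrightarrow> cos (phase t) = cos \<psi>0"
    using amp_pos by (auto simp: x_def X_def \<psi>0 field_simps)
  also have "\<dots> \<longleftrightarrow> (\<exists>n::int. phase t = \<psi>0 + of_int n * (2 * pi)) \<or> (\<exists>n::int. phase t = - \<psi>0 + of_int n * (2 * pi))"
    unfolding cos_eq by (auto elim!: Ints_cases simp: algebra_simps)
  also have "\<dots> \<longleftrightarrow> (\<exists>n::int. t = \<alpha> + of_int n * per) \<or> (\<exists>n::int. t = - \<alpha> + of_int n * per)"
    unfolding \<alpha>_def using phase \<tau>_sym(2) \<tau>_sym(3) by metis
  finally show ?thesis .
qed

lemma x1_crossing: "0 < x1 (\<alpha> + of_int n * per)" "x1 (- \<alpha> + of_int n * per) < 0"
proof -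
  have s: "sin (a + of_int n * (2 * pi)) = sin a" for a
    using sin.plus_of_int[of a n] by simp
  have "phase \<alpha> = \<psi>0" "phase (- \<alpha>) = - \<psi>0"
    unfolding \<alpha>_def using phase(2) \<tau>_sym(2) by metis+
  then show "0 < x1 (\<alpha> + of_int n * per)" "x1 (- \<alpha> + of_int n * per) < 0"
    using \<omega>_pos amp_pos sin_gt_zero[of \<psi>0] \<psi>0 unfolding x1_def phase_add s
    by (auto simp: s mult_neg_pos mult_pos_pos simp del: add_uminus_conv_diff uminus_add_conv_diff)
qed

text \<open>A period carries the upward crossing at time \<alpha> to a crossing with the same
  velocity. Downward crossings have negative velocity, so the image is again an upward one, a
  multiple of \<open>per\<close> later.\<close>

lemma x_period:
  assumes "\<And>t. x (t + s) = x t"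
  shows "\<exists>n::int. s = of_int n * per"
proof -
  have "x1 (\<alpha> + s) = x1 \<alpha>"
  proof -
    have "((\<lambda>t. x (t + s)) has_real_derivative x1 (\<alpha> + s)) (at \<alpha>)"
      using DERIV_shift x_deriv by blast
    then show ?thesis
      unfolding assms using x_deriv DERIV_unique by blast
  qed
  then have pos: "0 < x1 (\<alpha> + s)"
    using x1_crossing(1)[of 0] by simp
  have "x (\<alpha> + s) = s0"
    using assms[of \<alpha>] crossing_iff[of \<alpha>] by (metis add.right_neutral mult_zero_left of_int_0)
  then consider n :: int where "\<alpha> + s = \<alpha> + of_int n * per" | n :: int where "\<alpha> + s = - \<alpha> + of_int n * per"
    using crossing_iff by blast
  then show ?thesis
  proof cases
    case (2 n)
    then show ?thesis
      using pos x1_crossing(2)[of n] unfolding 2 by simp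
  qed auto
qed

end

section \<open>Closed geodesics\<close>

lemma Gronwall_zero:
  fixes E :: "real \<Rightarrow> real"
  assumes "\<And>t. (E has_real_derivative E' t) (at t)" "\<And>t. \<bar>E' t\<bar> \<le> K * E t" "\<And>t. 0 \<le> E t" "E t0 = 0"
  shows "E t = 0"
proof (cases "t0 \<le> t")
  case True
  have "E t * exp (- K * t) \<le> E t0 * exp (- K * t0)"
  proof (rule DERIV_nonpos_imp_nonincreasing[OF True])
    fix u
    have "((\<lambda>t. E t * exp (- K * t)) has_real_derivative (E' u - K * E u) * exp (- K * u)) (at u)"
      by (auto intro!: derivative_eq_intros assms(1) simp: algebra_simps)
    moreover have "(E' u - K * E u) * exp (- K * u) \<le> 0"
      using assms(2)[of u] by (intro mult_nonpos_nonneg) auto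
    ultimately show "\<exists>y. ((\<lambda>t. E t * exp (- K * t)) has_real_derivative y) (at u) \<and> y \<le> 0"
      by blast
  qed
  then show ?thesis
    using assms(3)[of t] assms(4) by (simp add: mult_le_0_iff)
next
  case False
  then have "t \<le> t0" by simp
  then have "E t * exp (K * t) \<le> E t0 * exp (K * t0)"
  proof (rule DERIV_nonneg_imp_nondecreasing)
    fix u
    have "((\<lambda>t. E t * exp (K * t)) has_real_derivative (E' u + K * E u) * exp (K * u)) (at u)"
      by (auto intro!: derivative_eq_intros assms(1) simp: algebra_simps)
    moreover have "0 \<le> (E' u + K * E u) * exp (K * u)"
      using assms(2)[of u] by (intro mult_nonneg_nonneg) auto
    ultimately show "\<exists>y. ((\<lambda>t. E t * exp (K * t)) has_real_derivative y) (at u) \<and> 0 \<le> y"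
      by blast
  qed
  then show ?thesis
    using assms(3)[of t] assms(4) by (simp add: mult_le_0_iff)
qed

lemma periodic_int:
  fixes F :: "real \<Rightarrow> 'a"
  assumes "\<And>t. F (t + T) = F t"
  shows "F (t + of_int n * T) = F t"
proof -
  have nat: "F (t + of_nat n * T) = F t" for t n
  proof (induction n)
    case (Suc n)
    then show ?case
      using assms[of "t + of_nat n * T"] by (simp add: algebra_simps)
  qed simp
  show ?thesis
    using nat[of t "nat n"] nat[of "t + of_int n * T" "nat (- n)"] by (cases "0 \<le> n") auto
qed

lemma periodic_range:
  fixes F :: "real \<Rightarrow> 'a"
  assumes "\<And>t. F (t + T) = F t" "0 < T"
  shows "range F = F ` {0..T}"
proof
  show "range F \<subseteq> F ` {0..T}"
  proof
    fix y assume "y \<in> range F"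
    then obtain t where t: "y = F t" by auto
    define n where "n = \<lfloor>t / T\<rfloor>"
    have "of_int n * T \<le> t" "t < (of_int n + 1) * T"
      using floor_divide_lower[OF assms(2), of t] floor_divide_upper[OF assms(2), of t] by (auto simp: n_def)
    then have "t - of_int n * T \<in> {0..T}"
      by (auto simp: algebra_simps)
    moreover have "F (t - of_int n * T) = y"
      using periodic_int[of F T "t" "-n", OF assms(1)] by (simp add: t)
    ultimately show "y \<in> F ` {0..T}"
      by (metis image_eqI)
  qed
qed auto

lemma card_int_interval: "finite {j::int. y \<le> of_int j \<and> of_int j < y + real n}"
  "card {j::int. y \<le> of_int j \<and> of_int j < y + real n} = n"
proof -
  have "{j::int. y \<le> of_int j \<and> of_int j < y + real n} = {\<lceil>y\<rceil>..<\<lceil>y\<rceil> + int n}"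
  proof (intro set_eqI iffI; clarsimp)
    fix j :: int
    assume "y \<le> of_int j" "of_int j < y + real n"
    then show "\<lceil>y\<rceil> \<le> j \<and> j < \<lceil>y\<rceil> + int n"
      using ceiling_correct[of y] by (auto simp: ceiling_le_iff) linarith
  next
    fix j :: int
    assume j: "\<lceil>y\<rceil> \<le> j" "j < \<lceil>y\<rceil> + int n"
    then have "real_of_int j \<le> \<lceil>y\<rceil> + real n - 1"
      by linarith
    then show "y \<le> of_int j \<and> of_int j < y + real n"
      using ceiling_correct[of y] j by (auto simp: ceiling_le_iff)
  qed
  then show "finite {j::int. y \<le> of_int j \<and> of_int j < y + real n}"
    "card {j::int. y \<le> of_int j \<and> of_int j < y + real n} = n"
    by auto
qed

text \<open>Solving for \<open>t\<close> makes the index \<open>j\<close> range over the integers of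
  a half-open interval of length \<open>n\<close>; there are exactly \<open>n\<close> of these
  wherever the interval starts.\<close>

lemma card_arithmetic_progression:
  fixes a c d v T :: real
  assumes "0 < d" "0 < v" "v * T = real n * d"
  shows "finite {t \<in> {0..<T}. \<exists>j::int. v * t + c = a + of_int j * d}"
    "card {t \<in> {0..<T}. \<exists>j::int. v * t + c = a + of_int j * d} = n"
proof -
  define J where "J = {j::int. (c - a) / d \<le> of_int j \<and> of_int j < (c - a) / d + real n}"
  define F where "F j = (a + of_int j * d - c) / v" for j :: int
  have inj: "inj_on F J"
    using assms by (auto simp: inj_on_def F_def)
  have "F j \<in> {0..<T} \<longleftrightarrow> j \<in> J" for j
  proof -
    have "0 \<le> F j \<longleftrightarrow> (c - a) / d \<le> of_int j"
      using assms by (simp add: F_def zero_le_divide_iff divide_le_eq algebra_simps)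
    moreover have "F j < T \<longleftrightarrow> of_int j < (c - a) / d + real n"
      using assms by (simp add: F_def divide_less_eq field_simps)
    ultimately show ?thesis by (simp add: J_def)
  qed
  moreover have "v * t + c = a + of_int j * d \<longleftrightarrow> t = F j" for t j
    using assms by (simp add: F_def field_simps)
  ultimately have "{t \<in> {0..<T}. \<exists>j::int. v * t + c = a + of_int j * d} = F ` J"
    by auto
  then show "finite {t \<in> {0..<T}. \<exists>j::int. v * t + c = a + of_int j * d}"
    "card {t \<in> {0..<T}. \<exists>j::int. v * t + c = a + of_int j * d} = n"
    using card_int_interval[of "(c - a) / d" n, folded J_def] by (simp_all only: card_image[OF inj] finite_imageI)
qed

context orbit
begin

text \<open>Upward and downward crossings form two progressions with step \<open>per\<close>,
  disjoint because 0 < 2 \<alpha> < \<open>per\<close>; \<open>n\<close> oscillations meet each of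
  them \<open>n\<close> times.\<close>

lemma card_crossings:
  assumes "0 < v" "v * T = real n * per"
  shows "finite {t \<in> {0..<T}. x (v * t + c) = s0}" "card {t \<in> {0..<T}. x (v * t + c) = s0} = 2 * n"
proof -
  define S where "S a = {t \<in> {0..<T}. \<exists>j::int. v * t + c = a + of_int j * per}" for a
  have S: "finite (S a)" "card (S a) = n" for a
    using card_arithmetic_progression[OF per_pos assms] unfolding S_def by auto
  have eq: "{t \<in> {0..<T}. x (v * t + c) = s0} = S \<alpha> \<union> S (- \<alpha>)"
    unfolding S_def crossing_iff by auto
  have "S \<alpha> \<inter> S (- \<alpha>) = {}"
  proof (rule ccontr)
    assume "S \<alpha> \<inter> S (- \<alpha>) \<noteq> {}"
    then obtain t and i j :: int where "v * t + c = \<alpha> + of_int i * per" "v * t + c = - \<alpha> + of_int j * per"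
      unfolding S_def by blast
    then have "of_int (j - i) * per = 2 * \<alpha>"
      by (simp add: algebra_simps)
    then have "0 < of_int (j - i) * per" "of_int (j - i) * per < 1 * per"
      using \<alpha> by auto
    then have "0 < (of_int (j - i) :: real)" "(of_int (j - i) :: real) < 1"
      using per_pos by (auto simp: zero_less_mult_iff mult_less_cancel_right_pos simp del: of_int_diff)
    then have "0 < j - i" "j - i < 1"
      unfolding of_int_0_less_iff of_int_less_1_iff by auto
    then show False by simp
  qed
  then show "finite {t \<in> {0..<T}. x (v * t + c) = s0}" "card {t \<in> {0..<T}. x (v * t + c) = s0} = 2 * n"
    unfolding eq using S by (auto simp: card_Un_disjoint)
qed

text \<open>Uniqueness for the second-order equation at speed \<open>v\<close>, by Gronwall for the
  squared distance of position and velocity.\<close>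

lemma orbit_unique:
  assumes \<sigma>: "\<And>t. \<sigma> t \<in> I" "\<And>t. (\<sigma> has_real_derivative \<sigma>1 t) (at t)"
      "\<And>t. (\<sigma>1 has_real_derivative v\<^sup>2 * G (\<sigma> t)) (at t)" "\<And>t. (\<sigma>1 t)\<^sup>2 = v\<^sup>2 * P (\<sigma> t)"
    and v: "0 < v" and t0: "\<sigma> t0 = x (v * t0 + c)" "\<sigma>1 t0 = v * x1 (v * t0 + c)"
  shows "\<sigma> t = x (v * t + c)"
proof -
  \<comment> \<open>The first integral confines the solution to the compact band between the turning
    points, where \<open>G\<close> is Lipschitz.\<close>
  have mem: "\<sigma> t \<in> {lo..hi}" for t
  proof -
    have "0 \<le> v\<^sup>2 * P (\<sigma> t)"
      using \<sigma>(4)[of t] by (metis zero_le_power2)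
    then have "0 \<le> P (\<sigma> t)"
      using v by (simp add: zero_le_mult_iff)
    then have "(\<rho> / f (\<sigma> t))\<^sup>2 \<le> 1\<^sup>2"
      by (simp add: P_def)
    then have "\<rho> / f (\<sigma> t) \<le> 1"
      by (rule power2_le_imp_le) simp
    then have "\<rho> \<le> f (\<sigma> t)"
      using f_pos_I[OF \<sigma>(1)] by (simp add: divide_le_eq)
    then show ?thesis
      using f_gt_iff(2)[of "\<sigma> t"] \<sigma>(1)[of t] by auto
  qed
  have "continuous_on {lo..hi} (deriv G)"
    by (rule continuous_on_subset[OF smooth_on_continuous[OF smooth_on_deriv[OF _ G_smooth]] lo_hi(2)]) simp
  then obtain L where L: "0 \<le> L" "\<And>s. s \<in> {lo..hi} \<Longrightarrow> norm (deriv G s) \<le> L"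
    using continuous_on_compact_bound[OF compact_Icc] by metis
  have GL: "\<bar>G u - G w\<bar> \<le> L * \<bar>u - w\<bar>" if "u \<in> {lo..hi}" "w \<in> {lo..hi}" for u w
  proof -
    have "norm (G u - G w) \<le> L * norm (u - w)"
      by (rule field_differentiable_bound[of "{lo..hi}" G "deriv G"])
        (use that L(2) has_field_derivative_at_within[OF smooth_on_has_real_derivative[OF G_smooth]] lo_hi(2) in auto)
    then show ?thesis by simp
  qed
  define a where "a t = \<sigma> t - x (v * t + c)" for t
  define b where "b t = \<sigma>1 t - v * x1 (v * t + c)" for t
  have lin: "((\<lambda>t. v * t + c) has_real_derivative v) (at t)" for t
    by (auto intro!: derivative_eq_intros)
  have a': "(a has_real_derivative b t) (at t)" for t
    unfolding a_def b_def using DERIV_diff[OF \<sigma>(2) DERIV_chain2[OF x_deriv lin]] by (simp add: mult.commute)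
  have b': "(b has_real_derivative v\<^sup>2 * (G (\<sigma> t) - G (x (v * t + c)))) (at t)" for t
    unfolding b_def using DERIV_diff[OF \<sigma>(3) DERIV_cmult[OF DERIV_chain2[OF x1_deriv lin], of v]]
    by (simp add: algebra_simps power2_eq_square)
  have "(a t)\<^sup>2 + (b t)\<^sup>2 = 0"
  proof (rule Gronwall_zero[where E = "\<lambda>t. (a t)\<^sup>2 + (b t)\<^sup>2" and K = "1 + v\<^sup>2 * L"
        and E' = "\<lambda>t. 2 * a t * b t + 2 * b t * (v\<^sup>2 * (G (\<sigma> t) - G (x (v * t + c))))"])
    show "((\<lambda>t. (a t)\<^sup>2 + (b t)\<^sup>2) has_real_derivative
        2 * a t * b t + 2 * b t * (v\<^sup>2 * (G (\<sigma> t) - G (x (v * t + c))))) (at t)" for t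
      by (auto intro!: derivative_eq_intros a' b')
    show "\<bar>2 * a t * b t + 2 * b t * (v\<^sup>2 * (G (\<sigma> t) - G (x (v * t + c))))\<bar> \<le> (1 + v\<^sup>2 * L) * ((a t)\<^sup>2 + (b t)\<^sup>2)" for t
    proof -
      have ab: "\<bar>2 * a t * b t\<bar> \<le> (a t)\<^sup>2 + (b t)\<^sup>2"
        using sum_squares_bound[of "\<bar>a t\<bar>" "\<bar>b t\<bar>"] by (simp add: abs_mult)
      have "\<bar>G (\<sigma> t) - G (x (v * t + c))\<bar> \<le> L * \<bar>a t\<bar>"
        using GL[OF mem, of "x (v * t + c)" t] x_I by (simp add: a_def)
      from mult_left_mono[OF mult_left_mono[OF this zero_le_power2[of v]] abs_ge_zero[of "2 * b t"]]
      have "\<bar>2 * b t * (v\<^sup>2 * (G (\<sigma> t) - G (x (v * t + c))))\<bar> \<le> \<bar>2 * b t\<bar> * (v\<^sup>2 * (L * \<bar>a t\<bar>))"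
        by (simp add: abs_mult)
      also have "\<dots> = (v\<^sup>2 * L) * \<bar>2 * a t * b t\<bar>"
        by (simp add: abs_mult)
      also have "\<dots> \<le> (v\<^sup>2 * L) * ((a t)\<^sup>2 + (b t)\<^sup>2)"
        using L ab by (intro mult_left_mono) auto
      finally show ?thesis
        using ab by (simp add: algebra_simps abs_le_iff)
    qed
    show "(a t0)\<^sup>2 + (b t0)\<^sup>2 = 0"
      using t0 by (simp add: a_def b_def)
  qed auto
  then show ?thesis
    by (simp add: a_def sum_power2_eq_zero_iff)
qed

end

section \<open>Length, winding number and the equator\<close>

context profile
begin

lemma curve_speed:
  assumes "(\<sigma> has_real_derivative \<sigma>1) (at t)" "(\<theta> has_real_derivative \<theta>1) (at t)" "\<sigma> t \<in> I"
  shows "g (\<Phi> (\<sigma> t, \<theta> t)) (vector_derivative (\<lambda>t. \<Phi> (\<sigma> t, \<theta> t)) (at t))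
      (vector_derivative (\<lambda>t. \<Phi> (\<sigma> t, \<theta> t)) (at t)) = \<sigma>1\<^sup>2 + (f (\<sigma> t))\<^sup>2 * \<theta>1\<^sup>2"
  using vector_derivative_at[OF Phi_curve[OF assms]] metric_D[OF assms(3)]
  by (simp add: power2_eq_square)

lemma curve_length_const:
  assumes "\<And>t. (\<sigma> has_real_derivative \<sigma>1 t) (at t)" "\<And>t. (\<theta> has_real_derivative \<theta>1 t) (at t)" "\<And>t. \<sigma> t \<in> I"
    and "\<And>t. (\<sigma>1 t)\<^sup>2 + (f (\<sigma> t))\<^sup>2 * (\<theta>1 t)\<^sup>2 = v\<^sup>2" "0 \<le> v" "0 \<le> T"
  shows "curve_length g 0 T (\<lambda>t. \<Phi> (\<sigma> t, \<theta> t)) = v * T"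
  unfolding curve_length_def curve_speed[OF assms(1-3)] assms(4) using assms(5,6) by simp

text \<open>The horizontal part of the reference meridian has a continuous logarithm over the
  contractible interval \<open>I\<close>. Adding the angle writes the projected curve as an
  exponential, and the meridian term cancels since the first coordinate returns to its starting
  value.\<close>

lemma winding_curve:
  assumes "\<And>t. \<sigma> t \<in> I" "continuous_on UNIV \<sigma>" "continuous_on UNIV \<theta>" "\<sigma> T = \<sigma> 0"
  shows "winding_z (\<lambda>t. \<Phi> (\<sigma> t, \<theta> t)) T = (\<theta> T - \<theta> 0) / (2 * pi)"
proof -
  have "continuous_on I (\<lambda>s. Complex (A s) (B s))"
    unfolding Complex_eq using ABh_smooth(1,2)[THEN smooth_on_continuous] by (intro continuous_intros)
  moreover have "Complex (A s) (B s) \<noteq> 0" if "s \<in> I" for s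
    using ABh[OF that] AB_pos[OF that] by (auto simp: complex_eq_iff)
  ultimately obtain L where L: "continuous_on I L" "\<And>s. s \<in> I \<Longrightarrow> Complex (A s) (B s) = exp (L s)"
    using continuous_logarithm_on_contractible[of I "\<lambda>s. Complex (A s) (B s)"] convex_imp_contractible[of I]
    by auto
  define p where "p s = L (\<sigma> (T * s)) + \<i> * \<theta> (T * s)" for s
  have "continuous_on UNIV p"
    unfolding p_def
    by (intro continuous_intros continuous_on_compose2[OF L(1)] continuous_on_compose2[OF assms(2)] continuous_on_compose2[OF assms(3)])
      (use assms(1) in auto)
  then have "path p"
    unfolding path_def by (rule continuous_on_subset) simp
  have "(\<lambda>s. Complex (\<Phi> (\<sigma> (T * s), \<theta> (T * s)) $ 1) (\<Phi> (\<sigma> (T * s), \<theta> (T * s)) $ 2)) = exp \<circ> p"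
  proof
    fix s
    have "exp (p s) = Complex (A (\<sigma> (T * s))) (B (\<sigma> (T * s))) * cis (\<theta> (T * s))"
      by (simp add: p_def exp_add L(2)[OF assms(1)] cis_conv_exp)
    then show "Complex (\<Phi> (\<sigma> (T * s), \<theta> (T * s)) $ 1) (\<Phi> (\<sigma> (T * s), \<theta> (T * s)) $ 2) = (exp \<circ> p) s"
      by (simp add: Phi_nth[OF assms(1)] complex_eq_iff algebra_simps)
  qed
  then have "winding_z (\<lambda>t. \<Phi> (\<sigma> t, \<theta> t)) T = (pathfinish p - pathstart p) / (2 * of_real pi * \<i>)"
    unfolding winding_z_def using winding_number_compose_exp[OF \<open>path p\<close>] by simp
  also have "\<dots> = (\<theta> T - \<theta> 0) / (2 * pi)"
    by (simp add: pathfinish_def pathstart_def p_def assms(4) field_simps)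
  finally show ?thesis .
qed

definition E0 where "E0 = range (\<lambda>t. \<Phi> (s0, t))"

lemma s0_I: "s0 \<in> I"
  using s0 by simp

lemma Phi_E0:
  assumes "s \<in> I"
  shows "\<Phi> (s, t) \<in> E0 \<longleftrightarrow> s = s0"
  using Z_Phi[OF s0_I] Z_Phi[OF assms, of t] by (auto simp: E0_def)

text \<open>With vanishing derivative of the profile at \<open>s0\<close>, the constant first
  coordinate solves the reduced equation.\<close>

lemma equator_closed_geodesic:
  "closed_geodesic g (\<lambda>t. \<Phi> (s0, t)) (2 * pi)"
  unfolding closed_geodesic_def
proof (intro conjI allI impI)
  show "geodesic g (\<lambda>t. \<Phi> (s0, t))"
    by (rule geodesicI[where \<sigma> = "\<lambda>t. s0" and \<theta> = "\<lambda>t. t" and ?\<theta>1.0 = "\<lambda>t. 1" and ?\<sigma>1.0 = "\<lambda>t. 0" and k = "(f s0)\<^sup>2"])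
      (auto simp: smooth_on_const smooth_on_ident s0)
  show "\<Phi> (s0, t + 2 * pi) = \<Phi> (s0, t)" for t
    using Phi_periodic[OF s0_I, of t 1] by simp
  fix s :: real assume s: "0 < s \<and> s < 2 * pi"
  have "\<Phi> (s0, 0 + s) \<noteq> \<Phi> (s0, 0)"
  proof
    assume "\<Phi> (s0, 0 + s) = \<Phi> (s0, 0)"
    then obtain n :: int where "s = 2 * pi * n"
      using Phi_angle_eq[OF s0_I, of "0 + s" 0] by auto
    then have "0 < n" "n < 1"
      using s by (auto simp: zero_less_mult_iff)
    then show False by simp
  qed
  then show "\<exists>t. \<Phi> (s0, t + s) \<noteq> \<Phi> (s0, t)" by blast
qed simp

lemma rotz_Phi: "s \<in> I \<Longrightarrow> rotz \<alpha> (\<Phi> (s, t)) = \<Phi> (s, t + \<alpha>)"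
  using polar unfolding polar_coordinates_def by auto

lemma is_equator_E0: "is_equator g E0"
  unfolding is_equator_def
proof (intro conjI allI)
  show "\<exists>\<gamma> T. closed_geodesic g \<gamma> T \<and> E0 = range \<gamma>"
    using equator_closed_geodesic by (auto simp: E0_def)
  show "rotz \<alpha> ` E0 = E0" for \<alpha>
  proof -
    have "rotz \<alpha> ` E0 = range (\<lambda>t. \<Phi> (s0, t + \<alpha>))"
      unfolding E0_def image_image rotz_Phi[OF s0_I] ..
    also have "\<dots> = E0"
      unfolding E0_def by (auto simp: image_iff) (metis diff_add_cancel)
    finally show ?thesis .
  qed
qed

lemma equator_eq: "\<exists>!E. is_equator g E \<Longrightarrow> equator g = E0"
  unfolding equator_def using the1_equality[of "is_equator g" E0] is_equator_E0 by blast

lemma avoid_poles: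
  assumes "range \<gamma> \<subseteq> S2" "south_pole \<notin> range \<gamma>" "north_pole \<notin> range \<gamma>"
  shows "\<bar>\<gamma> t $ 3\<bar> < 1"
  using S2_poles[of "\<gamma> t"] assms by (metis range_subsetD rangeI)

lemma closed_geodesic_not_constant:
  assumes "closed_geodesic g \<gamma> T"
  shows "\<exists>t. \<gamma> t \<noteq> \<gamma> 0"
proof (rule ccontr)
  assume "\<not> ?thesis"
  then have "\<gamma> (t + T / 2) = \<gamma> t" for t by metis
  then show False
    using assms unfolding closed_geodesic_def by (metis half_gt_zero field_sum_of_halves less_add_same_cancel1)
qed

text \<open>The definite description requires all closed geodesics with this image to have the same
  length. Each runs along the parallel with constant angular velocity \<open>c\<close>, and
  minimality of the period forces \<bar>c\<bar> \<open>T = 2 pi\<close>.\<close>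

lemma equator_length_eq:
  assumes "\<exists>!E. is_equator g E"
  shows "equator_length g = 2 * pi * R"
  unfolding equator_length_def equator_eq[OF assms]
proof (rule the_equality)
  have "curve_length g 0 (2 * pi) (\<lambda>t. \<Phi> ((\<lambda>t. s0) t, (\<lambda>t. t) t)) = R * (2 * pi)"
    by (rule curve_length_const[where ?\<sigma>1.0 = "\<lambda>t. 0" and ?\<theta>1.0 = "\<lambda>t. 1"])
      (use R_pos s0 in \<open>auto simp: R_def\<close>)
  then show "\<exists>\<gamma> T. closed_geodesic g \<gamma> T \<and> range \<gamma> = E0 \<and> 2 * pi * R = curve_length g 0 T \<gamma>"
    using equator_closed_geodesic by (intro exI[of _ "\<lambda>t. \<Phi> (s0, t)"] exI[of _ "2 * pi"]) (auto simp: E0_def)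
  fix l assume "\<exists>\<gamma> T. closed_geodesic g \<gamma> T \<and> range \<gamma> = E0 \<and> l = curve_length g 0 T \<gamma>"
  then obtain \<gamma> T where \<gamma>: "closed_geodesic g \<gamma> T" "range \<gamma> = E0" "l = curve_length g 0 T \<gamma>"
    by blast
  have geo: "geodesic g \<gamma>" "0 < T" "\<And>t. \<gamma> (t + T) = \<gamma> t"
    "\<And>s. 0 < s \<Longrightarrow> s < T \<Longrightarrow> \<exists>t. \<gamma> (t + s) \<noteq> \<gamma> t"
    using \<gamma>(1) unfolding closed_geodesic_def by blast+
  have on: "\<exists>u. \<gamma> t = \<Phi> (s0, u)" for t
    using \<gamma>(2) by (auto simp: E0_def)
  have lt1: "\<bar>\<gamma> t $ 3\<bar> < 1" and Zg: "Z (\<gamma> t $ 3) = s0" for t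
    using on[of t] Phi_S2(2)[OF s0_I] Z_Phi[OF s0_I] by auto
  obtain \<sigma> \<theta> \<sigma>1 \<theta>1 k where *: "\<And>t. \<gamma> t = \<Phi> (\<sigma> t, \<theta> t)" "\<And>t. \<sigma> t \<in> I"
    "\<And>t. (\<sigma> has_real_derivative \<sigma>1 t) (at t)" "\<And>t. (\<theta> has_real_derivative \<theta>1 t) (at t)"
    "\<And>t. (\<sigma>1 has_real_derivative f (\<sigma> t) * deriv f (\<sigma> t) * (\<theta>1 t)\<^sup>2) (at t)"
    "\<And>t. (f (\<sigma> t))\<^sup>2 * \<theta>1 t = k"
    using geodesicD[OF geo(1) lt1, of s0 s0] Zg s0 by (metis order_refl)
  have \<sigma>: "\<sigma> t = s0" for t
    using Zg[of t] *(1,2) Z_Phi by metis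
  have \<sigma>1: "\<sigma>1 t = 0" for t
  proof -
    have "\<sigma> = (\<lambda>t. s0)" using \<sigma> by auto
    then show ?thesis
      using *(3)[of t] DERIV_unique DERIV_const by blast
  qed
  define c where "c = k / R\<^sup>2"
  have \<theta>1: "\<theta>1 t = c" for t
    using *(6)[of t] R_pos \<sigma> by (auto simp: c_def R_def field_simps)
  have \<theta>: "\<theta> t = \<theta> 0 + c * t" for t
    by (rule has_real_derivative_eqI[where h = "\<lambda>t. c" and a = 0 and F = \<theta>])
      (use *(4) \<theta>1 in \<open>auto intro!: derivative_eq_intros\<close>)
  have g: "\<gamma> t = \<Phi> (s0, \<theta> 0 + c * t)" for t
    using *(1) \<sigma> \<theta> by metis
  have "c \<noteq> 0"
    using closed_geodesic_not_constant[OF \<gamma>(1)] g by auto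
  obtain n :: int where n: "c * T = 2 * pi * n"
    using Phi_angle_eq[OF s0_I, of "\<theta> 0 + c * T" "\<theta> 0"] geo(3)[of 0] g by force
  \<comment> \<open>The total angle is a nonzero multiple of 2 pi; if it exceeded 2 pi, the time of
    one full turn would be a smaller period.\<close>
  have "\<bar>c\<bar> * T = 2 * pi"
  proof (rule ccontr)
    assume ne: "\<bar>c\<bar> * T \<noteq> 2 * pi"
    have "\<bar>c\<bar> * T = 2 * pi * \<bar>real_of_int n\<bar>"
      using arg_cong[OF n, of abs] geo(2) by (simp add: abs_mult)
    moreover have "n \<noteq> 0"
      using n \<open>c \<noteq> 0\<close> geo(2) by auto
    then have "1 \<le> \<bar>real_of_int n\<bar>" by linarith
    ultimately have "2 * pi < \<bar>c\<bar> * T"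
      using ne mult_left_mono[of 1 "\<bar>real_of_int n\<bar>" "2 * pi"] by simp
    then have s: "0 < 2 * pi / \<bar>c\<bar>" "2 * pi / \<bar>c\<bar> < T"
      using \<open>c \<noteq> 0\<close> by (auto simp: divide_less_eq mult.commute)
    have "\<gamma> (t + 2 * pi / \<bar>c\<bar>) = \<gamma> t" for t
    proof -
      have "\<theta> 0 + c * (t + 2 * pi / \<bar>c\<bar>) = \<theta> 0 + c * t + 2 * pi * of_int (if 0 < c then 1 else - 1)"
        using \<open>c \<noteq> 0\<close> by (auto simp: field_simps)
      then show ?thesis
        by (simp only: g Phi_periodic[OF s0_I])
    qed
    then show False
      using geo(4)[OF s] by blast
  qed
  moreover have "curve_length g 0 T (\<lambda>t. \<Phi> (\<sigma> t, \<theta> t)) = (R * \<bar>c\<bar>) * T"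
    by (rule curve_length_const[OF *(3,4,2)]) (use R_pos geo(2) \<sigma> \<sigma>1 \<theta>1 in \<open>auto simp: R_def power_mult_distrib\<close>)
  moreover have "\<gamma> = (\<lambda>t. \<Phi> (\<sigma> t, \<theta> t))"
    using *(1) by (rule ext)
  ultimately show "l = 2 * pi * R"
    using \<gamma>(3) by (simp only: mult.assoc) (simp add: mult.commute)
qed

end

section \<open>Rotation and length of an orbit as functions of the Clairaut constant\<close>

text \<open>At unit speed the angle grows by \<rho>\<open>/ f^2\<close> per unit of time, and time
  by \<open>f / sqrt (f^2 -\<close>\<rho>\<open>^2)\<close> per unit of meridian length. The factor
  2 accounts for the way there and back; the value 0 for small \<open>u\<close> restricts the
  integrals to the band of the oscillation.\<close>

definition kTheta :: "real \<Rightarrow> real \<Rightarrow> real" where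
  "kTheta \<rho> u = (if \<rho> < u then 2 * \<rho> / (u * sqrt (u\<^sup>2 - \<rho>\<^sup>2)) else 0)"

definition kEll :: "real \<Rightarrow> real \<Rightarrow> real" where
  "kEll \<rho> u = (if \<rho> < u then 2 * u / sqrt (u\<^sup>2 - \<rho>\<^sup>2) else 0)"

text \<open>The kernel sees only the value of the profile, so for nonnegative \<open>K\<close> this
  is an integral against the push-forward measure. Values in \<open>ennreal\<close> permit Tonelli
  and additivity before finiteness is known.\<close>

definition prof_int :: "real \<Rightarrow> (real \<Rightarrow> real) \<Rightarrow> (real \<Rightarrow> real) \<Rightarrow> ennreal" where
  "prof_int m r K = (\<integral>\<^sup>+s. ennreal (K (r s)) * indicator {0..m} s \<partial>lborel)"

definition Theta :: "real \<Rightarrow> (real \<Rightarrow> real) \<Rightarrow> real \<Rightarrow> real" where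
  "Theta m r \<rho> = enn2real (prof_int m r (kTheta \<rho>))"

definition Ell :: "real \<Rightarrow> (real \<Rightarrow> real) \<Rightarrow> real \<Rightarrow> real" where
  "Ell m r \<rho> = enn2real (prof_int m r (kEll \<rho>))"

lemma nn_integral_substitution_Icc:
  fixes f g g' :: "real \<Rightarrow> real"
  assumes "set_borel_measurable borel {g a..g b} f"
    and "\<And>x. x \<in> {a..b} \<Longrightarrow> (g has_real_derivative g' x) (at x)"
    and "continuous_on {a..b} g'" "\<And>x. x \<in> {a..b} \<Longrightarrow> 0 \<le> g' x" "a \<le> b"
  shows "(\<integral>\<^sup>+x. ennreal (f x) * indicator {g a..g b} x \<partial>lborel)
    = (\<integral>\<^sup>+x. ennreal (f (g x) * g' x) * indicator {a..b} x \<partial>lborel)"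
  unfolding nn_integral_set_ennreal by (rule nn_integral_substitution[OF assms])

section \<open>Quadratures along the profile\<close>

context orbit
begin

text \<open>Substituting the phase on \<open>{0..pi}\<close>, where \<open>X\<close> increases from
  \<open>lo\<close> to \<open>hi\<close>, cancels the singularity at both ends: the square root of
  \<open>P\<close> becomes \<open>amp * sin\<close> times \<omega>, and the derivative of
  \<open>X\<close> supplies \<open>amp * sin\<close>.\<close>

lemma quadrature:
  assumes H: "continuous_on {lo..hi} H" "\<And>s. s \<in> {lo..hi} \<Longrightarrow> 0 \<le> H s"
    and K: "\<And>s. lo < s \<Longrightarrow> s < hi \<Longrightarrow> K (f s) = 2 * H s / sqrt (P s)"
    and K0: "\<And>u. u \<le> \<rho> \<Longrightarrow> K u = 0"
    and F: "\<And>\<psi>. (F has_real_derivative H (X \<psi>) / \<omega> \<psi>) (at \<psi>)"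
  shows "prof_int m f K = ennreal (2 * (F pi - F 0))"
proof -
  have Xe: "X 0 = lo" "X pi = hi"
    by (auto simp: X_def mid_def amp_def field_simps)
  have PC: "continuous_on {lo..hi} P"
    by (rule DERIV_continuous_on[OF has_field_derivative_at_within[OF P_deriv]]) (use lo_hi in auto)
  have "ennreal (K (f s)) * indicator {0..m} s = ennreal (2 * H s / sqrt (P s)) * indicator {X 0..X pi} s" for s
  proof (cases "lo < s \<and> s < hi")
    case True
    then show ?thesis
      using K[of s] lo hi by (auto simp: Xe indicator_def)
  next
    case False
    then have "s \<in> {0..m} \<Longrightarrow> K (f s) = 0"
      using f_gt_iff(1)[of s] K0[of "f s"] by force
    moreover have "s \<in> {lo..hi} \<Longrightarrow> P s = 0"
      using False P_ends by (cases "s = lo"; cases "s = hi") auto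
    ultimately show ?thesis
      by (auto simp: Xe indicator_def)
  qed
  then have "prof_int m f K = (\<integral>\<^sup>+s. ennreal (2 * H s / sqrt (P s)) * indicator {X 0..X pi} s \<partial>lborel)"
    by (simp add: prof_int_def)
  also have "\<dots> = (\<integral>\<^sup>+\<psi>. ennreal (2 * H (X \<psi>) / sqrt (P (X \<psi>)) * (amp * sin \<psi>)) * indicator {0..pi} \<psi> \<partial>lborel)"
  proof (rule nn_integral_substitution_Icc[where g = X and a = 0 and b = pi and f = "\<lambda>s. 2 * H s / sqrt (P s)"
        and g' = "\<lambda>\<psi>. amp * sin \<psi>"])
    have "(\<lambda>s. (indicator {lo..hi} s *\<^sub>R (2 * H s)) / (indicator {lo..hi} s *\<^sub>R sqrt (P s))) \<in> borel_measurable borel"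
      by (intro borel_measurable_divide borel_measurable_continuous_on_indicator continuous_intros H PC) auto
    also have "(\<lambda>s. (indicator {lo..hi} s *\<^sub>R (2 * H s)) / (indicator {lo..hi} s *\<^sub>R sqrt (P s)))
        = (\<lambda>s. indicator {lo..hi} s *\<^sub>R (2 * H s / sqrt (P s)))"
    proof
      fix s
      show "(indicator {lo..hi} s *\<^sub>R (2 * H s)) / (indicator {lo..hi} s *\<^sub>R sqrt (P s))
          = indicator {lo..hi} s *\<^sub>R (2 * H s / sqrt (P s))"
        by (cases "s \<in> {lo..hi}") auto
    qed
    finally show "set_borel_measurable borel {X 0..X pi} (\<lambda>s. 2 * H s / sqrt (P s))"
      by (simp add: set_borel_measurable_def Xe)
  qed (use X_deriv amp_pos in \<open>auto intro!: continuous_intros mult_nonneg_nonneg sin_ge_zero\<close>)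
  also have "\<dots> = (\<integral>\<^sup>+\<psi>. ennreal (2 * (H (X \<psi>) / \<omega> \<psi>)) * indicator {0..pi} \<psi> \<partial>lborel)"
  proof (rule nn_integral_cong_AE)
    have "AE \<psi> in lborel. \<psi> \<noteq> 0 \<and> \<psi> \<noteq> pi"
      using AE_lborel_singleton[of 0] AE_lborel_singleton[of pi] by eventually_elim auto
    then show "AE \<psi> in lborel. ennreal (2 * H (X \<psi>) / sqrt (P (X \<psi>)) * (amp * sin \<psi>)) * indicator {0..pi} \<psi>
        = ennreal (2 * (H (X \<psi>) / \<omega> \<psi>)) * indicator {0..pi} \<psi>"
    proof eventually_elim
      case (elim \<psi>)
      show ?case
      proof (cases "\<psi> \<in> {0..pi}")
        case True
        then have s: "0 < sin \<psi>"
          using elim by (intro sin_gt_zero) auto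
        then have "sqrt (P (X \<psi>)) = amp * sin \<psi> * \<omega> \<psi>"
          unfolding P_X using amp_pos \<omega>_pos[of \<psi>] by simp
        then have "2 * H (X \<psi>) / sqrt (P (X \<psi>)) * (amp * sin \<psi>) = 2 * (H (X \<psi>) / \<omega> \<psi>)"
          using s amp_pos \<omega>_pos[of \<psi>] by (simp add: field_simps)
        then show ?thesis by simp
      qed auto
    qed
  qed
  also have "\<dots> = ennreal (2 * F pi - 2 * F 0)"
  proof (rule nn_integral_FTC_Icc)
    have "continuous_on UNIV (\<lambda>\<psi>. 2 * (H (X \<psi>) / \<omega> \<psi>))"
      using \<omega>_pos X_range
      by (intro continuous_intros \<omega>_cont continuous_on_compose2[OF H(1) X_cont])
        (auto simp: less_imp_neq[symmetric])
    then show "(\<lambda>\<psi>. 2 * (H (X \<psi>) / \<omega> \<psi>)) \<in> borel_measurable borel"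
      by (rule borel_measurable_continuous_onI)
    show "((\<lambda>\<psi>. 2 * F \<psi>) has_real_derivative 2 * (H (X \<psi>) / \<omega> \<psi>)) (at \<psi>)" for \<psi>
      by (rule DERIV_cmult[OF F])
    show "0 \<le> 2 * (H (X \<psi>) / \<omega> \<psi>)" for \<psi>
      using H(2)[of "X \<psi>"] X_range \<omega>_pos[of \<psi>] by simp
  qed simp
  finally show ?thesis by (simp add: algebra_simps)
qed

lemma sqrt_P:
  assumes "lo < s" "s < hi"
  shows "sqrt (P s) = sqrt ((f s)\<^sup>2 - \<rho>\<^sup>2) / f s" "\<rho> < f s"
proof -
  have fs: "0 < f s"
    by (intro f_pos_I) (use assms lo hi in auto)
  then have "P s = ((f s)\<^sup>2 - \<rho>\<^sup>2) / (f s)\<^sup>2"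
    by (simp add: P_def power_divide diff_divide_distrib)
  then show "sqrt (P s) = sqrt ((f s)\<^sup>2 - \<rho>\<^sup>2) / f s"
    using fs by (simp add: real_sqrt_divide)
  show "\<rho> < f s"
    using f_gt_iff(1)[of s] assms lo hi by auto
qed

lemma Ell_eq_per: "prof_int m f (kEll \<rho>) = ennreal per" "Ell m f \<rho> = per"
proof -
  have "prof_int m f (kEll \<rho>) = ennreal (2 * (\<tau> pi - \<tau> 0))"
    by (rule quadrature[where H = "\<lambda>s. 1"]) (use sqrt_P \<tau>_deriv in \<open>auto simp: kEll_def\<close>)
  then show "prof_int m f (kEll \<rho>) = ennreal per" "Ell m f \<rho> = per"
    using per_pos by (auto simp: half_period \<tau>_sym Ell_def)
qed

lemma shift_pos: "0 < shift"
proof -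
  have "rot 0 < rot (2 * pi)"
    by (rule DERIV_pos_imp_increasing[of 0 "2 * pi" rot])
      (use rot_deriv \<rho> \<omega>_pos f_pos_I[OF X_I] in \<open>auto intro!: exI[of _ "rate _"] simp: rate_def zero_less_mult_iff less_imp_neq[symmetric]\<close>)
  then show ?thesis
    by (simp add: shift_def rot_sym)
qed

lemma Theta_eq_shift: "prof_int m f (kTheta \<rho>) = ennreal shift" "Theta m f \<rho> = shift"
proof -
  have fp: "0 < f s" if "s \<in> {lo..hi}" for s
    using that lo_hi by (intro f_pos_I) auto
  have "prof_int m f (kTheta \<rho>) = ennreal (2 * (rot pi - rot 0))"
  proof (rule quadrature[where H = "\<lambda>s. \<rho> / (f s)\<^sup>2"])
    show "continuous_on {lo..hi} (\<lambda>s. \<rho> / (f s)\<^sup>2)"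
      using fp by (intro continuous_intros f_cont) (auto simp: less_imp_neq[symmetric])
    show "kTheta \<rho> (f s) = 2 * (\<rho> / (f s)\<^sup>2) / sqrt (P s)" if "lo < s" "s < hi" for s
      using sqrt_P[OF that] fp[of s] that by (simp add: kTheta_def power2_eq_square)
    show "(rot has_real_derivative \<rho> / (f (X \<psi>))\<^sup>2 / \<omega> \<psi>) (at \<psi>)" for \<psi>
      using rot_deriv[of \<psi>] by (simp add: rate_def)
  qed (use \<rho> in \<open>auto simp: kTheta_def\<close>)
  then show "prof_int m f (kTheta \<rho>) = ennreal shift" "Theta m f \<rho> = shift"
    using shift_pos by (auto simp: half_period rot_sym Theta_def)
qed

lemma orbit_geodesic_of_type:
  assumes uniq: "\<exists>!E. is_equator g E" and pq: "1 \<le> p" "1 \<le> q" "coprime p q" "real q * shift = 2 * pi * real p"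
  shows "geodesic_of_type g p q (\<lambda>t. \<Phi> (x t, ang t)) (real q * per)"
    and "curve_length g 0 (real q * per) (\<lambda>t. \<Phi> (x t, ang t)) = real q * per"
proof -
  let ?\<gamma> = "\<lambda>t. \<Phi> (x t, ang t)" and ?T = "real q * per"
  have T: "0 < ?T"
    using pq per_pos by simp
  have fx: "0 < f (x t)" for t
    by (rule f_pos_I[OF x_I(1)])
  have geo: "geodesic g ?\<gamma>"
  proof (rule geodesicI[OF x_smooth ang_smooth x_I(1) x_deriv ang_deriv, of \<rho>])
    show "(x1 has_real_derivative f (x t) * deriv f (x t) * (\<rho> / (f (x t))\<^sup>2)\<^sup>2) (at t)" for t
      using x1_deriv[of t] fx[of t] by (simp add: G_def power2_eq_square power3_eq_cube field_simps)
    show "(f (x t))\<^sup>2 * (\<rho> / (f (x t))\<^sup>2) = \<rho>" for t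
      using fx[of t] by simp
  qed
  have per_q: "?\<gamma> (t + ?T) = ?\<gamma> t" for t
    using x_add[of t "int q"] ang_add[of t "int q"] pq(4) Phi_periodic[OF x_I(1), of t "ang t" "int p"]
    by simp
  have closed: "closed_geodesic g ?\<gamma> ?T"
    unfolding closed_geodesic_def
  proof (intro conjI allI impI geo T per_q)
    fix s assume s: "0 < s \<and> s < ?T"
    show "\<exists>t. ?\<gamma> (t + s) \<noteq> ?\<gamma> t"
    proof (rule ccontr)
      assume "\<not> ?thesis"
      then have eq: "?\<gamma> (t + s) = ?\<gamma> t" for t by blast
      have xs: "x (t + s) = x t" for t
        using arg_cong[OF eq[of t], of "\<lambda>x. Z (x $ 3)"] by (simp only: Z_Phi[OF x_I(1)])
      then obtain n :: int where n: "s = of_int n * per"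
        using x_period by blast
      have "ang (0 + s) = ang 0 + of_int n * shift"
        unfolding n by (rule ang_add)
      moreover obtain j :: int where "ang (0 + s) = ang 0 + 2 * pi * j"
        using Phi_angle_eq[OF x_I(1), of 0 "ang (0 + s)" "ang 0"] eq[of 0] xs[of 0] by auto
      ultimately have "of_int n * shift = 2 * pi * j" by simp
      \<comment> \<open>Returning after \<open>n\<close> oscillations requires
        \<open>n * shift\<close> to be a multiple of 2 pi. With the closing condition this reads
        \<open>n p = j q\<close>, and coprimality makes \<open>q\<close> divide \<open>n\<close>,
        against 0 < \<open>n\<close> < \<open>q\<close>.\<close>
      then have "of_int n * (real q * shift) = 2 * pi * (j * real q)"
        by (simp add: algebra_simps)
      then have "2 * pi * (of_int n * real p) = 2 * pi * (j * real q)"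
        unfolding pq(4) by (simp add: algebra_simps)
      then have "of_int n * real p = j * real q"
        by simp
      then have "n * int p = j * int q"
        by (metis of_int_eq_iff of_int_mult of_int_of_nat_eq)
      then have "int q dvd n * int p" by simp
      then have "int q dvd n"
        using pq(3) by (simp add: coprime_dvd_mult_left_iff coprime_commute)
      moreover have "0 < n" "n < int q"
        using s per_pos unfolding n by (auto simp: zero_less_mult_iff mult_less_cancel_right_pos)
      ultimately show False
        using zdvd_imp_le by fastforce
    qed
  qed
  have cross: "?\<gamma> t \<in> E0 \<longleftrightarrow> x t = s0" for t
    by (rule Phi_E0[OF x_I(1)])
  have poles: "south_pole \<notin> range ?\<gamma>" "north_pole \<notin> range ?\<gamma>"
    using Phi_S2(2)[OF x_I(1)] by (auto simp: south_pole_def north_pole_def) (metis abs_minus_cancel abs_one less_irrefl vector_3(3))+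
  \<comment> \<open>The orbit starts at its lower turning point, hence off the equator.\<close>
  have "phase 0 = 0"
    using phase(2)[of 0] by (simp add: \<tau>_sym)
  then have "x 0 = lo"
    by (simp add: x_def X_def mid_def amp_def field_simps)
  then have "?\<gamma> 0 \<notin> E0"
    using cross[of 0] lo by simp
  then have "range ?\<gamma> \<noteq> E0" by blast
  moreover have "cmod (winding_z ?\<gamma> ?T) = real p"
  proof -
    have "x ?T = x 0" "ang ?T = ang 0 + 2 * pi * real p"
      using x_add[of 0 "int q"] ang_add[of 0 "int q"] pq(4) by auto
    then have "winding_z ?\<gamma> ?T = of_real ((2 * pi * real p) / (2 * pi))"
      using winding_curve[of x ang ?T, OF x_I(1) x_cont smooth_on_continuous[OF ang_smooth]] by simp
    also have "\<dots> = of_real (real p)" by simp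
    finally show ?thesis by simp
  qed
  moreover have "finite {t \<in> {0..<?T}. ?\<gamma> t \<in> E0}" "card {t \<in> {0..<?T}. ?\<gamma> t \<in> E0} = 2 * q"
    using card_crossings[of 1 ?T q 0] by (auto simp: cross)
  ultimately show "geodesic_of_type g p q ?\<gamma> ?T"
    unfolding geodesic_of_type_def equator_eq[OF uniq] meridian_def using closed poles pq by auto
  have "curve_length g 0 ?T ?\<gamma> = 1 * ?T"
  proof (rule curve_length_const[OF x_deriv ang_deriv x_I(1)])
    show "(x1 t)\<^sup>2 + (f (x t))\<^sup>2 * (\<rho> / (f (x t))\<^sup>2)\<^sup>2 = 1\<^sup>2" for t
      unfolding x1_sq P_def using fx[of t] by (simp add: power2_eq_square field_simps)
  qed (use T in auto)
  then show "curve_length g 0 ?T ?\<gamma> = ?T" by simp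
qed

end

section \<open>Classification of the geodesics of type (p, q)\<close>

context profile
begin

text \<open>After normalizing the speed, every geodesic with a type is a time-shifted orbit,
  possibly run in the opposite sense. The number of crossings then gives the number of oscillations,
  and the winding number the closing condition.\<close>

lemma geodesic_of_type_orbit:
  assumes uniq: "\<exists>!E. is_equator g E" and ty: "geodesic_of_type g p q \<gamma> T"
  obtains \<rho> where "0 < \<rho>" "\<rho> < R" "real q * Theta m f \<rho> = 2 * pi * real p"
    "curve_length g 0 T \<gamma> = real q * Ell m f \<rho>"
proof -
  have cl: "closed_geodesic g \<gamma> T" and geo: "geodesic g \<gamma>" "0 < T" "\<And>t. \<gamma> (t + T) = \<gamma> t"
    and poles: "south_pole \<notin> range \<gamma>" "north_pole \<notin> range \<gamma>"
    and ne: "range \<gamma> \<noteq> E0" and p: "1 \<le> p" "1 \<le> q" "cmod (winding_z \<gamma> T) = real p"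
    and count: "card {t \<in> {0..<T}. \<gamma> t \<in> E0} = 2 * q"
    using ty unfolding geodesic_of_type_def equator_eq[OF uniq] closed_geodesic_def by auto
  have S2: "range \<gamma> \<subseteq> S2"
    using geo(1) unfolding geodesic_def by blast
  note lt1 = avoid_poles[OF S2 poles]
  have smg: "smooth_on \<gamma> UNIV"
    using geo(1) unfolding geodesic_def by blast
  have Zc: "continuous_on {0..T} (\<lambda>t. Z (\<gamma> t $ 3))"
    using smooth_on_continuous[OF Omega_smooth(2)[OF open_UNIV smg smg lt1]] continuous_on_subset by blast
  have ZI: "Z (\<gamma> t $ 3) \<in> I" for t
    by (rule Z(2)[OF lt1])
  \<comment> \<open>Extremal first coordinates over one period give the band away from the poles on
    which \<open>geodesicD\<close> relies.\<close>
  obtain tl where tl: "tl \<in> {0..T}" "\<forall>t\<in>{0..T}. Z (\<gamma> tl $ 3) \<le> Z (\<gamma> t $ 3)"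
    using continuous_attains_inf[OF _ _ Zc] geo(2) by auto
  obtain tu where tu: "tu \<in> {0..T}" "\<forall>t\<in>{0..T}. Z (\<gamma> t $ 3) \<le> Z (\<gamma> tu $ 3)"
    using continuous_attains_sup[OF _ _ Zc] geo(2) by auto
  have red: "\<exists>u\<in>{0..T}. \<gamma> t = \<gamma> u" for t
    using periodic_range[of \<gamma> T, OF geo(3,2)] by (metis imageE rangeI)
  have lu: "0 < Z (\<gamma> tl $ 3)" "Z (\<gamma> tu $ 3) < m"
    using ZI[of tl] ZI[of tu] by auto
  have L: "Z (\<gamma> tl $ 3) \<le> Z (\<gamma> t $ 3)" for t
    using red[of t] tl(2) by auto
  have U: "Z (\<gamma> t $ 3) \<le> Z (\<gamma> tu $ 3)" for t
    using red[of t] tu(2) by auto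
  obtain \<sigma> \<theta> \<sigma>1 \<theta>1 k where *: "\<And>t. \<gamma> t = \<Phi> (\<sigma> t, \<theta> t)" "\<And>t. \<sigma> t \<in> I"
    "\<And>t. (\<sigma> has_real_derivative \<sigma>1 t) (at t)" "\<And>t. (\<theta> has_real_derivative \<theta>1 t) (at t)"
    "\<And>t. (\<sigma>1 has_real_derivative f (\<sigma> t) * deriv f (\<sigma> t) * (\<theta>1 t)\<^sup>2) (at t)"
    "\<And>t. (f (\<sigma> t))\<^sup>2 * \<theta>1 t = k"
    using geodesicD[OF geo(1) lt1 lu L U] by blast
  have "Z (\<gamma> t $ 3) = \<sigma> t" for t
    using Z_Phi[OF *(2)] by (simp only: *(1))
  then have \<sigma>per: "\<sigma> (t + T) = \<sigma> t" for t
    using arg_cong[OF geo(3)[of t], of "\<lambda>x. Z (x $ 3)"] by (simp only:)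
  have \<gamma>eq: "\<gamma> = (\<lambda>t. \<Phi> (\<sigma> t, \<theta> t))"
    using *(1) by (rule ext)
  have fs: "0 < f (\<sigma> t)" "f (\<sigma> t) \<le> R" for t
    using f_pos f_le_R(1)[of "\<sigma> t"] *(2)[of t] by auto
  have \<theta>1: "\<theta>1 t = k / (f (\<sigma> t))\<^sup>2" for t
    using *(6)[of t] fs(1)[of t] by (simp add: field_simps)
  \<comment> \<open>The squared speed, whose constancy is derived here from the reduced
    equations.\<close>
  define V where "V t = (\<sigma>1 t)\<^sup>2 + (k / f (\<sigma> t))\<^sup>2" for t
  have V': "(V has_real_derivative 0) (at t)" for t
  proof -
    have "((\<lambda>t. f (\<sigma> t)) has_real_derivative deriv f (\<sigma> t) * \<sigma>1 t) (at t)"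
      by (rule DERIV_chain2[OF f_deriv *(3)])
    then have "(V has_real_derivative 2 * \<sigma>1 t * (f (\<sigma> t) * deriv f (\<sigma> t) * (\<theta>1 t)\<^sup>2)
        + 2 * (k / f (\<sigma> t)) * (- (k * (deriv f (\<sigma> t) * \<sigma>1 t)) / (f (\<sigma> t))\<^sup>2)) (at t)"
      unfolding V_def using fs(1)[of t] *(5)[of t]
      by (auto intro!: derivative_eq_intros simp: power2_eq_square)
    moreover have "2 * \<sigma>1 t * (f (\<sigma> t) * deriv f (\<sigma> t) * (\<theta>1 t)\<^sup>2)
        + 2 * (k / f (\<sigma> t)) * (- (k * (deriv f (\<sigma> t) * \<sigma>1 t)) / (f (\<sigma> t))\<^sup>2) = 0"
      unfolding \<theta>1 using fs(1)[of t] by (simp add: field_simps power2_eq_square)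
    ultimately show ?thesis by simp
  qed
  have V0: "V t = V 0" for t
    by (rule DERIV_isconst_all) (simp add: V')
  \<comment> \<open>With vanishing Clairaut integral the angle would be constant and the winding
    number 0, against \<open>p\<close> \<ge> 1.\<close>
  have "k \<noteq> 0"
  proof
    assume "k = 0"
    then have "\<theta> t = \<theta> 0" for t
      using DERIV_isconst_all[of \<theta> t 0] *(4) \<theta>1 by simp
    moreover have "\<sigma> T = \<sigma> 0"
      using \<sigma>per[of 0] by simp
    ultimately have "winding_z \<gamma> T = 0"
      unfolding \<gamma>eq using winding_curve[of \<sigma> \<theta> T]  *(2)
        DERIV_continuous_on[OF has_field_derivative_at_within[OF *(3)]] DERIV_continuous_on[OF has_field_derivative_at_within[OF *(4)]]
      by simp
    then show False using p by simp
  qed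
  have cross: "\<gamma> t \<in> E0 \<longleftrightarrow> \<sigma> t = s0" for t
    unfolding *(1) by (rule Phi_E0[OF *(2)])
  obtain t0 where t0: "\<sigma> t0 = s0"
  proof -
    have "{t \<in> {0..<T}. \<gamma> t \<in> E0} \<noteq> {}"
      using count p by (metis card.empty mult_is_0 not_one_le_zero numeral_2_eq_2 old.nat.distinct(1))
    then show ?thesis using that cross by blast
  qed
  define v where "v = sqrt (V 0)"
  have Vk: "(k / f (\<sigma> t))\<^sup>2 \<le> V 0" for t
    by (subst V0[of t, symmetric]) (simp add: V_def)
  have Vpos: "0 < V 0"
    using Vk[of 0] \<open>k \<noteq> 0\<close> fs(1)[of 0] by (smt (verit) divide_eq_0_iff zero_less_power2)
  have v: "0 < v" "v\<^sup>2 = V 0"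
    using Vpos by (auto simp: v_def)
  \<comment> \<open>The Clairaut integral rescaled to unit speed; the sign of \<open>k\<close>, the
    sense of rotation, is restored through \<open>sgn k\<close> below.\<close>
  define \<rho> where "\<rho> = \<bar>k\<bar> / v"
  have \<rho>0: "0 < \<rho>"
    using v \<open>k \<noteq> 0\<close> by (simp add: \<rho>_def)
  have k\<rho>: "k\<^sup>2 = v\<^sup>2 * \<rho>\<^sup>2"
    using v(1) by (simp add: \<rho>_def power_divide)
  have energy: "(\<sigma>1 t)\<^sup>2 + (k / f (\<sigma> t))\<^sup>2 = v\<^sup>2" for t
    using V0[of t] by (simp only: V_def[of t] v(2))
  have \<sigma>1sq: "(\<sigma>1 t)\<^sup>2 = v\<^sup>2 * (1 - (\<rho> / f (\<sigma> t))\<^sup>2)" for t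
    using energy[of t] by (simp add: power_divide k\<rho> algebra_simps)
  have "\<rho> \<le> R"
  proof -
    have "0 \<le> v\<^sup>2 * (1 - (\<rho> / f (\<sigma> t0))\<^sup>2)"
      unfolding \<sigma>1sq[symmetric] by simp
    then have "(\<rho> / R)\<^sup>2 \<le> 1\<^sup>2"
      using v(1) by (simp add: t0 R_def zero_le_mult_iff)
    then have "\<rho> / R \<le> 1"
      by (rule power2_le_imp_le) simp
    then show ?thesis
      using R_pos by (simp add: divide_le_eq)
  qed
  \<comment> \<open>For \<rho> = \<open>R\<close> the energy relation leaves no velocity along the
    meridians, so the curve would stay on the equator and cover it.\<close>
  moreover have "\<rho> \<noteq> R"
  proof
    assume "\<rho> = R"
    have "\<sigma>1 t = 0" for t
    proof -
      have "1 \<le> R / f (\<sigma> t)"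
        using fs[of t] by simp
      then have "1 \<le> (R / f (\<sigma> t))\<^sup>2"
        using power_mono[of 1 "R / f (\<sigma> t)" 2] by simp
      then have "v\<^sup>2 * (1 - (\<rho> / f (\<sigma> t))\<^sup>2) \<le> 0"
        unfolding \<open>\<rho> = R\<close> by (intro mult_nonneg_nonpos) auto
      then show ?thesis
        unfolding \<sigma>1sq[symmetric] by simp
    qed
    then have \<sigma>: "\<sigma> t = s0" for t
      using DERIV_isconst_all[of \<sigma> t t0] *(3) t0 by simp
    have "(\<theta> has_real_derivative k / R\<^sup>2) (at t)" for t
      using *(4)[of t] by (simp add: \<theta>1 \<sigma> R_def)
    moreover have "((\<lambda>t. \<theta> 0 + k / R\<^sup>2 * t) has_real_derivative k / R\<^sup>2) (at t)" for t
      using DERIV_add[OF DERIV_const DERIV_cmult[OF DERIV_ident, of "k / R\<^sup>2"]] by simp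
    ultimately have \<theta>: "\<theta> t = \<theta> 0 + k / R\<^sup>2 * t" for t
      by (rule has_real_derivative_eqI[where a = 0]) simp
    have "range \<gamma> = E0"
    proof
      show "E0 \<subseteq> range \<gamma>"
      proof
        fix y assume "y \<in> E0"
        then obtain u where "y = \<Phi> (s0, u)" by (auto simp: E0_def)
        moreover have "\<theta> ((u - \<theta> 0) * R\<^sup>2 / k) = u"
          using \<open>k \<noteq> 0\<close> R_pos by (subst \<theta>) simp
        ultimately have "y = \<gamma> ((u - \<theta> 0) * R\<^sup>2 / k)"
          by (simp add: *(1) \<sigma>)
        then show "y \<in> range \<gamma>" by blast
      qed
    qed (auto simp: *(1) \<sigma> E0_def)
    then show False using ne by blast
  qed
  ultimately have "\<rho> < R" by simp
  interpret orbit g m \<Phi> f s0 \<rho>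
    by unfold_locales (use \<rho>0 \<open>\<rho> < R\<close> in auto)
  have \<sigma>1sq: "(\<sigma>1 t)\<^sup>2 = v\<^sup>2 * P (\<sigma> t)" for t
    by (simp add: \<sigma>1sq P_def)
  have \<sigma>2: "(\<sigma>1 has_real_derivative v\<^sup>2 * G (\<sigma> t)) (at t)" for t
  proof -
    have "f (\<sigma> t) * deriv f (\<sigma> t) * (\<theta>1 t)\<^sup>2 = v\<^sup>2 * G (\<sigma> t)"
      unfolding \<theta>1 G_def using fs(1)[of t] k\<rho> by (simp add: power_divide field_simps power2_eq_square power3_eq_cube)
    then show ?thesis using *(5)[of t] by simp
  qed
  \<comment> \<open>At an equator crossing the energy relation fixes the velocity up to sign. The
    time shift selects the upward crossing at \<alpha> or the downward one at -\<alpha>.\<close>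
  obtain c where c: "\<sigma> t0 = x (v * t0 + c)" "\<sigma>1 t0 = v * x1 (v * t0 + c)"
  proof -
    have sq: "(\<sigma>1 t0)\<^sup>2 = (v * x1 u)\<^sup>2" if "x u = s0" for u
      using \<sigma>1sq[of t0] x1_sq[of u] that by (simp add: t0 power_mult_distrib)
    have xa: "x \<alpha> = s0" "x (- \<alpha>) = s0"
      using crossing_iff[of \<alpha>] crossing_iff[of "- \<alpha>"] by (auto intro: exI[of _ 0])
    have s: "0 < x1 \<alpha>" "x1 (- \<alpha>) < 0"
      using x1_crossing[of 0] by auto
    show ?thesis
    proof (cases "0 \<le> \<sigma>1 t0")
      case True
      then have "\<sigma>1 t0 = v * x1 \<alpha>"
        using sq[OF xa(1)] s v(1) by (intro power2_eq_imp_eq[of "\<sigma>1 t0" "v * x1 \<alpha>"]) auto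
      then show ?thesis
        using that[of "\<alpha> - v * t0"] xa t0 by simp
    next
      case False
      have "(- \<sigma>1 t0)\<^sup>2 = (- (v * x1 (- \<alpha>)))\<^sup>2"
        using sq[OF xa(2)] by simp
      moreover have "0 \<le> - \<sigma>1 t0" "0 \<le> - (v * x1 (- \<alpha>))"
        using False s v(1) by (auto simp: mult_nonneg_nonpos)
      ultimately have "- \<sigma>1 t0 = - (v * x1 (- \<alpha>))"
        by (rule power2_eq_imp_eq)
      then show ?thesis
        using that[of "- \<alpha> - v * t0"] xa t0 by simp
    qed
  qed
  have \<sigma>: "\<sigma> t = x (v * t + c)" for t
    by (rule orbit_unique[OF *(2,3) \<sigma>2 \<sigma>1sq v(1) c])
  have k: "k = sgn k * (v * \<rho>)"
    using v by (simp add: \<rho>_def sgn_mult_abs)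
  have \<theta>: "\<theta> t = \<theta> 0 + sgn k * (ang (v * t + c) - ang c)" for t
  proof (rule has_real_derivative_eqI[where h = \<theta>1 and a = 0 and F = \<theta>])
    show "((\<lambda>t. \<theta> 0 + sgn k * (ang (v * t + c) - ang c)) has_real_derivative \<theta>1 t) (at t)" for t
    proof -
      have lin: "((\<lambda>t. v * t + c) has_real_derivative v) (at t)"
        by (auto intro!: derivative_eq_intros)
      have "sgn k * (\<rho> / (f (x (v * t + c)))\<^sup>2 * v) = \<theta>1 t"
        unfolding \<theta>1 \<sigma> by (subst (2) k) simp
      moreover have "((\<lambda>t. \<theta> 0 + sgn k * (ang (v * t + c) - ang c)) has_real_derivative
          sgn k * (\<rho> / (f (x (v * t + c)))\<^sup>2 * v)) (at t)"
        using DERIV_chain2[OF ang_deriv lin] by (auto intro!: derivative_eq_intros)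
      ultimately show ?thesis by simp
    qed
  qed (use *(4) in auto)
  have "x (u + v * T) = x u" for u
  proof -
    have "\<sigma> ((u - c) / v + T) = \<sigma> ((u - c) / v)"
      by (rule \<sigma>per)
    moreover have "v * ((u - c) / v + T) + c = u + v * T" "v * ((u - c) / v) + c = u"
      using v(1) by (simp_all add: field_simps)
    ultimately show ?thesis
      by (simp only: \<sigma>)
  qed
  then obtain n :: int where n: "v * T = of_int n * per"
    using x_period by blast
  have "0 < real_of_int n"
    using n v(1) geo(2) per_pos by (metis zero_less_mult_pos2 mult_pos_pos)
  then have n0: "v * T = real (nat n) * per" "0 < n"
    using n by auto
  have "card {t \<in> {0..<T}. \<gamma> t \<in> E0} = 2 * nat n"
    using card_crossings(2)[OF v(1) n0(1), of c] by (simp add: cross \<sigma>)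
  then have nq: "nat n = q"
    using count by simp
  have "winding_z \<gamma> T = (\<theta> T - \<theta> 0) / (2 * pi)"
    unfolding \<gamma>eq
  proof (rule winding_curve[OF *(2)])
    show "\<sigma> T = \<sigma> 0"
      using \<sigma>per[of 0] by simp
  qed (auto intro!: DERIV_continuous_on[OF has_field_derivative_at_within[OF *(3)]] DERIV_continuous_on[OF has_field_derivative_at_within[OF *(4)]])
  also have "\<theta> T - \<theta> 0 = sgn k * (real q * shift)"
  proof -
    have "v * T + c = c + of_int n * per"
      using n by simp
    then have "ang (v * T + c) = ang c + of_int n * shift"
      by (simp only: ang_add)
    moreover have "of_int n = real q"
      using nq n0 by auto
    ultimately show ?thesis
      using \<theta>[of T] by simp
  qed
  finally have "cmod (winding_z \<gamma> T) = (real q * shift) / (2 * pi)"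
    using shift_pos \<open>k \<noteq> 0\<close> by (simp add: norm_mult norm_divide abs_sgn_eq)
  then have "real q * Theta m f \<rho> = 2 * pi * real p"
    using p(3) by (simp add: Theta_eq_shift field_simps)
  moreover have "curve_length g 0 T \<gamma> = v * T"
    unfolding \<gamma>eq
  proof (rule curve_length_const[OF *(3,4,2)])
    show "(\<sigma>1 t)\<^sup>2 + (f (\<sigma> t))\<^sup>2 * (\<theta>1 t)\<^sup>2 = v\<^sup>2" for t
      using energy[of t] fs(1)[of t] by (simp add: \<theta>1 power2_eq_square)
  qed (use v geo in auto)
  then have "curve_length g 0 T \<gamma> = real q * Ell m f \<rho>"
    by (simp add: n0 nq Ell_eq_per)
  ultimately show ?thesis
    using that \<rho>0 \<open>\<rho> < R\<close> by blast
qed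

theorem length_spectrum_eq:
  assumes uniq: "\<exists>!E. is_equator g E" and pq: "1 \<le> p" "1 \<le> q" "coprime p q"
  shows "length_spectrum g p q
    = {real q * Ell m f \<rho> | \<rho>. 0 < \<rho> \<and> \<rho> < R \<and> real q * Theta m f \<rho> = 2 * pi * real p}"
proof (intro set_eqI iffI)
  fix l assume "l \<in> length_spectrum g p q"
  then obtain \<gamma> T where "geodesic_of_type g p q \<gamma> T" "l = curve_length g 0 T \<gamma>"
    by (auto simp: length_spectrum_def)
  then obtain \<rho> where "0 < \<rho>" "\<rho> < R" "real q * Theta m f \<rho> = 2 * pi * real p" "l = real q * Ell m f \<rho>"
    using geodesic_of_type_orbit[OF uniq] by metis
  then show "l \<in> {real q * Ell m f \<rho> | \<rho>. 0 < \<rho> \<and> \<rho> < R \<and> real q * Theta m f \<rho> = 2 * pi * real p}"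
    by blast
next
  fix l assume "l \<in> {real q * Ell m f \<rho> | \<rho>. 0 < \<rho> \<and> \<rho> < R \<and> real q * Theta m f \<rho> = 2 * pi * real p}"
  then obtain \<rho> where rr: "l = real q * Ell m f \<rho>" "0 < \<rho>" "\<rho> < R" "real q * Theta m f \<rho> = 2 * pi * real p"
    by blast
  interpret orbit g m \<Phi> f s0 \<rho>
    by unfold_locales (use rr in auto)
  have t: "real q * shift = 2 * pi * real p"
    using rr(4) Theta_eq_shift(2) by simp
  have "l = curve_length g 0 (real q * per) (\<lambda>t. \<Phi> (x t, ang t))"
    using orbit_geodesic_of_type(2)[OF uniq pq t] rr(1) Ell_eq_per(2) by simp
  then show "l \<in> length_spectrum g p q"
    using orbit_geodesic_of_type(1)[OF uniq pq t] unfolding length_spectrum_def by blast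
qed

end

section \<open>Regularity of the rotation function\<close>

lemma nn_integral_eq_integral:
  fixes F :: "real \<Rightarrow> real"
  assumes "continuous_on {a..b} F" "\<And>x. x \<in> {a..b} \<Longrightarrow> 0 \<le> F x"
  shows "(\<integral>\<^sup>+x. ennreal (F x) * indicator {a..b} x \<partial>lborel) = ennreal (integral {a..b} F)"
  using assms by (intro nn_integral_has_integral_lebesgue' integrable_integral integrable_continuous_real)

text \<open>The part of a profile between a pole and the equator, with \<open>h\<close> the distance
  of the two. Strict increase is assumed below \<open>h\<close> only, because the derivative
  vanishes at the equator.\<close>

locale half_profile =
  fixes f :: "real \<Rightarrow> real" and h :: real
  assumes f_smooth: "smooth_on f UNIV" and h_pos: "0 < h" and f_0: "f 0 = 0" and f'_0: "deriv f 0 = 1"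
    and f'_pos: "\<And>s. 0 \<le> s \<Longrightarrow> s < h \<Longrightarrow> 0 < deriv f s"
begin

definition half_int :: "(real \<Rightarrow> real) \<Rightarrow> ennreal" where
  "half_int K = (\<integral>\<^sup>+s. ennreal (K (f s)) * indicator {0..h} s \<partial>lborel)"

lemma f_deriv: "(f has_real_derivative deriv f s) (at s)"
  by (rule smooth_on_has_real_derivative[OF f_smooth]) simp

lemma f'_cont: "continuous_on S (deriv f)" and f_cont: "continuous_on S f"
  using smooth_on_continuous[OF smooth_on_deriv[OF open_UNIV f_smooth]] smooth_on_continuous[OF f_smooth]
    continuous_on_subset by blast+

lemma f_strict_mono:
  assumes "0 \<le> a" "a < b" "b \<le> h"
  shows "f a < f b"
  by (rule DERIV_pos_imp_increasing_open[OF assms(2) _ f_cont]) (use f'_pos f_deriv assms in force)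

lemma f_image: "f ` {0<..<h} = {0<..<f h}"
proof
  show "f ` {0<..<h} \<subseteq> {0<..<f h}"
    using f_strict_mono f_0 by force
  show "{0<..<f h} \<subseteq> f ` {0<..<h}"
  proof
    fix u assume u: "u \<in> {0<..<f h}"
    then obtain s where "0 \<le> s" "s \<le> h" "f s = u"
      using IVT'[of f 0 u h] f_cont f_0 h_pos by auto
    moreover have "s \<noteq> 0" "s \<noteq> h"
      using u calculation f_0 by auto
    ultimately show "u \<in> f ` {0<..<h}" by force
  qed
qed

lemma f_inj: "inj_on f {0<..<h}"
  using f_strict_mono by (intro linorder_inj_onI) (auto, metis less_eq_real_def less_irrefl)

text \<open>In this locale \<tau> is the inverse branch of the profile, from values back to
  positions, not the time of an orbit.\<close>

definition \<tau> where "\<tau> = the_inv_into {0<..<h} f"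

lemma \<tau>: "0 < u \<Longrightarrow> u < f h \<Longrightarrow> 0 < \<tau> u" "0 < u \<Longrightarrow> u < f h \<Longrightarrow> \<tau> u < h"
  "0 < u \<Longrightarrow> u < f h \<Longrightarrow> f (\<tau> u) = u"
proof -
  assume "0 < u" "u < f h"
  then have u: "u \<in> f ` {0<..<h}"
    by (simp add: f_image)
  show "0 < \<tau> u" "\<tau> u < h" "f (\<tau> u) = u"
    using the_inv_into_into[OF f_inj u order_refl] f_the_inv_into_f[OF f_inj u] by (auto simp: \<tau>_def)
qed

lemma \<tau>_smooth: "smooth_on \<tau> {0<..<f h}"
  and \<tau>_deriv: "u \<in> {0<..<f h} \<Longrightarrow> (\<tau> has_real_derivative inverse (deriv f (\<tau> u))) (at u)"
proof -
  obtain k where k: "homeomorphism {0<..<h} (f ` {0<..<h}) f k"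
    by (rule invariance_of_domain_homeomorphism[OF _ f_cont _ f_inj]) auto
  have "k u = \<tau> u" if "u \<in> {0<..<f h}" for u
    using k that f_image \<tau> f_inj unfolding homeomorphism_def \<tau>_def
    by (metis the_inv_into_f_f imageE)
  moreover have "continuous_on {0<..<f h} k"
    using k f_image by (auto simp: homeomorphism_def)
  ultimately have "continuous_on {0<..<f h} \<tau>"
    using continuous_on_cong by metis
  note * = smooth_on_inverse_function[OF _ _ smooth_on_subset[OF f_smooth subset_UNIV, of "{0<..<h}"] _ this]
  show "smooth_on \<tau> {0<..<f h}"
    by (rule *(1)) (use \<tau> f'_pos in \<open>auto simp: less_imp_neq[symmetric]\<close>)
  show "u \<in> {0<..<f h} \<Longrightarrow> (\<tau> has_real_derivative inverse (deriv f (\<tau> u))) (at u)"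
    by (rule *(2)) (use \<tau> f'_pos in \<open>auto simp: less_imp_neq[symmetric]\<close>)
qed

text \<open>The density of the push-forward of Lebesgue measure under this branch. It is smooth
  strictly below the maximal value.\<close>

definition dens where "dens u = inverse (deriv f (\<tau> u))"

lemma dens_smooth: "smooth_on dens {0<..<f h}"
proof -
  have "smooth_on (\<lambda>u. deriv f (\<tau> u)) {0<..<f h}"
    by (rule smooth_on_compose[OF _ open_UNIV _ smooth_on_deriv[OF open_UNIV f_smooth] \<tau>_smooth]) auto
  then show ?thesis
    unfolding dens_def using f'_pos \<tau> by (intro smooth_on_inverse) (auto simp: less_imp_le less_imp_neq[symmetric])
qed

lemma dens_pos: "0 < u \<Longrightarrow> u < f h \<Longrightarrow> 0 < dens u"
  unfolding dens_def using f'_pos \<tau> by (simp add: less_imp_le)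

lemma dens_deriv: "u \<in> {0<..<f h} \<Longrightarrow> (dens has_real_derivative deriv dens u) (at u)"
  by (rule smooth_on_has_real_derivative[OF dens_smooth])

lemma dens'_cont: "continuous_on {0<..<f h} (deriv dens)"
  by (rule smooth_on_continuous[OF smooth_on_deriv[OF _ dens_smooth]]) simp

text \<open>\<open>T0\<close> and \<open>T1\<close> are the contributions of the parts \<open>f \<le> c\<close> and \<open>f \<ge> c\<close> of the profile. The
  substitution \<open>f s = \<rho> / cos (l * arccos (\<rho> / c))\<close> removes the singularity of the integrand at the
  turning point.\<close>

definition T0 where
  "T0 c \<rho> = 2 * arccos (\<rho> / c) * integral {0..1} (\<lambda>l. dens (\<rho> / cos (l * arccos (\<rho> / c))))"

definition T1 where
  "T1 c \<rho> = integral {\<tau> c..h} (\<lambda>s. 2 * \<rho> / (f s * sqrt ((f s)\<^sup>2 - \<rho>\<^sup>2)))"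

context
  fixes c :: real
  assumes c: "0 < c" "c < f h"
begin

lemma arccos_bounds:
  assumes "0 < \<rho>" "\<rho> < c"
  shows "0 < arccos (\<rho> / c)" "arccos (\<rho> / c) < pi / 2" "cos (arccos (\<rho> / c)) = \<rho> / c"
proof -
  have b: "-1 < \<rho> / c" "\<rho> / c < 1" "0 < \<rho> / c"
    using assms c by (auto simp: less_divide_eq)
  then show "cos (arccos (\<rho> / c)) = \<rho> / c" by simp
  show "0 < arccos (\<rho> / c)"
    using arccos_lt_bounded[OF b(1,2)] by simp
  show "arccos (\<rho> / c) < pi / 2"
    using arccos_less_arccos[of 0 "\<rho> / c"] b by simp
qed

lemma cos_bounds:
  assumes "0 < \<rho>" "\<rho> < c" "0 \<le> l" "l \<le> 1"
  shows "\<rho> / c \<le> cos (l * arccos (\<rho> / c))" "0 < cos (l * arccos (\<rho> / c))"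
    "\<rho> / cos (l * arccos (\<rho> / c)) \<in> {\<rho>..c}" "\<rho> / cos (l * arccos (\<rho> / c)) \<in> {0<..<f h}"
proof -
  note a = arccos_bounds[OF assms(1,2)]
  have "cos (arccos (\<rho> / c)) \<le> cos (l * arccos (\<rho> / c))"
    using a assms by (intro cos_monotone_0_pi_le) (auto simp: mult_left_le_one_le)
  then show 1: "\<rho> / c \<le> cos (l * arccos (\<rho> / c))"
    using a by simp
  then show 2: "0 < cos (l * arccos (\<rho> / c))"
    using assms c by (smt (verit) divide_pos_pos)
  have "\<rho> / cos (l * arccos (\<rho> / c)) \<le> c"
    using 1 2 c by (simp add: divide_le_eq mult.commute)
  moreover have "\<rho> \<le> \<rho> / cos (l * arccos (\<rho> / c))"
    using 2 assms by (simp add: le_divide_eq mult_left_le)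
  ultimately show "\<rho> / cos (l * arccos (\<rho> / c)) \<in> {\<rho>..c}" "\<rho> / cos (l * arccos (\<rho> / c)) \<in> {0<..<f h}"
    using assms c by auto
qed

lemma f_gt_c:
  assumes "s \<in> {\<tau> c..h}"
  shows "c \<le> f s"
  using f_strict_mono[of "\<tau> c" s] \<tau>[OF c] assms by (cases "s = \<tau> c") auto

lemma dens_comp_cont:
  assumes "0 < \<rho>" "\<rho> < c"
  shows "continuous_on {0..1} (\<lambda>l. dens (\<rho> / cos (l * arccos (\<rho> / c))))"
proof (rule continuous_on_compose2[OF smooth_on_continuous[OF dens_smooth]])
  show "continuous_on {0..1} (\<lambda>l. \<rho> / cos (l * arccos (\<rho> / c)))"
    using cos_bounds(2)[OF assms] by (intro continuous_intros) (auto simp: less_imp_neq[symmetric])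
qed (use cos_bounds(4)[OF assms] in auto)

lemma outer_cont:
  assumes "0 < \<rho>" "\<rho> < c"
  shows "continuous_on {\<tau> c..h} (\<lambda>s. 2 * \<rho> / (f s * sqrt ((f s)\<^sup>2 - \<rho>\<^sup>2)))"
    "\<And>s. s \<in> {\<tau> c..h} \<Longrightarrow> 0 < f s * sqrt ((f s)\<^sup>2 - \<rho>\<^sup>2)"
proof -
  show pos: "0 < f s * sqrt ((f s)\<^sup>2 - \<rho>\<^sup>2)" if "s \<in> {\<tau> c..h}" for s
    using f_gt_c[OF that] assms c by (auto intro!: mult_pos_pos power_strict_mono)
  show "continuous_on {\<tau> c..h} (\<lambda>s. 2 * \<rho> / (f s * sqrt ((f s)\<^sup>2 - \<rho>\<^sup>2)))"
  proof (rule continuous_on_divide)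
    show "\<forall>s\<in>{\<tau> c..h}. f s * sqrt ((f s)\<^sup>2 - \<rho>\<^sup>2) \<noteq> 0"
      using pos by (metis less_irrefl)
  qed (intro continuous_intros f_cont)+
qed

text \<open>With \<open>u =\<close>\<rho>\<open>/ cos (l\<close>\<alpha>\<open>)\<close> the square
  root becomes \<rho> times a tangent, and \<open>kTheta\<close> times \<open>du\<close> reduces to
  2 \<alpha> \<open>dl\<close>: only the density survives. The rescaled angle \<open>l\<close> runs
  over \<open>{0..1}\<close> for every \<rho>, as differentiation under the integral
  requires.\<close>

lemma half_inner:
  assumes \<rho>: "0 < \<rho>" "\<rho> < c"
  shows "(\<integral>\<^sup>+s. ennreal (kTheta \<rho> (f s)) * indicator {0..\<tau> c} s \<partial>lborel) = ennreal (T0 c \<rho>)"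
proof -
  define \<alpha> where "\<alpha> = arccos (\<rho> / c)"
  note a = arccos_bounds[OF \<rho>, folded \<alpha>_def] and cb = cos_bounds[OF \<rho>, folded \<alpha>_def]
  define g where "g l = \<tau> (\<rho> / cos (l * \<alpha>))" for l
  define g' where "g' l = dens (\<rho> / cos (l * \<alpha>)) * (\<rho> * (\<alpha> * sin (l * \<alpha>)) / (cos (l * \<alpha>))\<^sup>2)" for l
  have g01: "g 0 = \<tau> \<rho>" "g 1 = \<tau> c"
    using a(3) \<rho> by (auto simp: g_def)
  have \<rho>h: "\<rho> < f h" using \<rho> c by simp
  have "ennreal (kTheta \<rho> (f s)) * indicator {0..\<tau> c} s = ennreal (kTheta \<rho> (f s)) * indicator {g 0..g 1} s" for s
  proof (cases "s \<in> {0..\<tau> \<rho>}")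
    case True
    then have "f s \<le> \<rho>"
      using f_strict_mono[of s "\<tau> \<rho>"] \<tau>[OF \<rho>(1) \<rho>h] by (cases "s = \<tau> \<rho>") auto
    then show ?thesis by (simp add: kTheta_def)
  next
    case False
    then show ?thesis
      using \<tau>[OF \<rho>(1) \<rho>h] by (auto simp: g01 indicator_def)
  qed
  then have "(\<integral>\<^sup>+s. ennreal (kTheta \<rho> (f s)) * indicator {0..\<tau> c} s \<partial>lborel)
      = (\<integral>\<^sup>+s. ennreal (kTheta \<rho> (f s)) * indicator {g 0..g 1} s \<partial>lborel)"
    by simp
  also have "\<dots> = (\<integral>\<^sup>+l. ennreal (kTheta \<rho> (f (g l)) * g' l) * indicator {0..1} l \<partial>lborel)"
  proof (rule nn_integral_substitution_Icc[where g = g and a = 0 and b = 1 and f = "\<lambda>s. kTheta \<rho> (f s)" and g' = g'])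
    have [measurable]: "f \<in> borel_measurable borel"
      by (rule borel_measurable_continuous_onI[OF f_cont])
    show "set_borel_measurable borel {g 0..g 1} (\<lambda>s. kTheta \<rho> (f s))"
      unfolding set_borel_measurable_def kTheta_def by measurable
    show "(g has_real_derivative g' l) (at l)" if "l \<in> {0..1}" for l
    proof -
      have "((\<lambda>l. \<rho> / cos (l * \<alpha>)) has_real_derivative \<rho> * (\<alpha> * sin (l * \<alpha>)) / (cos (l * \<alpha>))\<^sup>2) (at l)"
        using cb(2)[of l] that by (auto intro!: derivative_eq_intros simp: power2_eq_square)
      from DERIV_chain2[OF \<tau>_deriv[OF cb(4)] this] that show ?thesis
        unfolding g_def g'_def dens_def by auto
    qed
    show "continuous_on {0..1} g'"
      unfolding g'_def \<alpha>_def using cos_bounds(2)[OF \<rho>]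
      by (intro continuous_intros dens_comp_cont \<rho>) (auto simp: less_imp_neq[symmetric])
    show "0 \<le> g' l" if "l \<in> {0..1}" for l
    proof -
      have "l * \<alpha> \<le> 1 * \<alpha>"
        using that a by (intro mult_right_mono) auto
      then have "l * \<alpha> \<le> pi"
        using a by linarith
      then have "0 \<le> sin (l * \<alpha>)"
        using that a by (intro sin_ge_zero) auto
      moreover have "0 < dens (\<rho> / cos (l * \<alpha>))"
        using dens_pos cb(4)[of l] that by auto
      ultimately show ?thesis
        unfolding g'_def using \<rho> a by (intro mult_nonneg_nonneg divide_nonneg_nonneg) auto
    qed
  qed simp
  also have "\<dots> = (\<integral>\<^sup>+l. ennreal (2 * \<alpha> * dens (\<rho> / cos (l * \<alpha>))) * indicator {0..1} l \<partial>lborel)"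
  \<comment> \<open>At \<open>l = 0\<close> the profile equals \<rho>, where the kernel is set to 0;
    this single point is discarded.\<close>
  proof (rule nn_integral_cong_AE)
    have "AE l in lborel. l \<noteq> (0::real)"
      by (rule AE_lborel_singleton)
    then show "AE l in lborel. ennreal (kTheta \<rho> (f (g l)) * g' l) * indicator {0..1} l
        = ennreal (2 * \<alpha> * dens (\<rho> / cos (l * \<alpha>))) * indicator {0..1} l"
    proof eventually_elim
      case (elim l)
      show ?case
      proof (cases "l \<in> {0..1}")
        case True
        then have l: "0 < l" "l \<le> 1" using elim by auto
        define u where "u = \<rho> / cos (l * \<alpha>)"
        have cp: "0 < cos (l * \<alpha>)" using cb(2) l by simp
        have "l * \<alpha> \<le> 1 * \<alpha>"
          using l a by (intro mult_right_mono) auto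
        then have la: "0 < l * \<alpha>" "l * \<alpha> < pi / 2"
          using l a by (simp, linarith)
        have sp: "0 < sin (l * \<alpha>)"
          using la by (intro sin_gt_zero) auto
        have u: "f (g l) = u" "0 < u"
          using \<tau>(3)[of u] cb(4)[of l] l by (auto simp: g_def u_def)
        have "cos (l * \<alpha>) < 1"
          using cos_monotone_0_pi[of 0 "l * \<alpha>"] la by simp
        then have "\<rho> < u"
          using \<rho> cp by (simp add: u_def less_divide_eq)
        have "u\<^sup>2 - \<rho>\<^sup>2 = (\<rho> * sin (l * \<alpha>) / cos (l * \<alpha>))\<^sup>2"
          using cp by (simp add: u_def power_divide power_mult_distrib sin_squared_eq field_simps)
        then have sq: "sqrt (u\<^sup>2 - \<rho>\<^sup>2) = \<rho> * sin (l * \<alpha>) / cos (l * \<alpha>)"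
          using \<rho> cp sp by simp
        have "kTheta \<rho> (f (g l)) * g' l = 2 * \<alpha> * dens u"
          unfolding u kTheta_def sq g'_def using \<open>\<rho> < u\<close> cp sp \<rho>
          by (simp add: u_def[symmetric] power2_eq_square) (simp add: u_def field_simps)
        then show ?thesis by (simp add: u_def)
      qed simp
    qed
  qed
  also have "\<dots> = ennreal (integral {0..1} (\<lambda>l. 2 * \<alpha> * dens (\<rho> / cos (l * \<alpha>))))"
    using dens_comp_cont[OF \<rho>] a dens_pos cb(4)
    by (intro nn_integral_eq_integral continuous_intros) (auto simp: \<alpha>_def less_imp_le)
  also have "integral {0..1} (\<lambda>l. 2 * \<alpha> * dens (\<rho> / cos (l * \<alpha>))) = T0 c \<rho>"
    by (simp add: T0_def \<alpha>_def)
  finally show ?thesis .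
qed

lemma half_outer:
  assumes \<rho>: "0 < \<rho>" "\<rho> < c"
  shows "(\<integral>\<^sup>+s. ennreal (kTheta \<rho> (f s)) * indicator {\<tau> c..h} s \<partial>lborel) = ennreal (T1 c \<rho>)"
proof -
  have "ennreal (kTheta \<rho> (f s)) * indicator {\<tau> c..h} s
      = ennreal (2 * \<rho> / (f s * sqrt ((f s)\<^sup>2 - \<rho>\<^sup>2))) * indicator {\<tau> c..h} s" for s
    using f_gt_c[of s] \<rho> by (auto simp: kTheta_def indicator_def)
  then have "(\<integral>\<^sup>+s. ennreal (kTheta \<rho> (f s)) * indicator {\<tau> c..h} s \<partial>lborel)
      = (\<integral>\<^sup>+s. ennreal (2 * \<rho> / (f s * sqrt ((f s)\<^sup>2 - \<rho>\<^sup>2))) * indicator {\<tau> c..h} s \<partial>lborel)"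
    by simp
  also have "\<dots> = ennreal (T1 c \<rho>)"
    unfolding T1_def
    by (rule nn_integral_eq_integral[OF outer_cont(1)[OF \<rho>]])
      (use outer_cont(2)[OF \<rho>] \<rho> in \<open>auto intro!: divide_nonneg_nonneg less_imp_le\<close>)
  finally show ?thesis .
qed

lemma T_nonneg:
  assumes \<rho>: "0 < \<rho>" "\<rho> < c"
  shows "0 \<le> T0 c \<rho>" "0 \<le> T1 c \<rho>"
proof -
  show "0 \<le> T0 c \<rho>"
    unfolding T0_def using arccos_bounds[OF \<rho>] dens_pos cos_bounds(4)[OF \<rho>]
    by (intro mult_nonneg_nonneg integral_nonneg integrable_continuous_real dens_comp_cont \<rho>)
      (auto simp: less_imp_le)
  show "0 \<le> T1 c \<rho>"
    unfolding T1_def using outer_cont[OF \<rho>] \<rho>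
    by (intro integral_nonneg integrable_continuous_real) (auto intro!: divide_nonneg_nonneg less_imp_le)
qed

lemma half_int_kTheta:
  assumes \<rho>: "0 < \<rho>" "\<rho> < c"
  shows "half_int (kTheta \<rho>) = ennreal (T0 c \<rho> + T1 c \<rho>)"
proof -
  have [measurable]: "f \<in> borel_measurable borel"
    by (rule borel_measurable_continuous_onI[OF f_cont])
  have [measurable]: "(\<lambda>s. kTheta \<rho> (f s)) \<in> borel_measurable borel"
    unfolding kTheta_def by measurable
  have "half_int (kTheta \<rho>) = (\<integral>\<^sup>+s. ennreal (kTheta \<rho> (f s)) * indicator {0..\<tau> c} s
      + ennreal (kTheta \<rho> (f s)) * indicator {\<tau> c..h} s \<partial>lborel)"
    unfolding half_int_def
  proof (rule nn_integral_cong_AE)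
    show "AE s in lborel. ennreal (kTheta \<rho> (f s)) * indicator {0..h} s
        = ennreal (kTheta \<rho> (f s)) * indicator {0..\<tau> c} s + ennreal (kTheta \<rho> (f s)) * indicator {\<tau> c..h} s"
      using AE_lborel_singleton[of "\<tau> c"]
      by eventually_elim (use \<tau>[OF c] in \<open>auto simp: indicator_def\<close>)
  qed
  also have "\<dots> = ennreal (T0 c \<rho>) + ennreal (T1 c \<rho>)"
    by (subst nn_integral_add) (simp_all add: half_inner[OF \<rho>] half_outer[OF \<rho>])
  also have "\<dots> = ennreal (T0 c \<rho> + T1 c \<rho>)"
    using T_nonneg[OF \<rho>] by simp
  finally show ?thesis .
qed

end

end

section \<open>Differentiability of the two contributions and the limit at 0\<close>

context half_profile
begin

context
  fixes c :: real
  assumes c: "0 < c" "c < f h"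
begin

text \<open>Differentiation under the integral over a fixed interval. The argument of the density
  stays between \<rho> and \<open>c\<close>, hence inside the open interval on which the density is
  smooth.\<close>

lemma T0_C1:
  obtains D where "\<And>\<rho>. \<rho> \<in> {0<..<c} \<Longrightarrow> (T0 c has_real_derivative D \<rho>) (at \<rho>)" "continuous_on {0<..<c} D"
proof -
  define \<alpha> where "\<alpha> \<rho> = arccos (\<rho> / c)" for \<rho>
  define \<alpha>' where "\<alpha>' \<rho> = inverse (- sqrt (1 - (\<rho> / c)\<^sup>2)) * (1 / c)" for \<rho>
  have \<alpha>d: "(\<alpha> has_real_derivative \<alpha>' \<rho>) (at \<rho>)" if "\<rho> \<in> {0<..<c}" for \<rho>
  proof -
    have b: "-1 < \<rho> / c" "\<rho> / c < 1"
      using that c by (auto simp: less_divide_eq)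
    have "((\<lambda>\<rho>. \<rho> / c) has_real_derivative 1 / c) (at \<rho>)"
      using c by (auto intro!: derivative_eq_intros)
    from DERIV_chain2[OF DERIV_arccos[OF b] this] show ?thesis
      unfolding \<alpha>_def \<alpha>'_def .
  qed
  have \<alpha>c: "continuous_on {0<..<c} \<alpha>"
    by (rule DERIV_continuous_on[OF has_field_derivative_at_within[OF \<alpha>d]])
  have \<alpha>'c: "continuous_on {0<..<c} \<alpha>'"
  proof -
    have "1 - (\<rho> / c)\<^sup>2 > 0" if "\<rho> \<in> {0<..<c}" for \<rho>
      using that c by (simp add: power_less_one_iff)
    then have "\<forall>\<rho>\<in>{0<..<c}. - sqrt (1 - (\<rho> / c)\<^sup>2) \<noteq> 0"
      by fastforce
    then show ?thesis
      unfolding \<alpha>'_def using c by (intro continuous_intros) auto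
  qed
  define u where "u \<rho> l = \<rho> / cos (l * \<alpha> \<rho>)" for \<rho> l
  define u' where "u' \<rho> l = (cos (l * \<alpha> \<rho>) + \<rho> * (sin (l * \<alpha> \<rho>) * (l * \<alpha>' \<rho>))) / (cos (l * \<alpha> \<rho>))\<^sup>2" for \<rho> l
  note cb = cos_bounds[OF c, folded \<alpha>_def, folded u_def]
  have ud: "((\<lambda>\<rho>. u \<rho> l) has_real_derivative u' \<rho> l) (at \<rho>)" if "\<rho> \<in> {0<..<c}" "l \<in> {0..1}" for \<rho> l
  proof -
    have "cos (l * \<alpha> \<rho>) \<noteq> 0" using cb(2)[of \<rho> l] that by simp
    moreover have "((\<lambda>\<rho>. cos (l * \<alpha> \<rho>)) has_real_derivative - sin (l * \<alpha> \<rho>) * (l * \<alpha>' \<rho>)) (at \<rho>)"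
      using \<alpha>d[OF that(1)] by (auto intro!: derivative_eq_intros)
    ultimately show ?thesis
      unfolding u_def u'_def using DERIV_divide[OF DERIV_ident] by (fastforce simp: power2_eq_square)
  qed
  have comp_fst: "continuous_on ({0<..<c} \<times> {0..1}) (\<lambda>p. k (fst p))" if "continuous_on {0<..<c} k" for k :: "real \<Rightarrow> real"
    by (rule continuous_on_compose2[OF that]) (auto intro!: continuous_intros)
  have cnz: "\<forall>p\<in>{0<..<c} \<times> {0..1}. cos (snd p * \<alpha> (fst p)) \<noteq> 0"
    using cb(2) by (auto simp: less_imp_neq[symmetric])
  have uc: "continuous_on ({0<..<c} \<times> {0..1}) (\<lambda>p. u (fst p) (snd p))"
    unfolding u_def using cnz by (intro continuous_intros comp_fst \<alpha>c) auto
  have u'c: "continuous_on ({0<..<c} \<times> {0..1}) (\<lambda>p. u' (fst p) (snd p))"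
    unfolding u'_def using cnz by (intro continuous_intros comp_fst \<alpha>c \<alpha>'c) auto
  define Fx where "Fx \<rho> l = deriv dens (u \<rho> l) * u' \<rho> l" for \<rho> l
  have "continuous_on ({0<..<c} \<times> {0..1}) (\<lambda>p. deriv dens (u (fst p) (snd p)))"
    by (rule continuous_on_compose2[OF dens'_cont uc]) (use cb(4) in auto)
  then have Fxc: "continuous_on ({0<..<c} \<times> cbox 0 1) (\<lambda>(\<rho>, l). Fx \<rho> l)"
    unfolding Fx_def case_prod_unfold cbox_interval by (intro continuous_intros u'c)
  have L: "((\<lambda>\<rho>. integral (cbox 0 1) (\<lambda>l. dens (u \<rho> l))) has_real_derivative integral (cbox 0 1) (Fx \<rho>)) (at \<rho> within {0<..<c})"
    if "\<rho> \<in> {0<..<c}" for \<rho>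
  proof (rule leibniz_rule_field_derivative[OF _ _ Fxc that])
    show "((\<lambda>\<rho>. dens (u \<rho> l)) has_real_derivative Fx \<rho> l) (at \<rho> within {0<..<c})"
      if "\<rho> \<in> {0<..<c}" "l \<in> cbox 0 1" for \<rho> l
      unfolding Fx_def
      by (rule has_field_derivative_at_within[OF DERIV_chain2[OF dens_deriv ud]]) (use that cb(4) in auto)
    show "(\<lambda>l. dens (u \<rho> l)) integrable_on cbox 0 1" if "\<rho> \<in> {0<..<c}" for \<rho>
      using integrable_continuous_real[OF dens_comp_cont[OF c]] that unfolding u_def \<alpha>_def by simp
  qed simp
  have I: "((\<lambda>\<rho>. integral {0..1} (\<lambda>l. dens (u \<rho> l))) has_real_derivative integral {0..1} (Fx \<rho>)) (at \<rho>)"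
    if "\<rho> \<in> {0<..<c}" for \<rho>
    using L[OF that] at_within_open[OF that open_greaterThanLessThan] by simp
  have T0: "T0 c = (\<lambda>\<rho>. 2 * \<alpha> \<rho> * integral {0..1} (\<lambda>l. dens (u \<rho> l)))"
    by (auto simp: T0_def u_def \<alpha>_def)
  show ?thesis
  proof (rule that)
    show "(T0 c has_real_derivative 2 * \<alpha>' \<rho> * integral {0..1} (\<lambda>l. dens (u \<rho> l)) + 2 * \<alpha> \<rho> * integral {0..1} (Fx \<rho>)) (at \<rho>)"
      if "\<rho> \<in> {0<..<c}" for \<rho>
      unfolding T0 using I[OF that] \<alpha>d[OF that] by (auto intro!: derivative_eq_intros)
    have "continuous_on {0<..<c} (\<lambda>\<rho>. integral {0..1} (\<lambda>l. dens (u \<rho> l)))"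
      by (rule DERIV_continuous_on[OF has_field_derivative_at_within[OF I]])
    moreover have "continuous_on {0<..<c} (\<lambda>\<rho>. integral {0..1} (Fx \<rho>))"
      using integral_continuous_on_param[OF Fxc] by simp
    ultimately show "continuous_on {0<..<c} (\<lambda>\<rho>. 2 * \<alpha>' \<rho> * integral {0..1} (\<lambda>l. dens (u \<rho> l)) + 2 * \<alpha> \<rho> * integral {0..1} (Fx \<rho>))"
      by (intro continuous_intros \<alpha>c \<alpha>'c)
  qed
qed

text \<open>Above the cut the profile is at least \<open>c\<close>, so for \<rho> < \<open>c\<close>
  the kernel is differentiable in \<rho> up to and including the maximum of the profile. No inverse
  branch enters here, and the critical point does no harm.\<close>

lemma T1_C1:
  obtains D where "\<And>\<rho>. \<rho> \<in> {0<..<c} \<Longrightarrow> (T1 c has_real_derivative D \<rho>) (at \<rho>)" "continuous_on {0<..<c} D"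
proof -
  define q where "q \<rho> s = sqrt ((f s)\<^sup>2 - \<rho>\<^sup>2)" for \<rho> s
  define Fx where "Fx \<rho> s = 2 / (f s * q \<rho> s) + 2 * \<rho>\<^sup>2 / (f s * (q \<rho> s) ^ 3)" for \<rho> s
  have pos: "0 < f s" "0 < (f s)\<^sup>2 - \<rho>\<^sup>2" "0 < q \<rho> s" if "\<rho> \<in> {0<..<c}" "s \<in> {\<tau> c..h}" for \<rho> s
  proof -
    show "0 < f s" using f_gt_c[OF c that(2)] c by simp
    show "0 < (f s)\<^sup>2 - \<rho>\<^sup>2"
      using f_gt_c[OF c that(2)] that(1) by (simp add: power_strict_mono)
    then show "0 < q \<rho> s" by (simp add: q_def)
  qed
  have qc: "continuous_on ({0<..<c} \<times> {\<tau> c..h}) (\<lambda>p. q (fst p) (snd p))"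
    unfolding q_def by (intro continuous_intros continuous_on_compose2[OF f_cont]) auto
  have fc: "continuous_on ({0<..<c} \<times> {\<tau> c..h}) (\<lambda>p. f (snd p))"
    by (intro continuous_on_compose2[OF f_cont[of UNIV]] continuous_intros) auto
  have Fxc: "continuous_on ({0<..<c} \<times> cbox (\<tau> c) h) (\<lambda>(\<rho>, s). Fx \<rho> s)"
    unfolding Fx_def case_prod_unfold cbox_interval using pos
    by (intro continuous_intros qc fc) (auto simp: less_imp_neq[symmetric])
  have L: "((\<lambda>\<rho>. integral (cbox (\<tau> c) h) (\<lambda>s. 2 * \<rho> / (f s * sqrt ((f s)\<^sup>2 - \<rho>\<^sup>2)))) has_real_derivative
      integral (cbox (\<tau> c) h) (Fx \<rho>)) (at \<rho> within {0<..<c})" if "\<rho> \<in> {0<..<c}" for \<rho>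
  proof (rule leibniz_rule_field_derivative[OF _ _ Fxc that])
    show "((\<lambda>\<rho>. 2 * \<rho> / (f s * sqrt ((f s)\<^sup>2 - \<rho>\<^sup>2))) has_real_derivative Fx \<rho> s) (at \<rho> within {0<..<c})"
      if "\<rho> \<in> {0<..<c}" "s \<in> cbox (\<tau> c) h" for \<rho> s
    proof (rule has_field_derivative_at_within)
      note p = pos[of \<rho> s] that
      have "((\<lambda>\<rho>. (f s)\<^sup>2 - \<rho>\<^sup>2) has_real_derivative - (2 * \<rho>)) (at \<rho>)"
        by (auto intro!: derivative_eq_intros)
      from DERIV_chain2[OF DERIV_real_sqrt this] p
      have dS: "((\<lambda>\<rho>. sqrt ((f s)\<^sup>2 - \<rho>\<^sup>2)) has_real_derivative - (\<rho> / q \<rho> s)) (at \<rho>)"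
        by (simp add: q_def field_simps)
      have "0 < f s * sqrt ((f s)\<^sup>2 - \<rho>\<^sup>2)"
        using p unfolding q_def by (intro mult_pos_pos) auto
      then have nz: "f s * sqrt ((f s)\<^sup>2 - \<rho>\<^sup>2) \<noteq> 0"
        by (metis less_irrefl)
      from DERIV_divide[OF DERIV_cmult[OF DERIV_ident, of 2] DERIV_cmult[OF dS, of "f s"] nz]
      have "((\<lambda>\<rho>. 2 * \<rho> / (f s * sqrt ((f s)\<^sup>2 - \<rho>\<^sup>2))) has_real_derivative
          (2 * (f s * q \<rho> s) + 2 * \<rho> * (f s * (\<rho> / q \<rho> s))) / (f s * q \<rho> s * (f s * q \<rho> s))) (at \<rho>)"
        by (simp add: q_def)
      moreover have "(2 * (f s * q \<rho> s) + 2 * \<rho> * (f s * (\<rho> / q \<rho> s))) / (f s * q \<rho> s * (f s * q \<rho> s)) = Fx \<rho> s"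
        unfolding Fx_def using p by (simp add: field_simps power2_eq_square power3_eq_cube)
      ultimately show "((\<lambda>\<rho>. 2 * \<rho> / (f s * sqrt ((f s)\<^sup>2 - \<rho>\<^sup>2))) has_real_derivative Fx \<rho> s) (at \<rho>)"
        by simp
    qed
    show "(\<lambda>s. 2 * \<rho> / (f s * sqrt ((f s)\<^sup>2 - \<rho>\<^sup>2))) integrable_on cbox (\<tau> c) h" if "\<rho> \<in> {0<..<c}" for \<rho>
      using integrable_continuous_real[OF outer_cont(1)[OF c, of \<rho>]] that by simp
  qed simp
  have "(T1 c has_real_derivative integral {\<tau> c..h} (Fx \<rho>)) (at \<rho>)" if "\<rho> \<in> {0<..<c}" for \<rho>
    using L[OF that] at_within_open[OF that open_greaterThanLessThan] by (simp add: T1_def[abs_def])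
  moreover have "continuous_on {0<..<c} (\<lambda>\<rho>. integral {\<tau> c..h} (Fx \<rho>))"
    using integral_continuous_on_param[OF Fxc] by simp
  ultimately show ?thesis by (rule that)
qed

end

definition half_Theta where "half_Theta \<rho> = enn2real (half_int (kTheta \<rho>))"

lemma half_Theta:
  assumes "0 < \<rho>" "\<rho> < f h"
  shows "half_int (kTheta \<rho>) = ennreal (half_Theta \<rho>)" "0 \<le> half_Theta \<rho>"
proof -
  define c where "c = (\<rho> + f h) / 2"
  have c: "0 < c" "c < f h" "\<rho> < c" using assms by (auto simp: c_def)
  show "half_int (kTheta \<rho>) = ennreal (half_Theta \<rho>)"
    unfolding half_Theta_def by (simp add: half_int_kTheta[OF c(1,2) assms(1) c(3)] T_nonneg[OF c(1,2) assms(1) c(3)])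
  show "0 \<le> half_Theta \<rho>" by (simp add: half_Theta_def)
qed

lemma half_Theta_eq:
  assumes "0 < c" "c < f h" "0 < \<rho>" "\<rho> < c"
  shows "half_Theta \<rho> = T0 c \<rho> + T1 c \<rho>"
  unfolding half_Theta_def using half_int_kTheta[OF assms] T_nonneg[OF assms] by (simp del: ennreal_plus)

lemma half_Theta_C1:
  assumes "0 < c" "c < f h"
  obtains D where "\<And>\<rho>. \<rho> \<in> {0<..<c} \<Longrightarrow> (half_Theta has_real_derivative D \<rho>) (at \<rho>)" "continuous_on {0<..<c} D"
proof -
  obtain D0 where D0: "\<And>\<rho>. \<rho> \<in> {0<..<c} \<Longrightarrow> (T0 c has_real_derivative D0 \<rho>) (at \<rho>)" "continuous_on {0<..<c} D0"
    using T0_C1[OF assms] by blast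
  obtain D1 where D1: "\<And>\<rho>. \<rho> \<in> {0<..<c} \<Longrightarrow> (T1 c has_real_derivative D1 \<rho>) (at \<rho>)" "continuous_on {0<..<c} D1"
    using T1_C1[OF assms] by blast
  have H: "(half_Theta has_real_derivative D0 \<rho> + D1 \<rho>) (at \<rho>)" if "\<rho> \<in> {0<..<c}" for \<rho>
    by (rule has_field_derivative_transform_within_open[OF DERIV_add[OF D0(1) D1(1)], of _ "{0<..<c}"])
      (use that half_Theta_eq[OF assms] in auto)
  show ?thesis
    by (rule that[OF H], assumption) (intro continuous_intros D0 D1)
qed

lemma dens_near_0:
  assumes "0 < e"
  obtains c where "0 < c" "c < f h" "\<And>u. 0 < u \<Longrightarrow> u \<le> c \<Longrightarrow> \<bar>dens u - 1\<bar> \<le> e"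
proof -
  have "isCont (deriv f) 0"
    using f'_cont[of UNIV] by (simp add: continuous_on_eq_continuous_at)
  then have "((\<lambda>s. inverse (deriv f s)) \<longlongrightarrow> inverse 1) (at 0)"
    using f'_0 by (intro tendsto_inverse) (auto simp: isCont_def)
  then have "\<forall>\<^sub>F s in at 0. dist (inverse (deriv f s)) (inverse 1) < e"
    using assms by (rule tendstoD)
  then obtain d where d: "0 < d" "\<And>s. s \<noteq> 0 \<Longrightarrow> dist s 0 < d \<Longrightarrow> dist (inverse (deriv f s)) (inverse 1) < e"
    unfolding eventually_at by auto
  define s where "s = min (d / 2) (h / 2)"
  have s: "0 < s" "s < d" "s < h"
    using d h_pos by (auto simp: s_def)
  have fs: "0 < f s" "f s < f h"
    using f_strict_mono[of 0 s] f_strict_mono[of s h] s f_0 by auto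
  have "\<bar>dens u - 1\<bar> \<le> e" if "0 < u" "u \<le> f s" for u
  proof -
    have u: "u < f h" using that fs by simp
    have "\<tau> u \<le> s"
    proof (rule ccontr)
      assume "\<not> \<tau> u \<le> s"
      then have "f s < f (\<tau> u)"
        using f_strict_mono[of s "\<tau> u"] s \<tau>[OF that(1) u] by auto
      then show False
        using \<tau>(3)[OF that(1) u] that by simp
    qed
    then show ?thesis
      using d(2)[of "\<tau> u"] \<tau>(1)[OF that(1) u] s by (simp add: dens_def dist_real_def)
  qed
  then show ?thesis using that fs by blast
qed

text \<open>Choose \<open>c\<close> so small that the density is nearly 1 below it. Then
  \<open>T0\<close> is nearly \<open>2 arccos (\<close>\<rho>\<open>/ c)\<close>, which tends to pi,
  while for this fixed \<open>c\<close> the outer part \<open>T1\<close> is at most a constant times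
  \<rho>, for small \<rho>.\<close>

lemma half_Theta_limit: "(half_Theta \<longlongrightarrow> pi) (at_right 0)"
proof (rule tendstoI)
  fix e :: real assume e: "0 < e"
  \<comment> \<open>The prefactor of the integral in \<open>T0\<close> is below pi, so this
    tolerance costs at most \<open>e / 2\<close>.\<close>
  obtain c where c: "0 < c" "c < f h" and dens: "\<And>u. 0 < u \<Longrightarrow> u \<le> c \<Longrightarrow> \<bar>dens u - 1\<bar> \<le> e / (2 * pi)"
    using dens_near_0[of "e / (2 * pi)"] e by auto
  \<comment> \<open>The error that depends on \<rho>: deviation of the prefactor from pi plus a
    bound for \<open>T1\<close>.\<close>
  define B where "B \<rho> = \<bar>2 * arccos (\<rho> / c) - pi\<bar> + 2 * \<rho> / (c * sqrt (c\<^sup>2 - \<rho>\<^sup>2)) * h" for \<rho>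
  have bound: "\<bar>half_Theta \<rho> - pi\<bar> \<le> e / 2 + B \<rho>" if \<rho>: "0 < \<rho>" "\<rho> < c" for \<rho>
  proof -
    define I where "I = integral {0..1} (\<lambda>l. dens (\<rho> / cos (l * arccos (\<rho> / c))))"
    have "((\<lambda>l. dens (\<rho> / cos (l * arccos (\<rho> / c))) - 1) has_integral I - 1) {0..1}"
      unfolding I_def
      using has_integral_diff[OF integrable_integral[OF integrable_continuous_real[OF dens_comp_cont[OF c \<rho>]]]
          has_integral_const_real[of 1 0 1]] by simp
    then have "norm (I - 1) \<le> e / (2 * pi) * measure lborel {0..1::real}"
    proof (rule has_integral_bound_real[rotated 2])
      show "0 \<le> e / (2 * pi)" using e by simp
      show "norm (dens (\<rho> / cos (l * arccos (\<rho> / c))) - 1) \<le> e / (2 * pi)" if "l \<in> {0..1} - {}" for l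
        using dens[of "\<rho> / cos (l * arccos (\<rho> / c))"] cos_bounds(3,4)[OF c \<rho>, of l] that by auto
    qed simp
    then have I: "\<bar>I - 1\<bar> \<le> e / (2 * pi)" by simp
    note a = arccos_bounds[OF c \<rho>]
    have "\<bar>T0 c \<rho> - 2 * arccos (\<rho> / c)\<bar> = 2 * arccos (\<rho> / c) * \<bar>I - 1\<bar>"
    proof -
      have "T0 c \<rho> - 2 * arccos (\<rho> / c) = 2 * arccos (\<rho> / c) * (I - 1)"
        by (simp add: T0_def I_def algebra_simps)
      then show ?thesis using a by (simp add: abs_mult)
    qed
    also have "\<dots> \<le> pi * (e / (2 * pi))"
      using a I by (intro mult_mono) auto
    finally have t0: "\<bar>T0 c \<rho> - 2 * arccos (\<rho> / c)\<bar> \<le> e / 2" by simp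
    have q: "0 < c\<^sup>2 - \<rho>\<^sup>2"
      using \<rho> by (simp add: power_strict_mono)
    have "T1 c \<rho> \<le> integral {\<tau> c..h} (\<lambda>s. 2 * \<rho> / (c * sqrt (c\<^sup>2 - \<rho>\<^sup>2)))"
      unfolding T1_def
    proof (rule integral_le)
      fix s assume s: "s \<in> {\<tau> c..h}"
      then have "c \<le> f s" by (rule f_gt_c[OF c])
      moreover have "sqrt (c\<^sup>2 - \<rho>\<^sup>2) \<le> sqrt ((f s)\<^sup>2 - \<rho>\<^sup>2)"
        using \<open>c \<le> f s\<close> c by (intro real_sqrt_le_mono diff_right_mono power_mono) auto
      ultimately have "c * sqrt (c\<^sup>2 - \<rho>\<^sup>2) \<le> f s * sqrt ((f s)\<^sup>2 - \<rho>\<^sup>2)"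
        using c q by (intro mult_mono) auto
      then show "2 * \<rho> / (f s * sqrt ((f s)\<^sup>2 - \<rho>\<^sup>2)) \<le> 2 * \<rho> / (c * sqrt (c\<^sup>2 - \<rho>\<^sup>2))"
        using c q \<rho> outer_cont(2)[OF c \<rho> s] by (intro divide_left_mono mult_pos_pos[OF outer_cont(2)[OF c \<rho> s]]) auto
    qed (use outer_cont[OF c \<rho>] in \<open>auto intro!: integrable_continuous_real\<close>)
    also have "\<dots> = 2 * \<rho> / (c * sqrt (c\<^sup>2 - \<rho>\<^sup>2)) * (h - \<tau> c)"
      using \<tau>(2)[OF c] by simp
    also have "\<dots> \<le> 2 * \<rho> / (c * sqrt (c\<^sup>2 - \<rho>\<^sup>2)) * h"
      using \<tau>(1)[OF c] c q \<rho> by (intro mult_left_mono) auto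
    finally have "T1 c \<rho> \<le> 2 * \<rho> / (c * sqrt (c\<^sup>2 - \<rho>\<^sup>2)) * h" .
    then show ?thesis
      using t0 T_nonneg(2)[OF c \<rho>] unfolding half_Theta_eq[OF c \<rho>] B_def by linarith
  qed
  have "((\<lambda>\<rho>. arccos (\<rho> / c)) \<longlongrightarrow> arccos (0 / c)) (at_right 0)"
    using c by (intro isCont_tendsto_compose[where g = arccos] isCont_arccos tendsto_intros) auto
  then have "(B \<longlongrightarrow> \<bar>2 * arccos (0 / c) - pi\<bar> + 2 * 0 / (c * sqrt (c\<^sup>2 - 0\<^sup>2)) * h) (at_right 0)"
    unfolding B_def using c by (intro tendsto_intros) auto
  then have "(B \<longlongrightarrow> 0) (at_right 0)" by simp
  then have "\<forall>\<^sub>F \<rho> in at_right 0. dist (B \<rho>) 0 < e / 2"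
    using e by (intro tendstoD) auto
  moreover have "\<forall>\<^sub>F \<rho> in at_right 0. \<rho> \<in> {0<..<c}"
    using c by (intro eventually_at_right_less[THEN eventually_mono] eventually_at_rightI[of 0 c]) auto
  ultimately show "\<forall>\<^sub>F \<rho> in at_right 0. dist (half_Theta \<rho>) pi < e"
    by eventually_elim (use bound in \<open>fastforce simp: dist_real_def\<close>)
qed

end

section \<open>Both halves of the profile together\<close>

context profile
begin

sublocale left: half_profile f s0
  by unfold_locales (use f_smooth s0 f_0 f'_0 f'_pos in auto)

lemma deriv_reflect: "deriv (\<lambda>s. f (m - s)) s = - deriv f (m - s)"
proof (rule DERIV_imp_deriv)
  have "((\<lambda>s. m - s) has_real_derivative -1) (at s)"
    by (auto intro!: derivative_eq_intros)
  from DERIV_chain2[where f = f and g = "\<lambda>s. m - s", OF f_deriv this]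
  show "((\<lambda>s. f (m - s)) has_real_derivative - deriv f (m - s)) (at s)" by simp
qed

sublocale right: half_profile "\<lambda>s. f (m - s)" "m - s0"
proof unfold_locales
  show "smooth_on (\<lambda>s. f (m - s)) UNIV"
    by (rule smooth_on_compose[OF open_UNIV open_UNIV _ f_smooth])
      (auto intro!: smooth_on_diff smooth_on_const smooth_on_ident)
qed (use s0 f_m f'_m f'_neg in \<open>auto simp: deriv_reflect\<close>)

lemma prof_int_split:
  assumes [measurable]: "K \<in> borel_measurable borel"
  shows "prof_int m f K = left.half_int K + right.half_int K"
proof -
  have [measurable]: "f \<in> borel_measurable borel"
    by (rule borel_measurable_continuous_onI[OF f_cont])
  have "prof_int m f K = (\<integral>\<^sup>+s. ennreal (K (f s)) * indicator {0..s0} s + ennreal (K (f s)) * indicator {s0..m} s \<partial>lborel)"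
    unfolding prof_int_def
  proof (rule nn_integral_cong_AE)
    show "AE s in lborel. ennreal (K (f s)) * indicator {0..m} s
        = ennreal (K (f s)) * indicator {0..s0} s + ennreal (K (f s)) * indicator {s0..m} s"
      using AE_lborel_singleton[of s0] by eventually_elim (use s0 in \<open>auto simp: indicator_def\<close>)
  qed
  also have "\<dots> = left.half_int K + (\<integral>\<^sup>+s. ennreal (K (f s)) * indicator {s0..m} s \<partial>lborel)"
    unfolding left.half_int_def by (rule nn_integral_add) measurable
  also have "(\<integral>\<^sup>+s. ennreal (K (f s)) * indicator {s0..m} s \<partial>lborel)
      = ennreal \<bar>-1\<bar> * (\<integral>\<^sup>+s. ennreal (K (f (m + -1 * s))) * indicator {s0..m} (m + -1 * s) \<partial>lborel)"
    by (rule nn_integral_real_affine) auto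
  also have "\<dots> = right.half_int K"
    unfolding right.half_int_def by (auto intro!: nn_integral_cong simp: indicator_def)
  finally show ?thesis .
qed

lemma kTheta_measurable: "kTheta \<rho> \<in> borel_measurable borel"
  unfolding kTheta_def by measurable

lemma Theta_split:
  assumes "0 < \<rho>" "\<rho> < R"
  shows "prof_int m f (kTheta \<rho>) = ennreal (Theta m f \<rho>)" "Theta m f \<rho> = left.half_Theta \<rho> + right.half_Theta \<rho>"
proof -
  have "prof_int m f (kTheta \<rho>) = ennreal (left.half_Theta \<rho> + right.half_Theta \<rho>)"
    using prof_int_split[OF kTheta_measurable] left.half_Theta right.half_Theta assms by (simp add: R_def)
  moreover have "0 \<le> left.half_Theta \<rho> + right.half_Theta \<rho>"
    using left.half_Theta(2) right.half_Theta(2) assms by (simp add: R_def)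
  ultimately show "prof_int m f (kTheta \<rho>) = ennreal (Theta m f \<rho>)" "Theta m f \<rho> = left.half_Theta \<rho> + right.half_Theta \<rho>"
    by (auto simp: Theta_def)
qed

text \<open>The two halves give the derivative only below a cut \<open>c < R\<close>. Every \<rho>
  lies below some cut, and the pieces fit together because each represents the derivative of the
  same function.\<close>

lemma Theta_C1:
  shows "\<rho> \<in> {0<..<R} \<Longrightarrow> (Theta m f has_real_derivative deriv (Theta m f) \<rho>) (at \<rho>)"
    and "continuous_on {0<..<R} (deriv (Theta m f))"
proof -
  have *: "\<exists>D. (\<forall>\<rho>\<in>{0<..<c}. (Theta m f has_real_derivative D \<rho>) (at \<rho>)) \<and> continuous_on {0<..<c} D"
    if c: "0 < c" "c < R" for c
  proof -
    obtain D0 where D0: "\<And>\<rho>. \<rho> \<in> {0<..<c} \<Longrightarrow> (left.half_Theta has_real_derivative D0 \<rho>) (at \<rho>)" "continuous_on {0<..<c} D0"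
      using left.half_Theta_C1 c by (metis R_def)
    obtain D1 where D1: "\<And>\<rho>. \<rho> \<in> {0<..<c} \<Longrightarrow> (right.half_Theta has_real_derivative D1 \<rho>) (at \<rho>)" "continuous_on {0<..<c} D1"
      using right.half_Theta_C1[of c] c by (auto simp: R_def)
    have "(Theta m f has_real_derivative D0 \<rho> + D1 \<rho>) (at \<rho>)" if "\<rho> \<in> {0<..<c}" for \<rho>
      by (rule has_field_derivative_transform_within_open[OF DERIV_add[OF D0(1) D1(1)], of _ "{0<..<c}"])
        (use that c Theta_split in auto)
    moreover have "continuous_on {0<..<c} (\<lambda>\<rho>. D0 \<rho> + D1 \<rho>)"
      by (intro continuous_intros D0 D1)
    ultimately show ?thesis
      by (intro exI[of _ "\<lambda>\<rho>. D0 \<rho> + D1 \<rho>"]) blast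
  qed
  have loc: "(Theta m f has_real_derivative deriv (Theta m f) \<rho>) (at \<rho>) \<and> isCont (deriv (Theta m f)) \<rho>" if \<rho>: "\<rho> \<in> {0<..<R}" for \<rho>
  proof -
    define c where "c = (\<rho> + R) / 2"
    have c: "0 < c" "c < R" "\<rho> \<in> {0<..<c}" using \<rho> by (auto simp: c_def)
    obtain D where D: "\<forall>\<rho>\<in>{0<..<c}. (Theta m f has_real_derivative D \<rho>) (at \<rho>)" "continuous_on {0<..<c} D"
      using *[OF c(1,2)] by blast
    have eq: "D x = deriv (Theta m f) x" if "x \<in> {0<..<c}" for x
      using D(1) that DERIV_imp_deriv by metis
    then have "continuous_on {0<..<c} (deriv (Theta m f))"
      using D(2) continuous_on_cong by metis
    then have "isCont (deriv (Theta m f)) \<rho>"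
      using c(3) by (simp add: continuous_on_eq_continuous_at)
    then show ?thesis
      using D(1) c(3) eq by metis
  qed
  then show "\<rho> \<in> {0<..<R} \<Longrightarrow> (Theta m f has_real_derivative deriv (Theta m f) \<rho>) (at \<rho>)"
    by blast
  show "continuous_on {0<..<R} (deriv (Theta m f))"
    using loc by (auto simp: continuous_on_eq_continuous_at)
qed

lemma Theta_limit: "(Theta m f \<longlongrightarrow> 2 * pi) (at_right 0)"
proof -
  have "((\<lambda>\<rho>. left.half_Theta \<rho> + right.half_Theta \<rho>) \<longlongrightarrow> pi + pi) (at_right 0)"
    by (intro tendsto_add left.half_Theta_limit right.half_Theta_limit)
  moreover have "\<forall>\<^sub>F \<rho> in at_right 0. left.half_Theta \<rho> + right.half_Theta \<rho> = Theta m f \<rho>"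
    using R_pos Theta_split(2) by (intro eventually_at_rightI[of 0 R]) auto
  ultimately show ?thesis
    using Lim_transform_eventually by fastforce
qed

end

section \<open>Abel inversion\<close>

text \<open>For improper integrals: the integrand may blow up at the ends as long as the primitive
  extends continuously.\<close>

lemma nn_integral_FTC_Ioo:
  fixes F k :: "real \<Rightarrow> real"
  assumes "a \<le> b" "continuous_on {a..b} F"
    and "\<And>x. a < x \<Longrightarrow> x < b \<Longrightarrow> (F has_real_derivative k x) (at x)"
    and "\<And>x. a < x \<Longrightarrow> x < b \<Longrightarrow> 0 \<le> k x"
  shows "(\<integral>\<^sup>+x. ennreal (k x) * indicator {a<..<b} x \<partial>lborel) = ennreal (F b - F a)"
proof (rule nn_integral_has_integral_lebesgue')
  have "(k has_integral F b - F a) {a..b}"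
    using assms by (intro fundamental_theorem_of_calculus_interior)
      (auto simp flip: has_real_derivative_iff_has_vector_derivative)
  then show "(k has_integral F b - F a) {a<..<b}"
    by (simp add: has_integral_Icc_iff_Ioo)
qed (use assms in auto)

text \<open>The integral of \<open>kTheta x u\<close> over \<open>x\<close> > \<rho>, and at the
  same time \<open>kEll -\<close>\<rho>\<open>kTheta\<close>. Hence its profile integral is both an
  antiderivative of -\<Theta> and the tangent intercept of the front.\<close>

definition kJ :: "real \<Rightarrow> real \<Rightarrow> real" where
  "kJ \<rho> u = (if \<rho> < u then 2 * sqrt (u\<^sup>2 - \<rho>\<^sup>2) / u else 0)"

text \<open>The kernel left after integrating \<open>kTheta\<close> against the Abel weight
  \<open>1 / sqrt (x^2 - s^2)\<close>; above the threshold it depends on \<open>u\<close>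
  alone.\<close>

definition kB :: "real \<Rightarrow> real \<Rightarrow> real" where
  "kB s u = (if s < u then pi / u else 0)"

lemma kernel_measurable [measurable]:
  "(\<lambda>p. kTheta (fst p) (snd p)) \<in> borel_measurable (borel \<Otimes>\<^sub>M borel)"
  "kTheta \<rho> \<in> borel_measurable borel" "kEll \<rho> \<in> borel_measurable borel"
  "kJ \<rho> \<in> borel_measurable borel" "kB \<rho> \<in> borel_measurable borel"
  unfolding kTheta_def kEll_def kJ_def kB_def by measurable

lemma nn_integral_kTheta:
  assumes "0 < \<rho>"
  shows "(\<integral>\<^sup>+x. ennreal (kTheta x u * indicator {\<rho><..} x) \<partial>lborel) = ennreal (kJ \<rho> u)"
proof (cases "\<rho> < u")
  case True
  have "(\<integral>\<^sup>+x. ennreal (kTheta x u * indicator {\<rho><..} x) \<partial>lborel)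
      = (\<integral>\<^sup>+x. ennreal (2 * x / (u * sqrt (u\<^sup>2 - x\<^sup>2))) * indicator {\<rho><..<u} x \<partial>lborel)"
    by (intro nn_integral_cong) (auto simp: kTheta_def indicator_def)
  also have "\<dots> = ennreal (- (2 * sqrt (u\<^sup>2 - u\<^sup>2) / u) - - (2 * sqrt (u\<^sup>2 - \<rho>\<^sup>2) / u))"
  proof (rule nn_integral_FTC_Ioo[where F = "\<lambda>x. - (2 * sqrt (u\<^sup>2 - x\<^sup>2) / u)"])
    show "continuous_on {\<rho>..u} (\<lambda>x. - (2 * sqrt (u\<^sup>2 - x\<^sup>2) / u))"
      using True assms by (intro continuous_intros) auto
    fix x assume x: "\<rho> < x" "x < u"
    then have q: "0 < u\<^sup>2 - x\<^sup>2"
      using assms by (simp add: power_strict_mono)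
    have "((\<lambda>x. u\<^sup>2 - x\<^sup>2) has_real_derivative - (2 * x)) (at x)"
      by (auto intro!: derivative_eq_intros)
    from DERIV_minus[OF DERIV_cmult[OF DERIV_chain2[OF DERIV_real_sqrt[OF q] this], of "2 / u"]]
    show "((\<lambda>x. - (2 * sqrt (u\<^sup>2 - x\<^sup>2) / u)) has_real_derivative 2 * x / (u * sqrt (u\<^sup>2 - x\<^sup>2))) (at x)"
      using q x by (simp add: field_simps)
    show "0 \<le> 2 * x / (u * sqrt (u\<^sup>2 - x\<^sup>2))"
      using q x assms by simp
  qed (use True in simp)
  finally show ?thesis
    using True by (simp add: kJ_def)
next
  case False
  then have "(\<lambda>x. kTheta x u * indicator {\<rho><..} x) = (\<lambda>x. 0)"
    by (auto simp: kTheta_def indicator_def)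
  then have eq: "(\<lambda>x. ennreal (kTheta x u * indicator {\<rho><..} x)) = (\<lambda>x. 0)"
    by (metis ennreal_0)
  then show ?thesis
    using False unfolding eq by (simp add: kJ_def)
qed

lemma nn_integral_kTheta_Abel:
  assumes "0 < s"
  shows "(\<integral>\<^sup>+x. ennreal (kTheta x u * (indicator {s<..} x / sqrt (x\<^sup>2 - s\<^sup>2))) \<partial>lborel) = ennreal (kB s u)"
proof (cases "s < u")
  case True
  \<comment> \<open>Affine in \<open>x^2\<close>, sending \<open>s\<close> to -1 and
    \<open>u\<close> to 1. The integrand has the primitive \<open>arcsin (w x) / u\<close>, whence
    the total pi / \<open>u\<close>.\<close>
  define w where "w x = (2 * x\<^sup>2 - u\<^sup>2 - s\<^sup>2) / (u\<^sup>2 - s\<^sup>2)" for x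
  have us: "0 < u\<^sup>2 - s\<^sup>2" "0 < u"
    using True assms by (auto simp: power_strict_mono)
  have "(\<integral>\<^sup>+x. ennreal (kTheta x u * (indicator {s<..} x / sqrt (x\<^sup>2 - s\<^sup>2))) \<partial>lborel)
      = (\<integral>\<^sup>+x. ennreal (2 * x / (u * sqrt (u\<^sup>2 - x\<^sup>2)) / sqrt (x\<^sup>2 - s\<^sup>2)) * indicator {s<..<u} x \<partial>lborel)"
    by (intro nn_integral_cong) (auto simp: kTheta_def indicator_def)
  also have "\<dots> = ennreal (arcsin (w u) / u - arcsin (w s) / u)"
  proof (rule nn_integral_FTC_Ioo[where F = "\<lambda>x. arcsin (w x) / u"])
    have wb: "-1 \<le> w x \<and> w x \<le> 1" if "x \<in> {s..u}" for x
    proof -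
      have "s\<^sup>2 \<le> x\<^sup>2" "x\<^sup>2 \<le> u\<^sup>2"
        using that assms by (auto intro!: power_mono)
      then show ?thesis
        using us by (simp add: w_def le_divide_eq divide_le_eq)
    qed
    have "continuous_on {s..u} w"
      unfolding w_def using us by (intro continuous_intros) auto
    then show "continuous_on {s..u} (\<lambda>x. arcsin (w x) / u)"
      using us wb by (intro continuous_intros) auto
    fix x assume x: "s < x" "x < u"
    then have sq: "s\<^sup>2 < x\<^sup>2" "x\<^sup>2 < u\<^sup>2"
      using assms by (auto intro!: power_strict_mono)
    have w1: "-1 < w x" "w x < 1"
      using sq us by (auto simp: w_def less_divide_eq divide_less_eq)
    have "1 - (w x)\<^sup>2 = 4 * ((u\<^sup>2 - x\<^sup>2) * (x\<^sup>2 - s\<^sup>2)) / (u\<^sup>2 - s\<^sup>2)\<^sup>2"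
    proof -
      have "(u\<^sup>2 - s\<^sup>2)\<^sup>2 - (2 * x\<^sup>2 - u\<^sup>2 - s\<^sup>2)\<^sup>2 = 4 * ((u\<^sup>2 - x\<^sup>2) * (x\<^sup>2 - s\<^sup>2))"
        by algebra
      then show ?thesis
        using us by (simp add: w_def power_divide diff_divide_eq_iff)
    qed
    then have sw: "sqrt (1 - (w x)\<^sup>2) = 2 * (sqrt (u\<^sup>2 - x\<^sup>2) * sqrt (x\<^sup>2 - s\<^sup>2)) / (u\<^sup>2 - s\<^sup>2)"
      using us by (simp add: real_sqrt_divide real_sqrt_mult)
    have "(w has_real_derivative 4 * x / (u\<^sup>2 - s\<^sup>2)) (at x)"
      unfolding w_def using us by (auto intro!: derivative_eq_intros)
    from DERIV_cdivide[OF DERIV_chain2[OF DERIV_arcsin[OF w1] this], of u]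
    show "((\<lambda>x. arcsin (w x) / u) has_real_derivative 2 * x / (u * sqrt (u\<^sup>2 - x\<^sup>2)) / sqrt (x\<^sup>2 - s\<^sup>2)) (at x)"
      unfolding sw by (rule DERIV_cong) (use us sq in \<open>simp add: divide_simps\<close>)
    show "0 \<le> 2 * x / (u * sqrt (u\<^sup>2 - x\<^sup>2)) / sqrt (x\<^sup>2 - s\<^sup>2)"
      using us sq x assms by simp
  qed (use True in simp)
  also have "arcsin (w u) / u - arcsin (w s) / u = kB s u"
  proof -
    have "w u = 1"
      using us by (simp add: w_def)
    moreover have "w s = -1"
      using us by (simp add: w_def divide_eq_eq)
    ultimately show ?thesis
      using True us by (simp add: kB_def arcsin_minus_1 field_simps)
  qed
  finally show ?thesis .
next
  case False
  then have "(\<lambda>x. kTheta x u * (indicator {s<..} x / sqrt (x\<^sup>2 - s\<^sup>2))) = (\<lambda>x. 0)"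
    by (auto simp: kTheta_def indicator_def)
  then have eq: "(\<lambda>x. ennreal (kTheta x u * (indicator {s<..} x / sqrt (x\<^sup>2 - s\<^sup>2)))) = (\<lambda>x. 0)"
    by (metis ennreal_0)
  then show ?thesis
    using False unfolding eq by (simp add: kB_def)
qed

section \<open>Abel's transform of the push-forward measure\<close>

context profile
begin

lemma f_measurable [measurable]: "f \<in> borel_measurable borel"
  by (rule borel_measurable_continuous_onI[OF f_cont])

lemma prof_int_Tonelli:
  assumes W [measurable]: "(\<lambda>p. W (fst p) (snd p)) \<in> borel_measurable (borel \<Otimes>\<^sub>M borel)"
  shows "(\<integral>\<^sup>+x. prof_int m f (W x) \<partial>lborel)
    = (\<integral>\<^sup>+s. (\<integral>\<^sup>+x. ennreal (W x (f s)) \<partial>lborel) * indicator {0..m} s \<partial>lborel)"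
proof -
  have [measurable]: "(\<lambda>p. W (snd p) (f (fst p))) \<in> borel_measurable (lborel \<Otimes>\<^sub>M lborel)"
    using measurable_compose[OF _ W, of "\<lambda>p. (snd p, f (fst p))" "lborel \<Otimes>\<^sub>M lborel"] by simp
  have "(\<integral>\<^sup>+x. prof_int m f (W x) \<partial>lborel)
      = (\<integral>\<^sup>+x. \<integral>\<^sup>+s. ennreal (W x (f s)) * indicator {0..m} s \<partial>lborel \<partial>lborel)"
    by (simp add: prof_int_def)
  also have "\<dots> = (\<integral>\<^sup>+s. \<integral>\<^sup>+x. ennreal (W x (f s)) * indicator {0..m} s \<partial>lborel \<partial>lborel)"
    by (rule lborel_pair.Fubini') measurable
  also have "\<dots> = (\<integral>\<^sup>+s. (\<integral>\<^sup>+x. ennreal (W x (f s)) \<partial>lborel) * indicator {0..m} s \<partial>lborel)"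
  proof (rule nn_integral_cong)
    fix s
    have "(\<lambda>x. W x (f s)) \<in> borel_measurable borel"
      using measurable_compose[OF _ W, of "\<lambda>x. (x, f s)" borel] by simp
    then show "(\<integral>\<^sup>+x. ennreal (W x (f s)) * indicator {0..m} s \<partial>lborel)
        = (\<integral>\<^sup>+x. ennreal (W x (f s)) \<partial>lborel) * indicator {0..m} s"
      by (intro nn_integral_multc) measurable
  qed
  finally show ?thesis .
qed

lemma prof_int_cmult:
  assumes [measurable]: "K \<in> borel_measurable borel" and "0 \<le> c"
  shows "prof_int m f (\<lambda>u. K u * c) = prof_int m f K * ennreal c"
proof -
  have "prof_int m f (\<lambda>u. K u * c) = (\<integral>\<^sup>+s. (ennreal (K (f s)) * indicator {0..m} s) * ennreal c \<partial>lborel)"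
    unfolding prof_int_def using assms(2)
    by (intro nn_integral_cong) (auto simp: indicator_def ennreal_mult'' )
  then show ?thesis
    unfolding prof_int_def by (simp add: nn_integral_multc)
qed

lemma prof_int_J:
  assumes "0 < \<rho>"
  shows "(\<integral>\<^sup>+x. prof_int m f (kTheta x) * indicator {\<rho><..} x \<partial>lborel) = prof_int m f (kJ \<rho>)"
proof -
  have "prof_int m f (kTheta x) * indicator {\<rho><..} x = prof_int m f (\<lambda>u. kTheta x u * indicator {\<rho><..} x)" for x
    by (subst prof_int_cmult) (auto simp: indicator_def)
  then have "(\<integral>\<^sup>+x. prof_int m f (kTheta x) * indicator {\<rho><..} x \<partial>lborel)
      = (\<integral>\<^sup>+x. prof_int m f (\<lambda>u. kTheta x u * indicator {\<rho><..} x) \<partial>lborel)"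
    by simp
  also have "\<dots> = (\<integral>\<^sup>+s. (\<integral>\<^sup>+x. ennreal (kTheta x (f s) * indicator {\<rho><..} x) \<partial>lborel) * indicator {0..m} s \<partial>lborel)"
    by (rule prof_int_Tonelli) measurable
  finally show ?thesis
    by (simp add: nn_integral_kTheta[OF assms] prof_int_def)
qed

lemma prof_int_Abel:
  assumes "0 < s"
  shows "(\<integral>\<^sup>+x. prof_int m f (kTheta x) * ennreal (indicator {s<..} x / sqrt (x\<^sup>2 - s\<^sup>2)) \<partial>lborel) = prof_int m f (kB s)"
proof -
  have nn: "0 \<le> indicator {s<..} x / sqrt (x\<^sup>2 - s\<^sup>2)" for x
    using assms by (auto simp: indicator_def power_mono)
  have "(\<integral>\<^sup>+x. prof_int m f (kTheta x) * ennreal (indicator {s<..} x / sqrt (x\<^sup>2 - s\<^sup>2)) \<partial>lborel)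
      = (\<integral>\<^sup>+x. prof_int m f (\<lambda>u. kTheta x u * (indicator {s<..} x / sqrt (x\<^sup>2 - s\<^sup>2))) \<partial>lborel)"
    by (simp only: prof_int_cmult[OF kernel_measurable(2) nn])
  also have "\<dots> = (\<integral>\<^sup>+t. (\<integral>\<^sup>+x. ennreal (kTheta x (f t) * (indicator {s<..} x / sqrt (x\<^sup>2 - s\<^sup>2))) \<partial>lborel) * indicator {0..m} t \<partial>lborel)"
    by (rule prof_int_Tonelli) measurable
  finally show ?thesis
    unfolding nn_integral_kTheta_Abel[OF assms] by (simp only: prof_int_def)
qed

lemma f_nonneg: "0 \<le> s \<Longrightarrow> s \<le> m \<Longrightarrow> 0 \<le> f s"
  using f_pos[of s] f_0 f_m by (cases "s = 0"; cases "s = m") auto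

lemma prof_int_kTheta_0:
  assumes "R \<le> \<rho>"
  shows "prof_int m f (kTheta \<rho>) = 0"
proof -
  have eq: "(\<lambda>s. ennreal (kTheta \<rho> (f s)) * indicator {0..m} s) = (\<lambda>s. 0)"
    using f_le_R(1) assms by (fastforce simp: kTheta_def indicator_def)
  then show ?thesis unfolding prof_int_def eq by simp
qed

definition mu :: "real measure" where
  "mu = distr (density lborel (indicator {0..m})) borel f"

text \<open>Abel's transform turns \<open>\<Theta>\<close> into the integrals of \<open>kB\<close>, which are the tails of \<open>kap s\<close>.\<close>

definition kap :: "real \<Rightarrow> real measure" where
  "kap s = distr (density lborel (\<lambda>t. indicator {0..m} t * ennreal (kB s (f t)))) borel f"

lemma nn_integral_mu:
  assumes [measurable]: "K \<in> borel_measurable borel"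
  shows "(\<integral>\<^sup>+u. ennreal (K u) \<partial>mu) = prof_int m f K"
  unfolding mu_def prof_int_def
  by (subst nn_integral_distr, measurable, subst nn_integral_density) (auto simp: mult.commute)

lemma emeasure_mu:
  assumes [measurable]: "S \<in> sets borel"
  shows "emeasure mu S = emeasure lborel {t \<in> {0..m}. f t \<in> S}"
proof -
  have "emeasure mu S = emeasure (density lborel (indicator {0..m})) (f -` S)"
    unfolding mu_def by (subst emeasure_distr) auto
  also have "\<dots> = emeasure lborel ({0..m} \<inter> (f -` S))"
  proof -
    have "f -` S \<in> sets borel"
      using measurable_sets[OF f_measurable assms] by simp
    then show ?thesis
      by (subst emeasure_density) (auto simp flip: nn_integral_indicator intro!: nn_integral_cong simp: indicator_def)
  qed
  also have "{0..m} \<inter> (f -` S) = {t \<in> {0..m}. f t \<in> S}" by auto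
  finally show ?thesis .
qed

lemma level_measure:
  "emeasure lborel {t \<in> {0..m}. \<rho> \<le> f t} = ennreal (measure lborel {t \<in> {0..m}. \<rho> \<le> f t})"
proof (rule emeasure_eq_ennreal_measure)
  have "emeasure lborel {t \<in> {0..m}. \<rho> \<le> f t} \<le> emeasure lborel {0..m}"
    by (rule emeasure_mono) auto
  then show "emeasure lborel {t \<in> {0..m}. \<rho> \<le> f t} \<noteq> top"
    using m_pos by (auto simp: top_unique)
qed

text \<open>Restricting the measure to values above \<open>x\<close> merely raises the threshold of
  the kernel. All tails are therefore transforms of the rotation function.\<close>

lemma emeasure_kap:
  assumes "0 < s"
  shows "emeasure (kap s) {x<..} = prof_int m f (kB (max s x))"
proof -
  have "emeasure (kap s) {x<..} = (\<integral>\<^sup>+t. indicator {0..m} t * ennreal (kB s (f t)) * indicator (f -` {x<..}) t \<partial>lborel)"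
    unfolding kap_def using measurable_sets[OF f_measurable, of "{x<..}"]
    by (subst emeasure_distr, measurable, subst emeasure_density) auto
  also have "\<dots> = prof_int m f (kB (max s x))"
    unfolding prof_int_def by (intro nn_integral_cong) (auto simp: indicator_def kB_def)
  finally show ?thesis .
qed

lemma prof_int_kB_finite:
  assumes "0 < s"
  shows "prof_int m f (kB s) < \<infinity>"
proof -
  have "prof_int m f (kB s) \<le> (\<integral>\<^sup>+t. ennreal (pi / s) * indicator {0..m} t \<partial>lborel)"
    unfolding prof_int_def
  proof (rule nn_integral_mono)
    fix t
    have "kB s (f t) \<le> pi / s"
      using assms by (auto simp: kB_def intro!: divide_left_mono)
    then show "ennreal (kB s (f t)) * indicator {0..m} t \<le> ennreal (pi / s) * indicator {0..m} t"
      by (auto simp: indicator_def intro: ennreal_leI)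
  qed
  also have "\<dots> < \<infinity>"
    using m_pos by (subst nn_integral_cmult_indicator) (auto simp: ennreal_mult_less_top)
  finally show ?thesis .
qed

text \<open>Above \<open>s\<close> the weight \<open>u / pi\<close> undoes the density
  \<open>pi / u\<close>. The strict inequality \<open>s\<close> < \<rho> keeps the level \<rho>
  itself above the threshold.\<close>

lemma nn_integral_kap:
  assumes "0 < s" "s < \<rho>"
  shows "(\<integral>\<^sup>+u. ennreal (u / pi) * indicator {\<rho>..} u \<partial>kap s) = emeasure lborel {t \<in> {0..m}. \<rho> \<le> f t}"
proof -
  have "(\<integral>\<^sup>+u. ennreal (u / pi) * indicator {\<rho>..} u \<partial>kap s)
      = (\<integral>\<^sup>+t. indicator {0..m} t * ennreal (kB s (f t)) * (ennreal (f t / pi) * indicator {\<rho>..} (f t)) \<partial>lborel)"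
    unfolding kap_def by (subst nn_integral_distr, measurable, subst nn_integral_density) auto
  also have "\<dots> = (\<integral>\<^sup>+t. indicator {t \<in> {0..m}. \<rho> \<le> f t} t \<partial>lborel)"
    using assms
    by (intro nn_integral_cong) (auto simp: indicator_def kB_def simp flip: ennreal_mult'')
  also have "\<dots> = emeasure lborel {t \<in> {0..m}. \<rho> \<le> f t}"
    by (rule nn_integral_indicator) measurable
  finally show ?thesis .
qed

end

section \<open>Fronts\<close>

text \<open>Each isolated point is singled out by an interval with rational ends, and there are
  countably many of those.\<close>

lemma countable_isolated_points:
  fixes A :: "real set"
  shows "countable {y \<in> A. \<not> y islimpt A}"
proof -
  have "\<exists>q. fst q \<in> \<rat> \<and> snd q \<in> \<rat> \<and> fst q < y \<and> y < snd q \<and> A \<inter> {fst q<..<snd q} = {y}"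
    if y: "y \<in> A" "\<not> y islimpt A" for y
  proof -
    obtain e where e: "e > 0" "\<And>z. z \<in> A \<Longrightarrow> dist z y < e \<Longrightarrow> z = y"
      using y(2) unfolding islimpt_approachable by blast
    obtain q1 where q1: "q1 \<in> \<rat>" "y - e < q1" "q1 < y"
      using Rats_dense_in_real[of "y - e" y] e(1) by auto
    obtain q2 where q2: "q2 \<in> \<rat>" "y < q2" "q2 < y + e"
      using Rats_dense_in_real[of y "y + e"] e(1) by auto
    have "A \<inter> {q1<..<q2} = {y}"
      using y(1) q1 q2 e(2) by (auto simp: dist_real_def)
    then show ?thesis
      using q1 q2 by (intro exI[of _ "(q1, q2)"]) auto
  qed
  then obtain Q where Q: "\<And>y. y \<in> A \<Longrightarrow> \<not> y islimpt A \<Longrightarrow>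
      fst (Q y) \<in> \<rat> \<and> snd (Q y) \<in> \<rat> \<and> A \<inter> {fst (Q y)<..<snd (Q y)} = {y}"
    by metis
  have "inj_on Q {y \<in> A. \<not> y islimpt A}"
    by (rule inj_onI) (metis (mono_tags, lifting) Q mem_Collect_eq singleton_inject)
  moreover have "countable (Q ` {y \<in> A. \<not> y islimpt A})"
  proof (rule countable_subset[of _ "\<rat> \<times> \<rat>"])
    show "Q ` {y \<in> A. \<not> y islimpt A} \<subseteq> \<rat> \<times> \<rat>"
    proof
      fix q assume "q \<in> Q ` {y \<in> A. \<not> y islimpt A}"
      then show "q \<in> \<rat> \<times> \<rat>"
        using Q by (auto simp: mem_Times_iff)
    qed
  qed (simp add: countable_rat)
  ultimately show ?thesis
    by (metis countable_image_inj_on)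
qed

text \<open>Sard's theorem in dimension one, with the set of critical points as domain. It is
  carried to \<open>real^1\<close> and back, where negligibility survives as that of a
  differentiable image.\<close>

lemma Sard_real:
  fixes f :: "real \<Rightarrow> real"
  assumes "\<And>x. x \<in> S \<Longrightarrow> (f has_real_derivative 0) (at x)"
  shows "negligible (f ` S)"
proof -
  define F :: "real^1 \<Rightarrow> real^1" where "F x = vec (f (x $ 1))" for x
  have "negligible (F ` (vec ` S))"
  proof (rule baby_Sard)
    fix x :: "real^1" assume "x \<in> vec ` S"
    then have "(f has_derivative (\<lambda>h. 0)) (at (x $ 1))"
      using assms by (force simp: has_field_derivative_def lambda_zero)
    then have "(f has_derivative (\<lambda>h. 0)) (at (x $ 1) within (\<lambda>y. y $ 1) ` vec ` S)"
      by (rule has_derivative_at_withinI)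
    moreover have "((\<lambda>y :: real^1. y $ 1) has_derivative (\<lambda>y. y $ 1)) (at x within vec ` S)"
      by (intro bounded_linear_imp_has_derivative bounded_linear_vec_nth)
    ultimately have "((\<lambda>y. f (y $ 1)) has_derivative (\<lambda>h. 0)) (at x within vec ` S)"
      using has_derivative_in_compose by blast
    then have "((\<lambda>y. vec (f (y $ 1)) :: real^1) has_derivative (\<lambda>h. vec 0)) (at x within vec ` S)"
      by (rule bounded_linear.has_derivative[OF linear_linear[THEN iffD2, OF linear_vec]])
    then show "(F has_derivative (\<lambda>h. 0)) (at x within vec ` S)"
      by (simp add: F_def[abs_def] vec_eq_iff zero_vec_def)
    show "rank (matrix (\<lambda>h :: real^1. 0 :: real^1)) < CARD(1)"
    proof -
      have "matrix (\<lambda>h :: real^1. 0 :: real^1) = 0"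
        by (simp add: matrix_def vec_eq_iff)
      then show ?thesis by simp
    qed
  qed simp
  moreover have "F ` (vec ` S) = vec ` f ` S"
    by (auto simp: F_def image_iff)
  ultimately have "negligible ((\<lambda>x :: real^1. x $ 1) ` vec ` f ` S)"
    by (intro negligible_differentiable_image_negligible[where f = "\<lambda>x :: real^1. x $ 1"]
        bounded_linear_imp_differentiable_on bounded_linear_vec_nth) simp_all
  then show ?thesis
    by (simp add: image_image)
qed

text \<open>Cauchy's mean value theorem for the pair: where the derivative of \<open>T\<close> does
  not vanish, the slope of a chord of the front is a parameter between those of its end
  points.\<close>

lemma front_slope:
  fixes T L :: "real \<Rightarrow> real"
  assumes "x \<noteq> y" "\<And>z. z \<in> closed_segment x y \<Longrightarrow> (T has_real_derivative T' z) (at z)"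
    and "\<And>z. z \<in> closed_segment x y \<Longrightarrow> (L has_real_derivative z * T' z) (at z)"
    and "\<And>z. z \<in> closed_segment x y \<Longrightarrow> T' z \<noteq> 0"
  shows "\<exists>z \<in> open_segment x y. L y - L x = z * (T y - T x)" and "T x \<noteq> T y"
proof -
  have *: "(\<exists>z. x < z \<and> z < y \<and> L y - L x = z * (T y - T x)) \<and> T x \<noteq> T y"
    if xy: "x < y" "\<And>z. x \<le> z \<Longrightarrow> z \<le> y \<Longrightarrow> (T has_real_derivative T' z) (at z)"
      "\<And>z. x \<le> z \<Longrightarrow> z \<le> y \<Longrightarrow> (L has_real_derivative z * T' z) (at z)"
      "\<And>z. x \<le> z \<Longrightarrow> z \<le> y \<Longrightarrow> T' z \<noteq> 0" for x y
  proof -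
    have "\<exists>z. x < z \<and> z < y \<and> (L y - L x) * T' z = (T y - T x) * (z * T' z)"
      using xy by (intro GMVT') (auto intro: DERIV_isCont)
    then obtain z where z: "x < z" "z < y" "(L y - L x) * T' z = (T y - T x) * (z * T' z)"
      by blast
    obtain w where w: "x < w" "w < y" "T y - T x = (y - x) * T' w"
      using MVT2[OF xy(1,2)] by blast
    have "L y - L x = z * (T y - T x)"
    proof -
      have "(L y - L x - z * (T y - T x)) * T' z = 0"
        using z(3) by (simp add: algebra_simps)
      then show ?thesis
        using z xy(4)[of z] by auto
    qed
    moreover have "T x \<noteq> T y"
      using w xy(1) xy(4)[of w] by auto
    ultimately show ?thesis
      using z by blast
  qed
  show "\<exists>z \<in> open_segment x y. L y - L x = z * (T y - T x)"
  proof (cases "x < y")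
    case True
    then show ?thesis
      using *[of x y] assms by (auto simp: closed_segment_eq_real_ivl open_segment_eq_real_ivl)
  next
    case False
    then obtain z where "y < z" "z < x" "L x - L y = z * (T x - T y)"
      using *[of y x] assms by (auto simp: closed_segment_eq_real_ivl)
    then show ?thesis
      using False by (intro bexI[of _ z]) (auto simp: open_segment_eq_real_ivl algebra_simps)
  qed
  show "T x \<noteq> T y"
    using *[of x y] *[of y x] assms by (cases "x < y") (auto simp: closed_segment_eq_real_ivl)
qed

text \<open>The expression \<open>L x - x * T x\<close> is the intercept of the tangent of slope
  \<open>x\<close>. Its limits at the two ends describe what happens when a parameter leaves the
  open interval; \<open>c\<close> is the one at 0.\<close>

locale front =
  fixes R :: real and T T' L :: "real \<Rightarrow> real" and c :: real
  assumes R_pos: "0 < R"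
    and T_deriv: "\<And>x. 0 < x \<Longrightarrow> x < R \<Longrightarrow> (T has_real_derivative T' x) (at x)"
    and T'_cont: "continuous_on {0<..<R} T'"
    and L_deriv: "\<And>x. 0 < x \<Longrightarrow> x < R \<Longrightarrow> (L has_real_derivative x * T' x) (at x)"
    and T_pos: "\<And>x. 0 < x \<Longrightarrow> x < R \<Longrightarrow> 0 < T x"
    and lim_R: "((\<lambda>x. L x - x * T x) \<longlongrightarrow> 0) (at_left R)"
    and lim_0: "((\<lambda>x. L x - x * T x) \<longlongrightarrow> c) (at_right 0)"
begin

lemma T_cont: "continuous_on {0<..<R} T"
  using DERIV_isCont[OF T_deriv] by (simp add: continuous_at_imp_continuous_on)

definition spectrum :: "nat \<Rightarrow> nat \<Rightarrow> real set" where
  "spectrum p q = {real q * L x | x. 0 < x \<and> x < R \<and> real q * T x = 2 * pi * real p}"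

lemma T'_nonzero_nbhd:
  assumes "0 < x" "x < R" "T' x \<noteq> 0"
  obtains e where "0 < e" "0 < x - e" "x + e < R" "\<And>y. \<bar>y - x\<bar> \<le> e \<Longrightarrow> T' y \<noteq> 0"
proof -
  have "isCont T' x"
    using T'_cont assms by (simp add: continuous_on_eq_continuous_at)
  then obtain d where d: "0 < d" "\<And>y. dist x y < d \<Longrightarrow> T' y \<noteq> 0"
    using continuous_at_avoid[of x T' 0] assms by blast
  define e where "e = min (d / 2) (min (x / 2) ((R - x) / 2))"
  have "0 < e" "e \<le> d / 2" "e \<le> x / 2" "e \<le> (R - x) / 2"
  proof -
    show "0 < e" using d assms by (simp add: e_def)
    show "e \<le> d / 2" "e \<le> x / 2" "e \<le> (R - x) / 2" unfolding e_def by linarith+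
  qed
  then show thesis
    using d assms by (intro that[of e]) (auto simp: dist_real_def)
qed

end

section \<open>Comparison of two fronts with the same spectrum\<close>

locale two_fronts = one: front R T1 T1' L1 c1 + two: front R T2 T2' L2 c2
  for R T1 T1' L1 c1 T2 T2' L2 c2 +
  assumes spec: "\<And>p q. 1 \<le> p \<Longrightarrow> 1 \<le> q \<Longrightarrow> coprime p q \<Longrightarrow> one.spectrum p q = two.spectrum p q"
begin

text \<open>Points with rational rotation accumulate at \<open>x\<close>, and the spectrum matches
  each of them with a point of the second front. A subsequence of the matching parameters converges
  in the closed interval; the last two alternatives are convergence to \<open>R\<close> and to 0,
  read off from the limits of the intercept.\<close>

lemma match_limit:
  assumes x: "0 < x" "x < R" "T1' x \<noteq> 0"
  shows "(\<exists>y. 0 < y \<and> y < R \<and> T2 y = T1 x \<and> L2 y = L1 x) \<or> L1 x = R * T1 x \<or> L1 x = c2"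
proof -
  obtain e where e: "0 < e" "0 < x - e" "x + e < R" "\<And>y. \<bar>y - x\<bar> \<le> e \<Longrightarrow> T1' y \<noteq> 0"
    using one.T'_nonzero_nbhd[OF x] by blast
  have "\<exists>u y. x < u \<and> u < x + e / real (Suc n) \<and> 0 < y \<and> y < R \<and> T2 y = T1 u \<and> L2 y = L1 u" for n
  proof -
    \<comment> \<open>The denominator \<open>n + 2\<close> keeps \<open>x'\<close> strictly inside
      the required neighbourhood.\<close>
    define x' where "x' = x + e / real (Suc (Suc n))"
    have x': "x < x'" "x' < x + e / real (Suc n)" "x' \<le> x + e"
      using e(1) by (auto simp: x'_def field_simps)
    have "T1 x \<noteq> T1 x'"
    proof -
      have "0 < u \<and> u < R \<and> T1' u \<noteq> 0" if "u \<in> closed_segment x x'" for u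
        using that x x' e(3) e(4)[of u] by (auto simp: closed_segment_eq_real_ivl)
      then show ?thesis
        using front_slope(2)[of x x' T1 T1' L1] x'(1) one.T_deriv one.L_deriv by blast
    qed
    \<comment> \<open>In lowest terms this rational is the pair \<open>(p, q)\<close> to which
      equality of spectra applies; positivity of \<open>T1\<close> gives \<open>p\<close> \<ge>
      1.\<close>
    then obtain r where r: "r \<in> \<rat>" "min (T1 x) (T1 x') / (2 * pi) < r" "r < max (T1 x) (T1 x') / (2 * pi)"
      using Rats_dense_in_real[of "min (T1 x) (T1 x') / (2 * pi)" "max (T1 x) (T1 x') / (2 * pi)"]
      by (force simp: divide_strict_right_mono)
    have "0 < T1 x" "0 < T1 x'"
      using one.T_pos x x' e by auto
    then have "0 < min (T1 x) (T1 x') / (2 * pi)"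
      by simp
    then have "0 < r" using r(2) by linarith
    obtain p q :: nat where pq: "q \<noteq> 0" "\<bar>r\<bar> = real p / real q" "coprime p q"
      using Rats_abs_nat_div_natE[OF r(1)] by metis
    have p: "r = real p / real q" "1 \<le> p" "1 \<le> q"
      using pq \<open>0 < r\<close> by (auto simp: Suc_le_eq zero_less_divide_iff)
    have cont: "continuous_on {x..x'} T1"
      by (rule continuous_on_subset[OF one.T_cont]) (use x x' e in auto)
    have "\<exists>u\<ge>x. u \<le> x' \<and> T1 u = 2 * pi * r"
    proof (cases "T1 x < T1 x'")
      case True
      then show ?thesis
        using r x' by (intro IVT'[OF _ _ _ cont]) (auto simp: field_simps)
    next
      case False
      then show ?thesis
        using r x' by (intro IVT2'[OF _ _ _ cont]) (auto simp: field_simps)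
    qed
    then obtain u where u: "x \<le> u" "u \<le> x'" "T1 u = 2 * pi * r"
      by blast
    have "u \<noteq> x"
      using u(3) r(2,3) by (auto simp: min_def max_def field_simps split: if_splits)
    then have ux: "x < u" "u < R" using u x' e by auto
    then have "real q * L1 u \<in> one.spectrum p q"
      using u x p(1) pq(1) by (auto simp: one.spectrum_def)
    then have "real q * L1 u \<in> two.spectrum p q"
      using spec[OF p(2,3) pq(3)] by simp
    then obtain y where "0 < y" "y < R" "real q * T2 y = 2 * pi * real p" "real q * L2 y = real q * L1 u"
      by (auto simp: two.spectrum_def)
    moreover have "u < x + e / real (Suc n)"
      using u(2) x'(2) by linarith
    moreover have "T2 y = T1 u"
      using calculation(3) pq(1) by (simp add: u(3) p(1) field_simps)
    ultimately show ?thesis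
      using pq(1) ux by (intro exI[of _ u] exI[of _ y]) auto
  qed
  then obtain u y where u: "\<And>n. x < u n" "\<And>n. u n < x + e / real (Suc n)"
    and y: "\<And>n. 0 < y n" "\<And>n. y n < R" "\<And>n. T2 (y n) = T1 (u n)" "\<And>n. L2 (y n) = L1 (u n)"
    by metis
  have "(\<lambda>n. x + e * inverse (real (Suc n))) \<longlonglongrightarrow> x + e * 0"
    by (intro tendsto_add tendsto_mult tendsto_const LIMSEQ_inverse_real_of_nat)
  then have "(\<lambda>n. x + e / real (Suc n)) \<longlonglongrightarrow> x"
    by (simp add: divide_inverse)
  then have ulim: "u \<longlonglongrightarrow> x"
    using u by (intro tendsto_sandwich[of "\<lambda>n. x" u sequentially "\<lambda>n. x + e / real (Suc n)"])
      (auto intro!: always_eventually less_imp_le)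
  obtain z s where z: "z \<in> {0..R}" "strict_mono s" "(y \<circ> s) \<longlonglongrightarrow> z"
    using compact_Icc[of 0 R] y(1,2) unfolding compact_def by (meson atLeastAtMost_iff less_imp_le)
  have us: "(\<lambda>n. u (s n)) \<longlonglongrightarrow> x"
    using LIMSEQ_subseq_LIMSEQ[OF ulim z(2)] by (simp add: o_def)
  have T1lim: "(\<lambda>n. T2 (y (s n))) \<longlonglongrightarrow> T1 x"
    unfolding y(3) by (rule isCont_tendsto_compose[OF DERIV_isCont[OF one.T_deriv[OF x(1,2)]] us])
  have L1lim: "(\<lambda>n. L2 (y (s n))) \<longlonglongrightarrow> L1 x"
    unfolding y(4) by (rule isCont_tendsto_compose[OF DERIV_isCont[OF one.L_deriv[OF x(1,2)]] us])
  have ys: "(\<lambda>n. y (s n)) \<longlonglongrightarrow> z"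
    using z(3) by (simp add: o_def)
  have Jlim: "(\<lambda>n. L2 (y (s n)) - y (s n) * T2 (y (s n))) \<longlonglongrightarrow> L1 x - z * T1 x"
    by (intro tendsto_intros T1lim L1lim ys)
  consider "z = 0" | "z = R" | "0 < z" "z < R"
    using z(1) by fastforce
  then show ?thesis
  proof cases
    case 1
    have "filterlim (\<lambda>n. y (s n)) (at_right 0) sequentially"
      using ys 1 y(1) by (auto simp: filterlim_at less_imp_neq[symmetric])
    from filterlim_compose[OF two.lim_0 this] have "L1 x - z * T1 x = c2"
      using Jlim LIMSEQ_unique by blast
    then show ?thesis using 1 by simp
  next
    case 2
    have "filterlim (\<lambda>n. y (s n)) (at_left R) sequentially"
      using ys 2 y(2) by (auto simp: filterlim_at less_le)
    from filterlim_compose[OF two.lim_R this] have "L1 x - z * T1 x = 0"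
      using Jlim LIMSEQ_unique by blast
    then show ?thesis using 2 by simp
  next
    case 3
    have "T1 x = T2 z" "L1 x = L2 z"
      using LIMSEQ_unique[OF T1lim isCont_tendsto_compose[OF DERIV_isCont[OF two.T_deriv[OF 3]] ys]]
        LIMSEQ_unique[OF L1lim isCont_tendsto_compose[OF DERIV_isCont[OF two.L_deriv[OF 3]] ys]] by auto
    then show ?thesis using 3 by auto
  qed
qed

lemma eq_at_regular:
  assumes x0: "0 < x0" "x0 < R" "T1' x0 \<noteq> 0"
  shows "T2 x0 = T1 x0"
proof (rule ccontr)
  assume ne: "T2 x0 \<noteq> T1 x0"
  obtain e1 where e1: "0 < e1" "0 < x0 - e1" "x0 + e1 < R" "\<And>y. \<bar>y - x0\<bar> \<le> e1 \<Longrightarrow> T1' y \<noteq> 0"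
    using one.T'_nonzero_nbhd[OF x0] by blast
  have "isCont (\<lambda>x. T2 x - T1 x) x0"
    by (intro isCont_diff DERIV_isCont[OF two.T_deriv] DERIV_isCont[OF one.T_deriv] x0)
  then obtain d where d: "0 < d" "\<And>y. dist x0 y < d \<Longrightarrow> T2 y - T1 y \<noteq> 0"
    using continuous_at_avoid[of x0 "\<lambda>x. T2 x - T1 x" 0] ne by auto
  define e where "e = min e1 (d / 2)"
  define N where "N = {x0 - e..x0 + e}"
  have e: "0 < e" "e \<le> e1" "e < d"
    using e1(1) d(1) by (auto simp: e_def)
  have N: "0 < x" "x < R" "T1' x \<noteq> 0" "T2 x \<noteq> T1 x" if "x \<in> N" for x
  proof -
    have "\<bar>x - x0\<bar> \<le> e" "dist x0 x < d"
      using that e by (auto simp: N_def dist_real_def)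
    then show "0 < x" "x < R" "T1' x \<noteq> 0" "T2 x \<noteq> T1 x"
      using e e1(2,3) e1(4)[of x] d(2)[of x] by auto
  qed
  have seg: "closed_segment x y \<subseteq> N" if "x \<in> N" "y \<in> N" for x y
    using that by (auto simp: N_def closed_segment_eq_real_ivl split: if_splits)
  have slope: "\<exists>z \<in> open_segment x y. L1 y - L1 x = z * (T1 y - T1 x)" "T1 x \<noteq> T1 y"
    if "x \<in> N" "y \<in> N" "x \<noteq> y" for x y
  proof -
    have "0 < u \<and> u < R \<and> T1' u \<noteq> 0" if "u \<in> closed_segment x y" for u
      using N seg[OF \<open>x \<in> N\<close> \<open>y \<in> N\<close>] that by blast
    then show "\<exists>z \<in> open_segment x y. L1 y - L1 x = z * (T1 y - T1 x)" "T1 x \<noteq> T1 y"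
      using front_slope[OF \<open>x \<noteq> y\<close>, of T1 T1' L1] one.T_deriv one.L_deriv by blast+
  qed
  \<comment> \<open>The parameters of those points of the second front that lie on the small arc of
    the first.\<close>
  define Z where "Z = {y. 0 < y \<and> y < R \<and> (\<exists>x\<in>N. T2 y = T1 x \<and> L2 y = L1 x)}"
  have inj: "inj_on T1 N"
    using slope(2) by (auto simp: inj_on_def)
  have contT1: "continuous_on N T1"
    by (rule continuous_on_subset[OF one.T_cont]) (use N in auto)
  define g where "g = the_inv_into N T1"
  have gT: "g (T1 x) = x" if "x \<in> N" for x
    unfolding g_def using the_inv_into_f_f[OF inj that] .
  have g_cont: "continuous_on (T1 ` N) g"
    by (rule continuous_on_inv[OF contT1]) (auto simp: N_def gT)
  \<comment> \<open>Two nearby common points span the same chord on both fronts. Its slope is close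
    to the parameter on the first front and also to that on the second, but these differ because
    \<open>T1\<close> and \<open>T2\<close> have no common value at any single parameter in
    \<open>N\<close>.\<close>
  have isolated: "\<not> y islimpt Z" if y: "y \<in> Z" "T2' y \<noteq> 0" for y
  proof
    assume lim: "y islimpt Z"
    obtain x where x: "x \<in> N" "T2 y = T1 x" "L2 y = L1 x" and y0: "0 < y" "y < R"
      using y(1) by (auto simp: Z_def)
    have "x \<noteq> y" using N(4)[OF x(1)] x(2) by auto
    \<comment> \<open>Half the gap between the two parameters: two slopes within \<open>b\<close> of
      them cannot be equal.\<close>
    define b where "b = \<bar>x - y\<bar> / 2"
    have b: "0 < b" using \<open>x \<noteq> y\<close> by (simp add: b_def)
    obtain a where a: "0 < a" "0 < y - a" "y + a < R" "\<And>z. \<bar>z - y\<bar> \<le> a \<Longrightarrow> T2' z \<noteq> 0"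
      using two.T'_nonzero_nbhd[OF y0 y(2)] by blast
    obtain w where w: "0 < w" "\<And>t. t \<in> T1 ` N \<Longrightarrow> dist t (T1 x) < w \<Longrightarrow> dist (g t) (g (T1 x)) < b"
      using g_cont x(1) b unfolding continuous_on_iff by (meson imageI)
    have "isCont T2 y"
      by (rule DERIV_isCont[OF two.T_deriv[OF y0]])
    then obtain k where k: "0 < k" "\<And>z. dist z y < k \<Longrightarrow> dist (T2 z) (T2 y) < w"
      using w(1) unfolding continuous_at_eps_delta by blast
    obtain z where z: "z \<in> Z" "z \<noteq> y" "dist z y < min a (min b k)"
      using lim a(1) b k(1) unfolding islimpt_approachable by (metis min_less_iff_conj)
    obtain v where v: "v \<in> N" "T2 z = T1 v" "L2 z = L1 v"
      using z(1) by (auto simp: Z_def)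
    have "dist v x < b"
      using w(2)[of "T1 v"] k(2)[of z] z(3) v x gT by auto
    have zs: "\<bar>u - y\<bar> \<le> a" "\<bar>u - y\<bar> < b" if "u \<in> closed_segment y z" for u
      using that z(3) by (auto simp: closed_segment_eq_real_ivl dist_real_def split: if_splits)
    have T2s: "\<exists>u \<in> open_segment y z. L2 z - L2 y = u * (T2 z - T2 y)" "T2 y \<noteq> T2 z"
    proof -
      have "0 < u \<and> u < R \<and> T2' u \<noteq> 0" if "u \<in> closed_segment y z" for u
        using zs[OF that] a by (auto simp: abs_le_iff)
      then show "\<exists>u \<in> open_segment y z. L2 z - L2 y = u * (T2 z - T2 y)" "T2 y \<noteq> T2 z"
        using front_slope[OF z(2)[symmetric], of T2 T2' L2] two.T_deriv two.L_deriv by blast+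
    qed
    then have "x \<noteq> v" using x v by auto
    from T2s obtain u where u: "u \<in> open_segment y z" "L2 z - L2 y = u * (T2 z - T2 y)"
      by blast
    from slope(1)[OF x(1) v(1) \<open>x \<noteq> v\<close>] obtain t where
      t: "t \<in> open_segment x v" "L1 v - L1 x = t * (T1 v - T1 x)"
      by blast
    have "t = u"
      using t(2) u(2) x v T2s(2) by auto
    moreover have "\<bar>t - x\<bar> < b"
      using t(1) \<open>dist v x < b\<close> by (auto simp: open_segment_eq_real_ivl dist_real_def split: if_splits)
    moreover have "\<bar>u - y\<bar> < b"
      using zs(2) u(1) segment_open_subset_closed by blast
    ultimately show False
      by (auto simp: b_def abs_if split: if_splits)
  qed
  have "negligible (T2 ` {y \<in> Z. T2' y = 0})"
    by (rule Sard_real) (use two.T_deriv in \<open>fastforce simp: Z_def\<close>)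
  moreover have "negligible (T2 ` {y \<in> Z. T2' y \<noteq> 0})"
  proof -
    have "{y \<in> Z. T2' y \<noteq> 0} \<subseteq> {y \<in> Z. \<not> y islimpt Z}"
      using isolated by auto
    then have "countable (T2 ` {y \<in> Z. T2' y \<noteq> 0})"
      by (intro countable_image countable_subset[OF _ countable_isolated_points])
    from countable_imp_null_set_lborel[OF this] show ?thesis
      unfolding negligible_iff_null_sets by (rule null_sets_completionI)
  qed
  ultimately have negZ: "negligible (T2 ` Z)"
    by (rule negligible_subset[OF negligible_Un]) blast
  \<comment> \<open>A chord between two such points would have slope \<open>R\<close>, but slopes of
    chords of the arc are parameters in \<open>N\<close>, below \<open>R\<close>. So there is at
    most one.\<close>
  have "finite {x \<in> N. L1 x = R * T1 x}"
  proof (rule finite_subset)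
    show "{x \<in> N. L1 x = R * T1 x} \<subseteq> {SOME x. x \<in> N \<and> L1 x = R * T1 x}"
    proof
      fix x assume "x \<in> {x \<in> N. L1 x = R * T1 x}"
      then have x: "x \<in> N" "L1 x = R * T1 x" by auto
      define y where "y = (SOME x. x \<in> N \<and> L1 x = R * T1 x)"
      have y: "y \<in> N" "L1 y = R * T1 y"
        using someI[of "\<lambda>x. x \<in> N \<and> L1 x = R * T1 x" x] x by (auto simp: y_def)
      have "x = y"
      proof (rule ccontr)
        assume "x \<noteq> y"
        from slope(1)[OF x(1) y(1) this] slope(2)[OF x(1) y(1) this] obtain z where z: "z \<in> open_segment x y" "L1 y - L1 x = z * (T1 y - T1 x)" "T1 x \<noteq> T1 y"
          by blast
        have "(R - z) * (T1 y - T1 x) = 0"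
          using z(2) x(2) y(2) by (simp add: algebra_simps)
        then have "z = R" using z(3) by auto
        moreover have "z \<in> N"
          using z(1) seg[OF x(1) y(1)] segment_open_subset_closed by blast
        ultimately show False using N(2) by blast
      qed
      then show "x \<in> {SOME x. x \<in> N \<and> L1 x = R * T1 x}"
        by (simp add: y_def)
    qed
  qed simp
  \<comment> \<open>Two such points would span a chord of slope 0, while all slopes are positive on
    \<open>N\<close>.\<close>
  moreover have "finite {x \<in> N. L1 x = c2}"
  proof -
    have "inj_on L1 N"
    proof (rule inj_onI, rule ccontr)
      fix x y assume x: "x \<in> N" and y: "y \<in> N" and "L1 x = L1 y" "x \<noteq> y"
      from slope(1)[OF x y \<open>x \<noteq> y\<close>] slope(2)[OF x y \<open>x \<noteq> y\<close>] obtain z where z: "z \<in> open_segment x y" "L1 y - L1 x = z * (T1 y - T1 x)" "T1 x \<noteq> T1 y"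
        by blast
      then have "z = 0" using \<open>L1 x = L1 y\<close> by auto
      moreover have "z \<in> N"
        using z(1) seg[OF x y] segment_open_subset_closed by blast
      ultimately show False using N(1) by blast
    qed
    then have "finite (L1 -` {c2} \<inter> N)"
      by (intro finite_vimage_IntI) auto
    then show ?thesis
      by (rule rev_finite_subset) auto
  qed
  ultimately have "finite ({x \<in> N. L1 x = R * T1 x} \<union> {x \<in> N. L1 x = c2})" (is "finite ?F")
    by simp
  then have "negligible (T1 ` ?F)"
    by (intro negligible_finite finite_imageI)
  moreover have "T1 ` N \<subseteq> T2 ` Z \<union> T1 ` ?F"
  proof
    fix t assume "t \<in> T1 ` N"
    then obtain x where x: "x \<in> N" "t = T1 x" by auto
    show "t \<in> T2 ` Z \<union> T1 ` ?F"
    proof (cases "x \<in> ?F")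
      case False
      then obtain y where "0 < y" "y < R" "T2 y = T1 x" "L2 y = L1 x"
        using match_limit[OF N(1-3)[OF x(1)]] x by blast
      then have "y \<in> Z" "t = T2 y"
        using x by (auto simp: Z_def)
      then show ?thesis by blast
    qed (use x in blast)
  qed
  ultimately have "negligible (T1 ` N)"
    using negZ by (meson negligible_Un negligible_subset)
  moreover have "\<not> negligible (T1 ` N)"
  proof -
    have ends: "x0 - e \<in> N" "x0 + e \<in> N"
      using e by (auto simp: N_def)
    have "connected (T1 ` N)"
      using contT1 by (rule connected_continuous_image) (simp add: N_def)
    then have "closed_segment (T1 (x0 - e)) (T1 (x0 + e)) \<subseteq> T1 ` N"
      using ends closed_segment_subset[of "T1 (x0 - e)" "T1 ` N"] by (simp add: connected_convex_1)
    moreover have "\<not> negligible (closed_segment (T1 (x0 - e)) (T1 (x0 + e)))"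
      using slope(2)[OF ends] e negligible_interval(1)[where 'a = real]
      by (auto simp: closed_segment_eq_real_ivl)
    ultimately show ?thesis
      using negligible_subset by blast
  qed
  ultimately show False by blast
qed

end

lemma fronts_eq:
  assumes A: "two_fronts R T1 T1' L1 c1 T2 T2' L2 c2"
    and B: "(T1 \<longlongrightarrow> l) (at_right 0)" "(T2 \<longlongrightarrow> l) (at_right 0)"
    and x: "0 < x" "x < R"
  shows "T1 x = T2 x"
proof -
  interpret A: two_fronts R T1 T1' L1 c1 T2 T2' L2 c2 by (rule A)
  interpret B: two_fronts R T2 T2' L2 c2 T1 T1' L1 c1
    using A.spec by unfold_locales simp
  \<comment> \<open>The square has derivative 0 at points of coincidence without any information on
    the derivatives there. At other points \<open>eq_at_regular\<close>, used in both directions,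
    makes both derivatives vanish.\<close>
  define D where "D y = (T1 y - T2 y)\<^sup>2" for y
  have "(D has_real_derivative 0) (at y)" if y: "0 < y" "y < R" for y
  proof -
    have "(D has_real_derivative 2 * (T1 y - T2 y) * (T1' y - T2' y)) (at y)"
      unfolding D_def using A.one.T_deriv[OF y] A.two.T_deriv[OF y]
      by (auto intro!: derivative_eq_intros)
    moreover have "2 * (T1 y - T2 y) * (T1' y - T2' y) = 0"
    proof (cases "T1 y = T2 y")
      case False
      then have "T1' y = 0" "T2' y = 0"
        using A.eq_at_regular[OF y] B.eq_at_regular[OF y] by metis+
      then show ?thesis by simp
    qed simp
    ultimately show ?thesis by (simp only:)
  qed
  then have "\<exists>k. \<forall>y\<in>{0<..<R}. D y = k"
    by (intro has_field_derivative_zero_constant) (auto intro: DERIV_subset)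
  then obtain k where k: "\<And>y. 0 < y \<Longrightarrow> y < R \<Longrightarrow> D y = k" by auto
  have "(D \<longlongrightarrow> (l - l)\<^sup>2) (at_right 0)"
    unfolding D_def by (intro tendsto_intros B)
  moreover have "\<forall>\<^sub>F y in at_right 0. D y = k"
    using k A.one.R_pos by (intro eventually_at_rightI[of 0 R]) auto
  then have "(D \<longlongrightarrow> k) (at_right 0)"
    by (rule tendsto_eventually)
  ultimately have "k = 0"
    using tendsto_unique[of "at_right (0::real)" D] by (metis diff_self trivial_limit_at_right_real zero_power2)
  then show ?thesis
    using k[OF x] by (simp add: D_def)
qed

section \<open>The front of a profile\<close>

lemma kJ_nonneg: "0 < \<rho> \<Longrightarrow> 0 \<le> kJ \<rho> u"
  by (auto simp: kJ_def power_mono)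

lemma kTheta_nonneg: "0 < \<rho> \<Longrightarrow> 0 \<le> kTheta \<rho> u"
  by (auto simp: kTheta_def power_mono)

lemma kEll_split:
  assumes "0 < \<rho>"
  shows "kEll \<rho> u = kJ \<rho> u + kTheta \<rho> u * \<rho>"
proof (cases "\<rho> < u")
  case True
  define d where "d = sqrt (u\<^sup>2 - \<rho>\<^sup>2)"
  have "0 < u\<^sup>2 - \<rho>\<^sup>2"
    using True assms by (simp add: power_strict_mono)
  then have d: "0 < d" "d\<^sup>2 = u\<^sup>2 - \<rho>\<^sup>2"
    by (auto simp: d_def)
  have "2 * u / d = 2 * d / u + 2 * \<rho> / (u * d) * \<rho>"
  proof -
    have "2 * u / d = 2 * u\<^sup>2 / (u * d)"
      using True assms by (simp add: power2_eq_square)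
    also have "u\<^sup>2 = d\<^sup>2 + \<rho>\<^sup>2"
      using d(2) by simp
    also have "2 * (d\<^sup>2 + \<rho>\<^sup>2) / (u * d) = 2 * d / u + 2 * \<rho> / (u * d) * \<rho>"
      using d(1) True assms by (simp add: field_simps power2_eq_square)
    finally show ?thesis .
  qed
  then show ?thesis
    using True by (simp add: kEll_def kJ_def kTheta_def d_def)
qed (simp add: kEll_def kJ_def kTheta_def)

context profile
begin

text \<open>The theorem speaks of closed rays, whereas measures are compared on open ones;
  exhaustion from inside mediates.\<close>

lemma emeasure_mu_gt: "emeasure mu {x<..} = (SUP n. emeasure mu {x + inverse (real (Suc n))..})"
proof -
  have "{x<..} = (\<Union>n. {x + inverse (real (Suc n))..})"
  proof (intro set_eqI iffI)
    fix y assume "y \<in> {x<..}"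
    then obtain n where "inverse (real (Suc n)) < y - x"
      using reals_Archimedean[of "y - x"] by auto
    then show "y \<in> (\<Union>n. {x + inverse (real (Suc n))..})"
      by (auto intro!: exI[of _ n])
  next
    fix y assume "y \<in> (\<Union>n. {x + inverse (real (Suc n))..})"
    then obtain n where "x + inverse (real (Suc n)) \<le> y" by auto
    moreover have "0 < inverse (real (Suc n))" by simp
    ultimately show "y \<in> {x<..}" unfolding greaterThan_iff by linarith
  qed
  moreover have "(SUP n. emeasure mu {x + inverse (real (Suc n))..}) = emeasure mu (\<Union>n. {x + inverse (real (Suc n))..})"
  proof (rule SUP_emeasure_incseq)
    show "incseq (\<lambda>n. {x + inverse (real (Suc n))..})"
    proof (rule incseq_SucI)
      fix n
      have "inverse (real (Suc (Suc n))) \<le> inverse (real (Suc n))"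
        by (simp add: field_simps)
      then show "{x + inverse (real (Suc n))..} \<subseteq> {x + inverse (real (Suc (Suc n)))..}"
        by auto
    qed
  qed (auto simp: mu_def)
  ultimately show ?thesis by simp
qed

lemma emeasure_mu_finite: "emeasure mu S < \<infinity>"
proof -
  have "emeasure mu S \<le> emeasure mu UNIV"
    by (intro emeasure_mono) (auto simp: mu_def)
  also have "\<dots> = emeasure lborel {0..m}"
    by (subst emeasure_mu) (auto intro!: arg_cong[where f = "emeasure lborel"])
  also have "\<dots> < \<infinity>"
    using m_pos by simp
  finally show ?thesis .
qed

lemma emeasure_mu_level: "emeasure mu {\<rho>..} = ennreal (measure lborel {t \<in> {0..m}. \<rho> \<le> f t})"
  using level_measure[of \<rho>] by (subst emeasure_mu) (simp_all only: atLeast_iff atLeast_borel)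

lemma emeasure_mu_level_neg:
  assumes "\<rho> \<le> 0"
  shows "emeasure mu {\<rho>..} = emeasure mu {0..}"
proof -
  have "{t \<in> {0..m}. \<rho> \<le> f t} = {t \<in> {0..m}. 0 \<le> f t}"
    using f_nonneg assms by force
  then show ?thesis by (simp add: emeasure_mu_level)
qed

lemma emeasure_mu_gt_0: "emeasure mu {0<..} = ennreal m"
proof -
  have "{t \<in> {0..m}. f t \<in> {0<..}} = {0<..<m}"
    using f_pos f_0 f_m by (force simp: less_le)
  then show ?thesis
    using m_pos by (subst emeasure_mu) auto
qed

lemma emeasure_mu_level_0: "emeasure mu {0..} = ennreal m"
proof -
  have "{t \<in> {0..m}. 0 \<le> f t} = {0..m}"
    using f_nonneg by auto
  then show ?thesis
    using m_pos by (simp add: emeasure_mu_level)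
qed

text \<open>Lets the maximal radius \<open>R\<close> be read off from the push-forward measure:
  below \<open>R\<close> a superlevel set is a nondegenerate interval, from \<open>R\<close> on at
  most one point.\<close>

lemma emeasure_mu_pos:
  assumes "0 < \<rho>"
  shows "0 < emeasure mu {\<rho>..} \<longleftrightarrow> \<rho> < R"
proof
  assume "\<rho> < R"
  then interpret orbit g m \<Phi> f s0 \<rho>
    using assms by unfold_locales
  have "{t \<in> {0..m}. \<rho> \<le> f t} = {lo..hi}"
    using f_gt_iff(2) lo hi by (auto; fastforce)
  then show "0 < emeasure mu {\<rho>..}"
    using lo_hi by (simp add: emeasure_mu_level)
next
  assume pos: "0 < emeasure mu {\<rho>..}"
  show "\<rho> < R"
  proof (rule ccontr)
    assume "\<not> \<rho> < R"
    then have "{t \<in> {0..m}. \<rho> \<le> f t} \<subseteq> {s0}"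
      using f_le_R by fastforce
    then have "emeasure lborel {t \<in> {0..m}. \<rho> \<le> f t} \<le> emeasure lborel {s0}"
      by (rule emeasure_mono) simp
    then show False
      using pos by (simp add: emeasure_mu)
  qed
qed

definition J :: "real \<Rightarrow> real" where
  "J \<rho> = enn2real (prof_int m f (kJ \<rho>))"

lemma prof_int_mono_const:
  assumes "\<And>s. 0 \<le> s \<Longrightarrow> s \<le> m \<Longrightarrow> K (f s) \<le> b" "0 \<le> b"
  shows "prof_int m f K \<le> ennreal (b * m)"
proof -
  have "prof_int m f K \<le> (\<integral>\<^sup>+t. ennreal b * indicator {0..m} t \<partial>lborel)"
    unfolding prof_int_def using assms
    by (intro nn_integral_mono) (auto simp: indicator_def intro: ennreal_leI)
  also have "\<dots> = ennreal (b * m)"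
    using m_pos assms(2) by (subst nn_integral_cmult_indicator) (auto simp: ennreal_mult)
  finally show ?thesis .
qed

text \<open>The first bound makes \<open>J\<close> tend to 0 at \<open>R\<close>; the second is
  uniform and makes its limit at 0 finite.\<close>

lemma J_bound:
  assumes "0 < \<rho>" "\<rho> < R"
  shows "prof_int m f (kJ \<rho>) = ennreal (J \<rho>)" "0 \<le> J \<rho>" "J \<rho> \<le> 2 * sqrt (R\<^sup>2 - \<rho>\<^sup>2) / \<rho> * m" "J \<rho> \<le> 2 * m"
proof -
  have "\<rho>\<^sup>2 \<le> R\<^sup>2" using assms by (intro power_mono) auto
  then have 1: "prof_int m f (kJ \<rho>) \<le> ennreal (2 * sqrt (R\<^sup>2 - \<rho>\<^sup>2) / \<rho> * m)"
  proof (intro prof_int_mono_const)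
    fix s assume s: "0 \<le> s" "s \<le> m"
    show "kJ \<rho> (f s) \<le> 2 * sqrt (R\<^sup>2 - \<rho>\<^sup>2) / \<rho>"
    proof (cases "\<rho> < f s")
      case True
      have "(f s)\<^sup>2 \<le> R\<^sup>2"
        using f_le_R(1)[OF s] f_nonneg[OF s] by (intro power_mono)
      moreover have "\<rho>\<^sup>2 \<le> (f s)\<^sup>2"
        using True assms by (intro power_mono) auto
      ultimately show ?thesis
        using True assms unfolding kJ_def by (auto intro!: frac_le)
    qed (use assms \<open>\<rho>\<^sup>2 \<le> R\<^sup>2\<close> in \<open>simp add: kJ_def\<close>)
  qed (use assms in simp)
  have 2: "prof_int m f (kJ \<rho>) \<le> ennreal (2 * m)"
  proof (rule prof_int_mono_const)
    fix s
    show "kJ \<rho> (f s) \<le> 2"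
    proof (cases "\<rho> < f s")
      case True
      have "sqrt ((f s)\<^sup>2 - \<rho>\<^sup>2) \<le> sqrt ((f s)\<^sup>2)"
        by (rule real_sqrt_le_mono) simp
      then show ?thesis
        using True assms by (simp add: kJ_def divide_le_eq)
    qed (simp add: kJ_def)
  qed simp
  have "prof_int m f (kJ \<rho>) < \<infinity>"
    using 2 by (simp add: order_le_less_trans)
  then show "prof_int m f (kJ \<rho>) = ennreal (J \<rho>)" "0 \<le> J \<rho>"
    by (auto simp: J_def)
  then show "J \<rho> \<le> 2 * sqrt (R\<^sup>2 - \<rho>\<^sup>2) / \<rho> * m" "J \<rho> \<le> 2 * m"
    using 1 2 assms m_pos \<open>\<rho>\<^sup>2 \<le> R\<^sup>2\<close> by (auto simp: ennreal_le_iff)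
qed

lemma Theta_pos: "0 < \<rho> \<Longrightarrow> \<rho> < R \<Longrightarrow> 0 < Theta m f \<rho>"
  using orbit.shift_pos orbit.Theta_eq_shift(2) by (metis orbit_axioms.intro orbit_def profile_axioms)

lemma Ell_eq:
  assumes "0 < \<rho>" "\<rho> < R"
  shows "Ell m f \<rho> = J \<rho> + \<rho> * Theta m f \<rho>"
proof -
  have "prof_int m f (kEll \<rho>) = prof_int m f (kJ \<rho>) + prof_int m f (\<lambda>u. kTheta \<rho> u * \<rho>)"
  proof -
    have "prof_int m f (kEll \<rho>) = (\<integral>\<^sup>+s. ennreal (kJ \<rho> (f s)) * indicator {0..m} s
        + ennreal (kTheta \<rho> (f s) * \<rho>) * indicator {0..m} s \<partial>lborel)"
      unfolding prof_int_def kEll_split[OF assms(1)]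
      using kJ_nonneg[OF assms(1)] kTheta_nonneg[OF assms(1)] assms
      by (intro nn_integral_cong) (auto simp: indicator_def)
    then show ?thesis
      unfolding prof_int_def by (subst (asm) nn_integral_add) auto
  qed
  also have "\<dots> = ennreal (J \<rho>) + ennreal (Theta m f \<rho>) * ennreal \<rho>"
    using assms by (simp add: prof_int_cmult J_bound(1) Theta_split(1))
  also have "\<dots> = ennreal (J \<rho> + \<rho> * Theta m f \<rho>)"
    using J_bound(2)[OF assms] Theta_pos[OF assms] assms by (simp add: ennreal_mult mult.commute)
  finally show ?thesis
    unfolding Ell_def using J_bound(2)[OF assms] Theta_pos[OF assms] assms by (metis add_nonneg_nonneg enn2real_ennreal less_imp_le mult_nonneg_nonneg)
qed

lemma Theta_cont: "continuous_on {0<..<R} (Theta m f)"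
  using DERIV_isCont[OF Theta_C1(1)] by (simp add: continuous_at_imp_continuous_on)

text \<open>\<open>J\<close> is a tail integral of \<Theta>; splitting the tail at \<open>b\<close>
  leaves the integral over the middle piece.\<close>

lemma J_diff:
  assumes "0 < a" "a \<le> b" "b < R"
  shows "J a = J b + integral {a..b} (Theta m f)"
proof -
  have [measurable]: "(\<lambda>x. prof_int m f (kTheta x)) \<in> borel_measurable borel"
  proof -
    have [measurable]: "(\<lambda>p. kTheta (fst p) (f (snd p))) \<in> borel_measurable (borel \<Otimes>\<^sub>M lborel)"
      using measurable_compose[OF _ kernel_measurable(1), of "\<lambda>p. (fst p, f (snd p))" "borel \<Otimes>\<^sub>M lborel"] by simp
    show ?thesis
      unfolding prof_int_def by (rule lborel.borel_measurable_nn_integral) (simp add: case_prod_unfold)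
  qed
  have cont: "continuous_on {a..b} (Theta m f)"
    by (rule continuous_on_subset[OF Theta_cont]) (use assms in auto)
  have int: "(Theta m f has_integral integral {a..b} (Theta m f)) {a..b}"
    by (rule integrable_integral[OF integrable_continuous_interval[OF cont]])
  have pos: "0 \<le> Theta m f x" if "x \<in> {a..b}" for x
    using Theta_pos[of x] that assms by auto
  have int_nonneg: "0 \<le> integral {a..b} (Theta m f)"
    by (rule integral_nonneg[OF integrable_continuous_interval[OF cont] pos])
  have "ennreal (J a) = (\<integral>\<^sup>+x. prof_int m f (kTheta x) * indicator {a<..} x \<partial>lborel)"
    using assms by (simp add: prof_int_J J_bound(1))
  also have "\<dots> = (\<integral>\<^sup>+x. prof_int m f (kTheta x) * indicator {a<..b} x + prof_int m f (kTheta x) * indicator {b<..} x \<partial>lborel)"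
    using assms by (intro nn_integral_cong) (auto simp: indicator_def)
  also have "\<dots> = (\<integral>\<^sup>+x. prof_int m f (kTheta x) * indicator {a<..b} x \<partial>lborel) + (\<integral>\<^sup>+x. prof_int m f (kTheta x) * indicator {b<..} x \<partial>lborel)"
    by (rule nn_integral_add) measurable
  also have "(\<integral>\<^sup>+x. prof_int m f (kTheta x) * indicator {b<..} x \<partial>lborel) = ennreal (J b)"
    using assms by (simp add: prof_int_J J_bound(1))
  also have "(\<integral>\<^sup>+x. prof_int m f (kTheta x) * indicator {a<..b} x \<partial>lborel) = (\<integral>\<^sup>+x. ennreal (Theta m f x) * indicator {a..b} x \<partial>lborel)"
  proof (rule nn_integral_cong_AE)
    show "AE x in lborel. prof_int m f (kTheta x) * indicator {a<..b} x = ennreal (Theta m f x) * indicator {a..b} x"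
      using AE_lborel_singleton[of a]
    proof eventually_elim
      case (elim x)
      then show ?case
        using assms Theta_split(1)[of x] by (auto simp: indicator_def)
    qed
  qed
  also have "\<dots> = ennreal (integral {a..b} (Theta m f))"
    by (rule nn_integral_has_integral_lebesgue'[OF pos int])
  also have "\<dots> + ennreal (J b) = ennreal (J b + integral {a..b} (Theta m f))"
    using J_bound(2)[of b] assms int_nonneg by (simp add: add.commute)
  finally show ?thesis
    using J_bound(2)[of a] J_bound(2)[of b] assms int_nonneg
    by (subst (asm) ennreal_inj) auto
qed

lemma J_deriv:
  assumes "0 < x" "x < R"
  shows "(J has_real_derivative - Theta m f x) (at x)"
proof -
  define a b where "a = x / 2" "b = (x + R) / 2"
  have ab: "0 < a" "a < x" "x < b" "b < R"
    using assms by (auto simp: a_b_def)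
  have cont: "continuous_on {a..b} (Theta m f)"
    by (rule continuous_on_subset[OF Theta_cont]) (use ab in auto)
  have "((\<lambda>y. integral {a..y} (Theta m f)) has_real_derivative Theta m f x) (at x within {a..b})"
    by (rule integral_has_real_derivative[OF cont]) (use ab in auto)
  then have "((\<lambda>y. integral {a..y} (Theta m f)) has_real_derivative Theta m f x) (at x)"
    using ab by (simp add: at_within_Icc_at)
  then have "((\<lambda>y. J a - integral {a..y} (Theta m f)) has_real_derivative 0 - Theta m f x) (at x)"
    by (intro derivative_intros)
  then show ?thesis
  proof (rule DERIV_cong_ev[THEN iffD1, rotated -1, OF _ refl])
    have "\<forall>\<^sub>F y in nhds x. y \<in> {a<..<b}"
      using ab by (intro eventually_nhds_in_open) auto
    then show "\<forall>\<^sub>F y in nhds x. J a - integral {a..y} (Theta m f) = J y"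
    proof eventually_elim
      case (elim y)
      then show ?case
        using J_diff[of a y] ab by simp
    qed
  qed simp
qed

lemma front: "\<exists>c. front R (Theta m f) (deriv (Theta m f)) (Ell m f) c"
proof -
  \<comment> \<open>\<open>J\<close> is nonincreasing and bounded, so its limit at 0 is its
    supremum.\<close>
  define c where "c = (SUP \<rho>\<in>{0<..<R}. J \<rho>)"
  have bdd: "bdd_above (J ` {0<..<R})"
    using J_bound(4) by (auto intro!: bdd_aboveI2)
  have mono: "J b \<le> J a" if "0 < a" "a \<le> b" "b < R" for a b
  proof -
    have "0 \<le> integral {a..b} (Theta m f)"
      using Theta_pos that by (intro integral_nonneg integrable_continuous_interval
        continuous_on_subset[OF Theta_cont]) (auto intro: less_imp_le)
    then show ?thesis
      using J_diff[OF that] by simp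
  qed
  have lim0: "(J \<longlongrightarrow> c) (at_right 0)"
  proof (rule increasing_tendsto)
    show "\<forall>\<^sub>F \<rho> in at_right 0. J \<rho> \<le> c"
      unfolding c_def using R_pos
      by (intro eventually_at_rightI[of 0 R]) (auto intro!: cSUP_upper[OF _ bdd])
    fix y assume "y < c"
    then obtain b where b: "0 < b" "b < R" "y < J b"
      using less_cSUP_iff[OF _ bdd, of y] R_pos unfolding c_def by auto
    then show "\<forall>\<^sub>F \<rho> in at_right 0. y < J \<rho>"
      by (intro eventually_at_rightI[of 0 b]) (use b mono in \<open>force intro: less_le_trans[OF b(3)]\<close>)
  qed
  have limR: "(J \<longlongrightarrow> 0) (at_left R)"
  proof (rule tendsto_sandwich[of "\<lambda>\<rho>. 0" _ _ "\<lambda>\<rho>. 2 * sqrt (R\<^sup>2 - \<rho>\<^sup>2) / \<rho> * m"])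
    show "\<forall>\<^sub>F \<rho> in at_left R. 0 \<le> J \<rho>" "\<forall>\<^sub>F \<rho> in at_left R. J \<rho> \<le> 2 * sqrt (R\<^sup>2 - \<rho>\<^sup>2) / \<rho> * m"
      using R_pos J_bound by (auto intro!: eventually_at_leftI[of 0 R])
    have "((\<lambda>\<rho>. 2 * sqrt (R\<^sup>2 - \<rho>\<^sup>2) / \<rho> * m) \<longlongrightarrow> 2 * sqrt (R\<^sup>2 - R\<^sup>2) / R * m) (at_left R)"
      using R_pos by (intro tendsto_intros) auto
    then show "((\<lambda>\<rho>. 2 * sqrt (R\<^sup>2 - \<rho>\<^sup>2) / \<rho> * m) \<longlongrightarrow> 0) (at_left R)"
      by simp
  qed simp
  have eqs: "\<forall>\<^sub>F \<rho> in at_right 0. J \<rho> = Ell m f \<rho> - \<rho> * Theta m f \<rho>"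
    "\<forall>\<^sub>F \<rho> in at_left R. J \<rho> = Ell m f \<rho> - \<rho> * Theta m f \<rho>"
    using Ell_eq R_pos by (auto intro!: eventually_at_rightI[of 0 R] eventually_at_leftI[of 0 R])
  have "front R (Theta m f) (deriv (Theta m f)) (Ell m f) c"
  proof
    show "((\<lambda>x. Ell m f x - x * Theta m f x) \<longlongrightarrow> c) (at_right 0)"
      by (rule Lim_transform_eventually[OF lim0 eqs(1)])
    show "((\<lambda>x. Ell m f x - x * Theta m f x) \<longlongrightarrow> 0) (at_left R)"
      by (rule Lim_transform_eventually[OF limR eqs(2)])
    fix x assume x: "0 < x" "x < R"
    show T: "(Theta m f has_real_derivative deriv (Theta m f) x) (at x)"
      using Theta_C1(1) x by simp
    \<comment> \<open>The derivative of \<open>J\<close> cancels the undifferentiated term of the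
      product rule, leaving the front relation.\<close>
    have "((\<lambda>x. J x + x * Theta m f x) has_real_derivative - Theta m f x + (1 * Theta m f x + deriv (Theta m f) x * x)) (at x)"
      by (intro DERIV_add DERIV_mult J_deriv x T DERIV_ident)
    then have "((\<lambda>x. J x + x * Theta m f x) has_real_derivative x * deriv (Theta m f) x) (at x)"
      by (simp add: mult.commute)
    then show "(Ell m f has_real_derivative x * deriv (Theta m f) x) (at x)"
    proof (rule DERIV_cong_ev[THEN iffD1, rotated -1, OF _ refl])
      have "\<forall>\<^sub>F y in nhds x. y \<in> {0<..<R}"
        using x by (intro eventually_nhds_in_open) auto
      then show "\<forall>\<^sub>F y in nhds x. J y + y * Theta m f y = Ell m f y"
        by eventually_elim (use Ell_eq in auto)
    qed simp
  qed (use R_pos Theta_C1(2) Theta_pos in auto)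
  then show ?thesis ..
qed

end

text \<open>The function \<open>r\<close> is prescribed on \<open>{0..m}\<close> only, so
  derivatives at the ends are taken from its smooth extension. In the interior both have the same
  derivative, hence the same critical point.\<close>

lemma profile_function_obtain:
  assumes "profile_function g m r"
  obtains \<Phi> f s0 where "profile g m \<Phi> f s0" "\<And>s. s \<in> {0..m} \<Longrightarrow> f s = r s"
proof -
  have rest: "0 < m" "\<And>s. s \<in> {0<..<m} \<Longrightarrow> 0 < r s" "r 0 = 0" "r m = 0"
    "\<exists>!s. s \<in> {0<..<m} \<and> deriv r s = 0"
    and ex: "\<exists>\<Phi>. polar_coordinates g m r \<Phi>"
    "\<exists>f. smooth_on f UNIV \<and> (\<forall>s\<in>{0..m}. f s = r s) \<and> (\<forall>s. f (- s) = - f s) \<and>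
      (\<forall>s. f (s + 2 * m) = f s) \<and> deriv f 0 = 1 \<and> deriv f m = -1"
    using assms unfolding profile_function_def by blast+
  obtain \<Phi> where \<Phi>: "polar_coordinates g m r \<Phi>"
    using ex(1) by blast
  obtain f where f: "smooth_on f UNIV" "\<And>s. s \<in> {0..m} \<Longrightarrow> f s = r s" "deriv f 0 = 1" "deriv f m = -1"
    using ex(2) by blast
  obtain s0 where s0: "s0 \<in> {0<..<m}" "deriv r s0 = 0" "\<And>s. s \<in> {0<..<m} \<Longrightarrow> deriv r s = 0 \<Longrightarrow> s = s0"
    using rest(5) by auto
  have d: "deriv f s = deriv r s" if "s \<in> {0<..<m}" for s
  proof (rule deriv_cong_ev)
    have "\<forall>\<^sub>F y in nhds s. y \<in> {0<..<m}"
      using that by (intro eventually_nhds_in_open) auto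
    then show "\<forall>\<^sub>F y in nhds s. f y = r y"
      by eventually_elim (use f(2) in auto)
  qed simp
  have "polar_coordinates g m f \<Phi>"
    using \<Phi> f(2) by (simp add: polar_coordinates_def)
  then have "profile g m \<Phi> f s0"
  proof (rule profile.intro[OF rest(1)])
    show "deriv f s0 = 0" "0 < s0" "s0 < m"
      using d s0(1,2) by auto
    show "s = s0" if "0 < s" "s < m" "deriv f s = 0" for s
      using d[of s] s0(3)[of s] that by simp
    show "0 < f s" if "0 < s" "s < m" for s
      using f(2)[of s] rest(2)[of s] that by simp
    show "f 0 = 0" "f m = 0"
      using f(2) rest(1,3,4) by auto
  qed (fact f)+
  then show thesis using f(2) that by blast
qed

section \<open>Comparison of two profiles\<close>

locale two_profiles = one: profile g1 m1 \<Phi>1 f1 s1 + two: profile g2 m2 \<Phi>2 f2 s2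
  for g1 m1 \<Phi>1 f1 s1 g2 m2 \<Phi>2 f2 s2
begin

lemma mu_eq_iff: "one.mu = two.mu \<longleftrightarrow> (\<forall>\<rho>\<ge>0. emeasure one.mu {\<rho>..} = emeasure two.mu {\<rho>..})"
proof
  assume levels: "\<forall>\<rho>\<ge>0. emeasure one.mu {\<rho>..} = emeasure two.mu {\<rho>..}"
  have "emeasure one.mu {\<rho>..} = emeasure two.mu {\<rho>..}" for \<rho>
    using levels one.emeasure_mu_level_neg[of \<rho>] two.emeasure_mu_level_neg[of \<rho>] by (cases "0 \<le> \<rho>") auto
  then have "emeasure one.mu {x<..} = emeasure two.mu {x<..}" for x
    by (simp add: one.emeasure_mu_gt two.emeasure_mu_gt)
  then show "one.mu = two.mu"
    by (intro measure_eqI_lessThan one.emeasure_mu_finite) (auto simp: one.mu_def two.mu_def)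
qed simp

lemma mu_eq_iff_levels: "one.mu = two.mu \<longleftrightarrow>
  (\<forall>\<rho>\<ge>0. measure lborel {t \<in> {0..m1}. \<rho> \<le> f1 t} = measure lborel {t \<in> {0..m2}. \<rho> \<le> f2 t})"
  by (simp add: mu_eq_iff one.emeasure_mu_level two.emeasure_mu_level)

lemma R_eq:
  assumes "one.mu = two.mu"
  shows "one.R = two.R"
proof (rule ccontr)
  assume "one.R \<noteq> two.R"
  define \<rho> where "\<rho> = (one.R + two.R) / 2"
  have "0 < \<rho>"
    using one.R_pos two.R_pos by (simp add: \<rho>_def)
  then have "\<rho> < one.R \<longleftrightarrow> \<rho> < two.R"
    using one.emeasure_mu_pos[of \<rho>] two.emeasure_mu_pos[of \<rho>] assms by simp
  then show False
    using \<open>one.R \<noteq> two.R\<close> by (auto simp: \<rho>_def)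
qed

lemma prof_int_eq:
  assumes "one.mu = two.mu" "K \<in> borel_measurable borel"
  shows "prof_int m1 f1 K = prof_int m2 f2 K"
  using one.nn_integral_mu[OF assms(2)] two.nn_integral_mu[OF assms(2)] assms(1) by simp

text \<open>Equal rotation functions have equal Abel transforms, so the measures
  \<open>kap s\<close> have equal finite tails and coincide. Removing their density recovers the
  push-forward measure at every positive level.\<close>

lemma mu_eq_if_Theta_eq:
  assumes R: "one.R = two.R"
    and Theta: "\<And>\<rho>. 0 < \<rho> \<Longrightarrow> \<rho> < one.R \<Longrightarrow> Theta m1 f1 \<rho> = Theta m2 f2 \<rho>"
  shows "one.mu = two.mu"
proof -
  have T: "prof_int m1 f1 (kTheta x) = prof_int m2 f2 (kTheta x)" if "0 < x" for x
  proof (cases "x < one.R")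
    case True
    then show ?thesis
      using that Theta R one.Theta_split(1) two.Theta_split(1) by simp
  next
    case False
    then show ?thesis
      using R one.prof_int_kTheta_0[of x] two.prof_int_kTheta_0[of x] by simp
  qed
  have B: "prof_int m1 f1 (kB s) = prof_int m2 f2 (kB s)" if "0 < s" for s
  proof -
    have "prof_int m1 f1 (kTheta x) * ennreal (indicator {s<..} x / sqrt (x\<^sup>2 - s\<^sup>2))
      = prof_int m2 f2 (kTheta x) * ennreal (indicator {s<..} x / sqrt (x\<^sup>2 - s\<^sup>2))" for x
      using T[of x] that by (cases "s < x") auto
    then show ?thesis
      unfolding one.prof_int_Abel[OF that, symmetric] two.prof_int_Abel[OF that, symmetric] by (rule nn_integral_cong)
  qed
  have kap: "one.kap s = two.kap s" if "0 < s" for s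
  proof (rule measure_eqI_lessThan)
    fix x
    have "0 < max s x" using that by simp
    then show "emeasure (one.kap s) {x<..} < \<infinity>" "emeasure (one.kap s) {x<..} = emeasure (two.kap s) {x<..}"
      using one.prof_int_kB_finite B by (simp_all add: one.emeasure_kap two.emeasure_kap that)
  qed (auto simp: one.kap_def two.kap_def)
  have pos: "emeasure one.mu {\<rho>..} = emeasure two.mu {\<rho>..}" if "0 < \<rho>" for \<rho>
    using one.nn_integral_kap[of "\<rho> / 2" \<rho>] two.nn_integral_kap[of "\<rho> / 2" \<rho>] kap[of "\<rho> / 2"] that
    by (simp add: one.emeasure_mu two.emeasure_mu)
  \<comment> \<open>The profile is positive between the poles, so the positive levels already
    determine the total length; this settles level 0.\<close>
  then have "emeasure one.mu {0<..} = emeasure two.mu {0<..}"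
    by (simp add: one.emeasure_mu_gt two.emeasure_mu_gt)
  then have "m1 = m2"
    using one.m_pos two.m_pos by (simp add: one.emeasure_mu_gt_0 two.emeasure_mu_gt_0)
  then show ?thesis
    unfolding mu_eq_iff using pos one.emeasure_mu_level_0 two.emeasure_mu_level_0
    by (metis order_le_less)
qed

lemma isospectral_iff:
  assumes E: "\<exists>!E. is_equator g1 E" "\<exists>!E. is_equator g2 E"
  shows "isospectral g1 g2 \<longleftrightarrow> one.mu = two.mu"
proof
  assume iso: "isospectral g1 g2"
  \<comment> \<open>Equal equator lengths give both fronts the same parameter interval, which the
    comparison of fronts presupposes.\<close>
  then have R: "two.R = one.R"
    using one.equator_length_eq[OF E(1)] two.equator_length_eq[OF E(2)] by (simp add: isospectral_def)
  obtain c1 where c1: "front one.R (Theta m1 f1) (deriv (Theta m1 f1)) (Ell m1 f1) c1"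
    using one.front by blast
  obtain c2 where c2: "front one.R (Theta m2 f2) (deriv (Theta m2 f2)) (Ell m2 f2) c2"
    using two.front unfolding R by blast
  have fronts: "two_fronts one.R (Theta m1 f1) (deriv (Theta m1 f1)) (Ell m1 f1) c1
      (Theta m2 f2) (deriv (Theta m2 f2)) (Ell m2 f2) c2"
  proof (intro two_fronts.intro c1 c2 two_fronts_axioms.intro)
    fix p q :: nat assume pq: "1 \<le> p" "1 \<le> q" "coprime p q"
    then show "front.spectrum one.R (Theta m1 f1) (Ell m1 f1) p q = front.spectrum one.R (Theta m2 f2) (Ell m2 f2) p q"
      using iso one.length_spectrum_eq[OF E(1) pq] two.length_spectrum_eq[OF E(2) pq]
      unfolding front.spectrum_def[OF c1] front.spectrum_def[OF c2] isospectral_def R by simp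
  qed
  show "one.mu = two.mu"
  proof (rule mu_eq_if_Theta_eq)
    show "one.R = two.R" using R by simp
  qed (rule fronts_eq[OF fronts one.Theta_limit two.Theta_limit])
next
  assume mu: "one.mu = two.mu"
  \<comment> \<open>Both functions are the same functionals of the push-forward measure, so they
    agree for all arguments, and then so do the spectra.\<close>
  have "Theta m1 f1 = Theta m2 f2" "Ell m1 f1 = Ell m2 f2"
    by (auto simp: Theta_def[abs_def] Ell_def[abs_def] prof_int_eq[OF mu kernel_measurable(2)] prof_int_eq[OF mu kernel_measurable(3)])
  then show "isospectral g1 g2"
    by (simp add: isospectral_def R_eq[OF mu] one.equator_length_eq[OF E(1)] two.equator_length_eq[OF E(2)]
      one.length_spectrum_eq[OF E(1)] two.length_spectrum_eq[OF E(2)])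
qed

end

theorem theoremB:
  fixes g1 g2 :: metric and m1 m2 :: real and r1 r2 :: "real \<Rightarrow> real"
  assumes "g1 \<in> metrics_unique_equator" and "g2 \<in> metrics_unique_equator"
    and "profile_function g1 m1 r1" and "profile_function g2 m2 r2"
  shows "isospectral g1 g2 \<longleftrightarrow>
    (\<forall>\<rho>\<ge>0. measure lborel {\<sigma> \<in> {0..m1}. r1 \<sigma> \<ge> \<rho>} = measure lborel {\<sigma> \<in> {0..m2}. r2 \<sigma> \<ge> \<rho>})"
proof -
  obtain \<Phi>1 f1 s1 where 1: "profile g1 m1 \<Phi>1 f1 s1" "\<And>s. s \<in> {0..m1} \<Longrightarrow> f1 s = r1 s"
    using profile_function_obtain[OF assms(3)] by blast
  obtain \<Phi>2 f2 s2 where 2: "profile g2 m2 \<Phi>2 f2 s2" "\<And>s. s \<in> {0..m2} \<Longrightarrow> f2 s = r2 s"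
    using profile_function_obtain[OF assms(4)] by blast
  interpret two_profiles g1 m1 \<Phi>1 f1 s1 g2 m2 \<Phi>2 f2 s2
    by (intro two_profiles.intro 1(1) 2(1))
  have "{t \<in> {0..m1}. \<rho> \<le> f1 t} = {t \<in> {0..m1}. \<rho> \<le> r1 t}" "{t \<in> {0..m2}. \<rho> \<le> f2 t} = {t \<in> {0..m2}. \<rho> \<le> r2 t}" for \<rho>
    using 1(2) 2(2) by auto
  then show ?thesis
    using isospectral_iff mu_eq_iff_levels assms(1,2) by (simp add: metrics_unique_equator_def)
qed

end
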